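(* Let $\mathfrak H$ be a Hilbert space, $A$ a nonnegative self-adjoint operator in $\mathfrak H$, and $\mathfrak B$ a Banach space with norm $\|\cdot\|_{\mathfrak B}$ such that $\mathfrak H^{k_1}\subseteq\mathfrak B\subseteq\mathfrak H^{-k_2}$ for some $k_1,k_2\in\mathbb N$, each space continuously and densely embedded in the next. Let $\{m_n\}_{n\in\mathbb N_0}$ be a nondecreasing sequence of positive numbers such that (i) for every $\alpha>0$ there is $c=c(\alpha)>0$ with $m_n\ge c\alpha^n$ for all $n$, and (ii) there exist $c>0,h>1$ with $m_{n+1}\le ch^nm_n$ for all $n$. Let $\tau(\lambda)=\sum_{n\ge0}\lambda^n/m_n$. Then for every weak solution $y\in S$: (a) $y\in C^\infty(\mathbb R_+,\mathfrak H)$ iff for every $\alpha>0$, $\mathcal E_r(y,\mathfrak B)=O(r^{-\alpha})$ as $r\to\infty$; (b) $y\in C_{\{m_n\}}$ iff there exists $\alpha>0$ with $\mathcal E_r(y,\mathfrak B)=O(1/\tau(\alpha r))$ as $r\to\infty$; (c) $y\in C_{(m_n)}$ iff for every $\alpha>0$, $\mathcal E_r(y,\mathfrak B)=O(1/\tau(\alpha r))$ as $r\to\infty$.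
   Context: $e^{-At}=\int_0^\infty e^{-\lambda t}dE(\lambda)$, $E$ the spectral measure of $A$. For $n\in\mathbb N$, $\mathfrak H^n=\mathcal D(A^n)$ with norm $\|f\|_{\mathfrak H^n}=(\|f\|^2+\|A^nf\|^2)^{1/2}$, and $\mathfrak H^{-n}$ is the completion of $\mathfrak H$ in the norm $\|f\|_{\mathfrak H^{-n}}=\|(A+I)^{-n}f\|$. A weak solution of $y'+Ay=0$ on $\mathbb R_+=[0,\infty)$ is a continuous $y:\mathbb R_+\to\mathfrak H$ with $\int_0^ty(s)ds\in\mathcal D(A)$ and $y(t)=-A\int_0^ty(s)ds+y(0)$ for all $t\ge0$. $S$ is the set of weak solutions (each of the form $e^{-At}f$, $f\in\mathfrak H$). $S_0\subset S$: weak solutions extending to entire $\mathfrak H$-valued functions of exponential type, type $\sigma(y)=\inf\{\alpha>0:\exists c,\ \|y(z)\|\le ce^{\alpha|z|}\}$. $\mathcal E_r(y,\mathfrak B)=\inf_{y_0\in S_0,\ \sigma(y_0)\le r}\sup_{s\ge0}\|y(s)-y_0(s)\|_{\mathfrak B}$. For $\alpha>0$, $C^\alpha_{m_n}=\{y\in C^\infty(\mathbb R_+,\mathfrak H):\exists c>0\ \forall k\in\mathbb N_0,\ \sup_{t\ge0}\|y^{(k)}(t)\|\le cm_k\alpha^k\}$; $C_{\{m_n\}}=\bigcup_{\alpha>0}C^\alpha_{m_n}$, $C_{(m_n)}=\bigcap_{\alpha>0}C^\alpha_{m_n}$. *)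

theory Defs
  imports "HOL-Analysis.Analysis"
begin

text \<open>A complex Hilbert space is a real Hilbert space (real inner product = real part of the
complex inner product) together with the isometric real-linear map J = multiplication by i.\<close>

definition cplx_structure :: "('h::real_inner \<Rightarrow> 'h) \<Rightarrow> bool" where
  "cplx_structure J \<longleftrightarrow> linear J \<and> (\<forall>x. J (J x) = - x) \<and> (\<forall>x y. inner (J x) (J y) = inner x y)"

definition cscale :: "('h::real_vector \<Rightarrow> 'h) \<Rightarrow> complex \<Rightarrow> 'h \<Rightarrow> 'h" where
  "cscale J z x = Re z *\<^sub>R x + Im z *\<^sub>R J x"

text \<open>An operator is given by its domain D and its action A (values of A outside D are irrelevant).\<close>

definition nonneg_selfadjoint :: "('h::real_inner \<Rightarrow> 'h) \<Rightarrow> 'h set \<Rightarrow> ('h \<Rightarrow> 'h) \<Rightarrow> bool" where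
  "nonneg_selfadjoint J D A \<longleftrightarrow>
     subspace D \<and> (\<forall>x\<in>D. J x \<in> D) \<and> closure D = UNIV \<and>
     (\<forall>x\<in>D. \<forall>y\<in>D. A (x + y) = A x + A y) \<and>
     (\<forall>x\<in>D. \<forall>c. A (c *\<^sub>R x) = c *\<^sub>R A x) \<and>
     (\<forall>x\<in>D. A (J x) = J (A x)) \<and>
     (\<forall>x\<in>D. \<forall>y\<in>D. inner (A x) y = inner x (A y)) \<and>
     (\<forall>y z. (\<forall>x\<in>D. inner (A x) y = inner x z) \<longrightarrow> y \<in> D) \<and>
     (\<forall>x\<in>D. inner (A x) x \<ge> 0)"

fun dom_pow :: "'h set \<Rightarrow> ('h \<Rightarrow> 'h) \<Rightarrow> nat \<Rightarrow> 'h set" where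
  "dom_pow D A 0 = UNIV"
| "dom_pow D A (Suc n) = {x \<in> D. A x \<in> dom_pow D A n}"

definition Hpos_norm :: "('h::real_normed_vector \<Rightarrow> 'h) \<Rightarrow> nat \<Rightarrow> 'h \<Rightarrow> real" where
  "Hpos_norm A n f = sqrt ((norm f)\<^sup>2 + (norm ((A ^^ n) f))\<^sup>2)"

definition resolv :: "'h set \<Rightarrow> ('h::real_vector \<Rightarrow> 'h) \<Rightarrow> 'h \<Rightarrow> 'h" where
  "resolv D A f = (THE g. g \<in> D \<and> A g + g = f)"

text \<open>e : H \<rightarrow> Hneg realises H^(-n) as a completion of H in the norm ||(A+I)^(-n) f||:
  isometric for that norm, linear, with dense range in the Banach space Hneg.\<close>
definition is_Hneg_completion ::
  "'h set \<Rightarrow> ('h::real_normed_vector \<Rightarrow> 'h) \<Rightarrow> nat \<Rightarrow> ('h \<Rightarrow> 'c::banach) \<Rightarrow> bool" where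
  "is_Hneg_completion D A n e \<longleftrightarrow>
     linear e \<and> (\<forall>f. norm (e f) = norm ((resolv D A ^^ n) f)) \<and> closure (range e) = UNIV"

text \<open>The Banach space B (via an injective map j into H^(-k2)) with
  H^k1 \<subseteq> B \<subseteq> H^(-k2), each continuously and densely embedded in the next.\<close>
definition B_between ::
  "'h set \<Rightarrow> ('h::real_normed_vector \<Rightarrow> 'h) \<Rightarrow> nat \<Rightarrow> ('h \<Rightarrow> 'c::banach) \<Rightarrow> ('b::banach \<Rightarrow> 'c) \<Rightarrow> bool" where
  "B_between D A k1 e j \<longleftrightarrow>
     linear j \<and> inj j \<and> (\<exists>C. \<forall>b. norm (j b) \<le> C * norm b) \<and> closure (range j) = UNIV \<and>
     (\<forall>f\<in>dom_pow D A k1. e f \<in> range j) \<and>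
     (\<exists>C. \<forall>f\<in>dom_pow D A k1. norm (THE b. j b = e f) \<le> C * Hpos_norm A k1 f) \<and>
     closure {b. \<exists>f\<in>dom_pow D A k1. j b = e f} = UNIV"

definition Bnorm :: "('h \<Rightarrow> 'c) \<Rightarrow> ('b::real_normed_vector \<Rightarrow> 'c) \<Rightarrow> 'h \<Rightarrow> ereal" where
  "Bnorm e j f = (if \<exists>b. j b = e f then ereal (norm (THE b. j b = e f)) else \<infinity>)"

section \<open>Weak solutions of y' + Ay = 0 on [0,\<infinity>)\<close>

definition weak_sol :: "'h set \<Rightarrow> ('h::real_normed_vector \<Rightarrow> 'h) \<Rightarrow> (real \<Rightarrow> 'h) \<Rightarrow> bool" where
  "weak_sol D A y \<longleftrightarrow> continuous_on {0..} y \<and>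
     (\<forall>t\<ge>0. integral {0..t} y \<in> D \<and> y t = - A (integral {0..t} y) + y 0)"

definition entire_J :: "('h::real_normed_vector \<Rightarrow> 'h) \<Rightarrow> (complex \<Rightarrow> 'h) \<Rightarrow> bool" where
  "entire_J J F \<longleftrightarrow> (\<forall>z. \<exists>v. (F has_derivative (\<lambda>w. cscale J w v)) (at z))"

definition exp_type_set :: "(complex \<Rightarrow> 'h::real_normed_vector) \<Rightarrow> real set" where
  "exp_type_set F = {\<alpha>. \<alpha> > 0 \<and> (\<exists>c. \<forall>z. norm (F z) \<le> c * exp (\<alpha> * cmod z))}"

definition exp_type :: "(complex \<Rightarrow> 'h::real_normed_vector) \<Rightarrow> real" where
  "exp_type F = Inf (exp_type_set F)"

definition S0_le :: "('h \<Rightarrow> 'h) \<Rightarrow> 'h set \<Rightarrow> ('h::real_normed_vector \<Rightarrow> 'h) \<Rightarrow> real \<Rightarrow> (real \<Rightarrow> 'h) set" where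
  "S0_le J D A r = {y0. weak_sol D A y0 \<and>
     (\<exists>F. entire_J J F \<and> (\<forall>t\<ge>0. F (complex_of_real t) = y0 t) \<and>
          exp_type_set F \<noteq> {} \<and> exp_type F \<le> r)}"

definition best_approx :: "('h \<Rightarrow> 'h) \<Rightarrow> 'h set \<Rightarrow> ('h::real_normed_vector \<Rightarrow> 'h) \<Rightarrow>
    ('h \<Rightarrow> 'c) \<Rightarrow> ('b::real_normed_vector \<Rightarrow> 'c) \<Rightarrow> (real \<Rightarrow> 'h) \<Rightarrow> real \<Rightarrow> ereal" where
  "best_approx J D A e j y r = (INF y0 \<in> S0_le J D A r. SUP s \<in> {0..}. Bnorm e j (y s - y0 s))"

definition derivs_on :: "(real \<Rightarrow> 'h::real_normed_vector) \<Rightarrow> (nat \<Rightarrow> real \<Rightarrow> 'h) \<Rightarrow> bool" where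
  "derivs_on y Dy \<longleftrightarrow> (\<forall>t\<ge>0. Dy 0 t = y t) \<and>
     (\<forall>n. \<forall>t\<ge>0. (Dy n has_vector_derivative Dy (Suc n) t) (at t within {0..}))"

definition C_infty :: "(real \<Rightarrow> 'h::real_normed_vector) \<Rightarrow> bool" where
  "C_infty y \<longleftrightarrow> (\<exists>Dy. derivs_on y Dy)"

definition C_alpha :: "(nat \<Rightarrow> real) \<Rightarrow> real \<Rightarrow> (real \<Rightarrow> 'h::real_normed_vector) \<Rightarrow> bool" where
  "C_alpha m \<alpha> y \<longleftrightarrow> (\<exists>Dy. derivs_on y Dy \<and>
     (\<exists>c>0. \<forall>k. \<forall>t\<ge>0. norm (Dy k t) \<le> c * m k * \<alpha> ^ k))"

definition C_roumieu :: "(nat \<Rightarrow> real) \<Rightarrow> (real \<Rightarrow> 'h::real_normed_vector) \<Rightarrow> bool" where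
  "C_roumieu m y \<longleftrightarrow> (\<exists>\<alpha>>0. C_alpha m \<alpha> y)"

definition C_beurling :: "(nat \<Rightarrow> real) \<Rightarrow> (real \<Rightarrow> 'h::real_normed_vector) \<Rightarrow> bool" where
  "C_beurling m y \<longleftrightarrow> (\<forall>\<alpha>>0. C_alpha m \<alpha> y)"

definition tau :: "(nat \<Rightarrow> real) \<Rightarrow> real \<Rightarrow> real" where
  "tau m x = (\<Sum>n. x ^ n / m n)"

definition bigO_top :: "(real \<Rightarrow> ereal) \<Rightarrow> (real \<Rightarrow> real) \<Rightarrow> bool" where
  "bigO_top E g \<longleftrightarrow> (\<exists>C. eventually (\<lambda>r. E r \<le> ereal (C * g r)) at_top)"

end

theory Submission
  imports Defs "HOL-Complex_Analysis.Complex_Analysis"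
begin

text \<open>Put \<open>R = (A + I)\<^sup>-\<^sup>1\<close>. The spectral theorem is replaced by the closed subspaces \<open>M \<rho>\<close> of
  vectors \<open>v\<close> with \<open>norm ((A + I)\<^sup>k v) = O(\<rho>\<^sup>k)\<close>. By log-convexity of \<open>k \<mapsto> norm ((A + I)\<^sup>k v)\<close> the
  operator \<open>A + I\<close> is bounded by \<open>\<rho>\<close> on \<open>M \<rho>\<close>, and a weak compactness argument shows that it is
  bounded below by \<open>\<rho>\<close> on the orthogonal complement. So the orthogonal projection \<open>P \<rho>\<close> onto \<open>M \<rho>\<close>
  serves as a spectral projection.

  Orbits of vectors of \<open>M \<rho>\<close> are entire of type at most \<open>\<rho>\<close>; conversely (Cauchy's inequality) an
  entire orbit of type \<open>r\<close> starts in \<open>M (8 * (r + 1))\<close>. Best approximation in \<open>B\<close> is therefore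
  controlled, up to constant factors in \<open>r\<close>, from above by \<open>norm (A\<^sup>i (f - P r f))\<close> with \<open>i = 0, k1\<close> and
  from below by \<open>norm (R\<^sup>k\<^sup>2 (f - P r f))\<close>, where \<open>f = y 0\<close>. The first is at most
  \<open>(2 / r)\<^sup>n * norm (A\<^sup>n\<^sup>+\<^sup>i f)\<close> for every \<open>n\<close>, and decay of the second gives bounds on \<open>norm (A\<^sup>n f)\<close> by
  summing over dyadic frequency blocks. Passing between \<open>m\<close> and \<open>tau m\<close> costs only constants, and
  condition (ii) absorbs the shifts of the index by \<open>k1\<close> and \<open>k2 + 1\<close>.\<close>

section \<open>Complete normed and inner product spaces\<close>

text \<open>A weak solution is never identified with a semigroup orbit. Uniformity in time comes
  from contractivity of solutions: the supremum over \<open>s\<close> is bounded above by data at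
  time \<open>0\<close>, while the lower estimate looks at \<open>s = 0\<close> only. The obstacle
  is that a weak solution need not take values in \<open>D\<close>; equations involving
  \<open>A\<close> are therefore first smoothed by \<open>R\<close> or by a frequency cutoff, or
  tested against vectors of \<open>D\<close>. The link between exponential type and \<open>M\<close>
  is deliberately lossy. A competitor of type \<open>r\<close> is only placed in
  \<open>M (8 * (r + 1))\<close>, contained in \<open>M (16 * r)\<close> for
  \<open>r \<ge> 1\<close>, and the end of the next dyadic block turns 16 into 32. Such factors
  rescale \<open>r\<close>: in the power case they disappear in the constant, in the
  \<open>tau\<close> cases in the free parameter \<alpha>. The extra 1 in the index shift
  \<open>k2 + 1\<close> pays for summing the dyadic blocks: it leaves a geometric factor
  \<open>(1/2) ^ i\<close> after all powers of the frequency have been spent.\<close>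

text \<open>The sort \<open>{real_normed_vector, complete_space}\<close> does not entail the class \<open>banach\<close>, although it
  has the same axioms. Facts about Banach spaces are transported through an isometric copy.\<close>

typedef 'a banach_copy = "UNIV :: 'a set" morphisms of_copy to_copy
  by simp

setup_lifting type_definition_banach_copy

instantiation banach_copy :: (real_normed_vector) real_normed_vector
begin

lift_definition zero_banach_copy :: "'a banach_copy" is 0 .
lift_definition plus_banach_copy :: "'a banach_copy \<Rightarrow> 'a banach_copy \<Rightarrow> 'a banach_copy" is "(+)" .
lift_definition minus_banach_copy :: "'a banach_copy \<Rightarrow> 'a banach_copy \<Rightarrow> 'a banach_copy" is "(-)" .
lift_definition uminus_banach_copy :: "'a banach_copy \<Rightarrow> 'a banach_copy" is "uminus" .
lift_definition scaleR_banach_copy :: "real \<Rightarrow> 'a banach_copy \<Rightarrow> 'a banach_copy" is "(*\<^sub>R)" .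
lift_definition norm_banach_copy :: "'a banach_copy \<Rightarrow> real" is norm .
lift_definition dist_banach_copy :: "'a banach_copy \<Rightarrow> 'a banach_copy \<Rightarrow> real" is dist .
lift_definition sgn_banach_copy :: "'a banach_copy \<Rightarrow> 'a banach_copy" is sgn .
definition uniformity_banach_copy :: "('a banach_copy \<times> 'a banach_copy) filter"
  where "uniformity_banach_copy = (INF e\<in>{0<..}. principal {(x, y). dist x y < e})"
definition open_banach_copy :: "'a banach_copy set \<Rightarrow> bool"
  where "open_banach_copy U \<longleftrightarrow> (\<forall>x\<in>U. eventually (\<lambda>(x', y). x' = x \<longrightarrow> y \<in> U) uniformity)"

instance
  by standard
    (simp_all only: uniformity_banach_copy_def open_banach_copy_def,
     (transfer, simp add: algebra_simps norm_triangle_ineq dist_norm sgn_div_norm)+)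

end

lemma norm_of_copy: "norm (of_copy x) = norm x"
  by transfer simp

lemma bounded_linear_of_copy: "bounded_linear of_copy"
  by (rule bounded_linear_intro[where K = 1]) (transfer, simp)+

lemma bounded_linear_to_copy: "bounded_linear to_copy"
  by (rule bounded_linear_intro[where K = 1])
    (metis UNIV_I to_copy_inverse of_copy_inject plus_banach_copy.rep_eq
      scaleR_banach_copy.rep_eq norm_banach_copy.rep_eq mult_1_right order_refl)+

instance banach_copy :: ("{real_normed_vector, complete_space}") banach
proof
  fix X :: "nat \<Rightarrow> 'a banach_copy"
  assume "Cauchy X"
  then have "Cauchy (\<lambda>n. of_copy (X n))"
    by (rule bounded_linear.Cauchy[OF bounded_linear_of_copy])
  then obtain l where "(\<lambda>n. of_copy (X n)) \<longlonglongrightarrow> l"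
    using Cauchy_convergent convergent_def by blast
  then have "(\<lambda>n. to_copy (of_copy (X n))) \<longlonglongrightarrow> to_copy l"
    by (rule bounded_linear.tendsto[OF bounded_linear_to_copy])
  then show "convergent X"
    by (auto simp: of_copy_inverse convergent_def)
qed

lemma of_to_copy [simp]: "of_copy (to_copy x) = x"
  by (simp add: to_copy_inverse)

lemma has_integral_to_copy:
  fixes f :: "real \<Rightarrow> 'a::{real_normed_vector, complete_space}"
  assumes "continuous_on {a..b} f"
  shows "(f has_integral of_copy (integral {a..b} (to_copy \<circ> f))) {a..b}"
proof -
  have "continuous_on {a..b} (to_copy \<circ> f)"
    unfolding o_def by (intro bounded_linear.continuous_on[OF bounded_linear_to_copy] assms)
  then have "(to_copy \<circ> f) integrable_on {a..b}"
    by (rule integrable_continuous_interval)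
  from has_integral_linear[OF integrable_integral[OF this] bounded_linear_of_copy]
  show ?thesis by (simp add: o_def)
qed

lemma integrable_continuous_complete:
  fixes f :: "real \<Rightarrow> 'a::{real_normed_vector, complete_space}"
  assumes "continuous_on {a..b} f"
  shows "f integrable_on {a..b}"
  using has_integral_to_copy[OF assms] by blast

lemma integral_has_vector_derivative_complete:
  fixes f :: "real \<Rightarrow> 'a::{real_normed_vector, complete_space}"
  assumes f: "continuous_on {a..b} f" and x: "x \<in> {a..b}"
  shows "((\<lambda>u. integral {a..u} f) has_vector_derivative f x) (at x within {a..b})"
proof -
  have c: "continuous_on {a..b} (to_copy \<circ> f)"
    unfolding o_def by (intro bounded_linear.continuous_on[OF bounded_linear_to_copy] f)
  have "((\<lambda>u. of_copy (integral {a..u} (to_copy \<circ> f))) has_vector_derivative of_copy ((to_copy \<circ> f) x))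
      (at x within {a..b})"
    by (rule bounded_linear.has_vector_derivative[OF bounded_linear_of_copy
          integral_has_vector_derivative[OF c x]])
  then have "((\<lambda>u. of_copy (integral {a..u} (to_copy \<circ> f))) has_vector_derivative f x)
      (at x within {a..b})" by simp
  then show ?thesis
  proof (rule has_vector_derivative_transform[OF x, rotated])
    fix u assume "u \<in> {a..b}"
    then have "continuous_on {a..u} f"
      by (intro continuous_on_subset[OF f]) auto
    from has_integral_to_copy[OF this]
    show "integral {a..u} f = of_copy (integral {a..u} (to_copy \<circ> f))"
      by (rule integral_unique)
  qed
qed

lemma fundamental_theorem_of_calculus_complete:
  fixes f :: "real \<Rightarrow> 'a::{real_normed_vector, complete_space}"
  assumes "a \<le> b"
    and "\<And>x. x \<in> {a..b} \<Longrightarrow> (f has_vector_derivative f' x) (at x within {a..b})"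
  shows "(f' has_integral (f b - f a)) {a..b}"
proof -
  have "((to_copy \<circ> f') has_integral ((to_copy \<circ> f) b - (to_copy \<circ> f) a)) {a..b}"
    by (rule fundamental_theorem_of_calculus)
      (auto simp: o_def intro!: bounded_linear.has_vector_derivative[OF bounded_linear_to_copy] assms)
  from has_integral_linear[OF this bounded_linear_of_copy]
  show ?thesis
    by (simp add: o_def minus_banach_copy.rep_eq)
qed

lemma summable_norm_complete:
  fixes f :: "nat \<Rightarrow> 'a::{real_normed_vector, complete_space}"
  assumes "summable (\<lambda>n. norm (f n))"
  shows "summable f"
proof -
  have "summable (\<lambda>n. norm (to_copy (f n)))"
    using assms by (simp add: norm_of_copy[symmetric])
  then have "summable (\<lambda>n. to_copy (f n))"
    by (rule summable_norm_cancel)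
  from bounded_linear.summable[OF bounded_linear_of_copy this]
  show ?thesis by simp
qed

text \<open>This takes the place of weak sequential compactness of balls.\<close>

lemma nested_convex_sets:
  fixes C :: "nat \<Rightarrow> 'a::{real_inner, complete_space} set"
  assumes cl: "\<And>n. closed (C n)" and cv: "\<And>n. convex (C n)" and ne: "\<And>n. C n \<noteq> {}"
    and dec: "\<And>n. C (Suc n) \<subseteq> C n" and bd: "bounded (C 0)"
  shows "\<exists>x. \<forall>n. x \<in> C n"
proof -
  have sub: "C m \<subseteq> C n" if "n \<le> m" for m n
    using lift_Suc_antimono_le[of C, OF dec that] .
  obtain B where B: "\<And>x. x \<in> C 0 \<Longrightarrow> norm x \<le> B"
    using bd bounded_iff by metis
  define d where "d n = Inf ((\<lambda>x. (norm x)\<^sup>2) ` C n)" for n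
  have bb: "bdd_below ((\<lambda>x. (norm x)\<^sup>2) ` C n)" for n
    by (rule bdd_belowI[of _ 0]) auto
  have dle: "d n \<le> (norm x)\<^sup>2" if "x \<in> C n" for x n
    unfolding d_def by (rule cInf_lower) (use that bb in auto)
  have "\<exists>x. x \<in> C n \<and> (norm x)\<^sup>2 < d n + 1 / Suc n" for n
  proof -
    have "Inf ((\<lambda>x. (norm x)\<^sup>2) ` C n) < d n + 1 / Suc n"
      by (simp add: d_def)
    then show ?thesis
      using cInf_lessD[of "(\<lambda>x. (norm x)\<^sup>2) ` C n"] ne by auto
  qed
  then obtain X where X: "\<And>n. X n \<in> C n" "\<And>n. (norm (X n))\<^sup>2 < d n + 1 / Suc n"
    by metis
  have dmono: "d n \<le> d m" if "n \<le> m" for n m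
    unfolding d_def by (rule cInf_superset_mono) (use ne bb sub[OF that] in auto)
  have dB: "d n \<le> B\<^sup>2" for n
  proof -
    have "X n \<in> C 0" using X sub by blast
    then have "(norm (X n))\<^sup>2 \<le> B\<^sup>2"
      using B by (intro power_mono) auto
    then show ?thesis using dle[OF X(1)[of n]] by simp
  qed
  obtain L where L: "d \<longlonglongrightarrow> L"
    using incseq_convergent[of d "B\<^sup>2"] dmono dB unfolding incseq_def by metis
  define w where "w n = 1 / real (Suc n)" for n
  \<comment> \<open>Parallelogram identity: the midpoint of \<open>X n\<close> and
    \<open>X m\<close> still lies in \<open>C n\<close>, so its squared norm is at least
    \<open>d n\<close>. Near-minimal points are thus close to each other once the increasing bounded
    sequence \<open>d\<close> has almost converged.\<close>
  have par: "(norm (X n - X m))\<^sup>2 \<le> 2 * (d m - d n) + 4 * w n" if nm: "n \<le> m" for n m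
  proof -
    have "(1/2) *\<^sub>R X n + (1/2) *\<^sub>R X m \<in> C n"
      using cv[of n] X sub[OF nm] unfolding convex_def
      by (metis add_divide_distrib div_self divide_nonneg_nonneg le_numeral_extra(4) subsetD zero_le_numeral zero_le_one one_add_one zero_neq_numeral)
    then have "d n \<le> (norm ((1/2) *\<^sub>R X n + (1/2) *\<^sub>R X m))\<^sup>2"
      by (rule dle)
    moreover have "(norm (X n - X m))\<^sup>2 =
        2 * (norm (X n))\<^sup>2 + 2 * (norm (X m))\<^sup>2 - 4 * (norm ((1/2) *\<^sub>R X n + (1/2) *\<^sub>R X m))\<^sup>2"
      by (simp add: power2_norm_eq_inner algebra_simps inner_commute)
    moreover have "w m \<le> w n"
      unfolding w_def using nm by (intro divide_left_mono) auto
    ultimately show ?thesis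
      using X(2)[of n, folded w_def] X(2)[of m, folded w_def] by (simp add: algebra_simps)
  qed
  have "Cauchy X"
  proof (rule CauchyI')
    fix e :: real assume e: "e > 0"
    have "(\<lambda>n. 2 * (L - d n) + 4 * w n) \<longlonglongrightarrow> 2 * (L - L) + 4 * 0"
      unfolding w_def by (intro tendsto_intros L LIMSEQ_Suc[OF lim_const_over_n])
    then have "\<forall>\<^sub>F n in sequentially. 2 * (L - d n) + 4 * w n < e\<^sup>2"
      using e by (intro order_tendstoD) auto
    then obtain N where N: "\<And>n. n \<ge> N \<Longrightarrow> 2 * (L - d n) + 4 * w n < e\<^sup>2"
      by (auto simp: eventually_sequentially)
    have dL: "d m \<le> L" for m
      using LIMSEQ_le_const[OF L, of "d m"] dmono by blast
    show "\<exists>M. \<forall>m\<ge>M. \<forall>n>m. dist (X m) (X n) < e"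
    proof (intro exI allI impI)
      fix m n assume "m \<ge> N" "n > m"
      then have "(norm (X m - X n))\<^sup>2 < e\<^sup>2"
        using par[of m n] N[of m] dL[of n] by simp
      then show "dist (X m) (X n) < e"
        using e by (simp add: dist_norm power2_less_imp_less)
    qed
  qed
  then obtain x where x: "X \<longlonglongrightarrow> x"
    using Cauchy_convergent convergent_def by blast
  have "x \<in> C n" for n
  proof (rule closed_sequentially[OF cl])
    show "X (k + n) \<in> C n" for k using X sub[of n "k + n"] by auto
    show "(\<lambda>k. X (k + n)) \<longlonglongrightarrow> x" using x by (rule LIMSEQ_ignore_initial_segment)
  qed
  then show ?thesis by blast
qed

text \<open>At \<open>t = inner v m / inner m m\<close> the squared norm on the right has dropped by
  \<open>(inner v m)\<^sup>2 / inner m m\<close>; minimality forces this amount to vanish.\<close>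

lemma orthogonal_if_minimal:
  fixes v m :: "'a::real_inner"
  assumes "\<And>t. norm v \<le> norm (v - t *\<^sub>R m)"
  shows "inner v m = 0"
proof (cases "m = 0")
  case False
  define t where "t = inner v m / inner m m"
  have mm: "inner m m > 0" using False by simp
  have "(norm v)\<^sup>2 \<le> (norm (v - t *\<^sub>R m))\<^sup>2"
    using assms[of t] by (intro power_mono) auto
  also have "\<dots> = inner v v - 2 * t * inner v m + t * (t * inner m m)"
    by (simp add: power2_norm_eq_inner inner_diff_left inner_diff_right inner_commute)
  also have "\<dots> = (norm v)\<^sup>2 - (inner v m)\<^sup>2 / inner m m"
    using mm by (simp add: power2_norm_eq_inner[symmetric] t_def power2_eq_square[of "inner v m"])
  finally have "(inner v m)\<^sup>2 / inner m m \<le> 0" by simp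
  then show ?thesis using mm
    by (simp add: divide_le_0_iff)
qed simp

text \<open>The points of \<open>M\<close> at distance at most
  \<open>infdist x M + 1 / Suc n\<close> from \<open>x\<close> form nested bounded closed convex
  sets; a common point attains the distance, and \<open>orthogonal_if_minimal\<close> applies to
  it.\<close>

lemma closed_subspace_projection:
  fixes M :: "'a::{real_inner, complete_space} set"
  assumes cl: "closed M" and sub: "subspace M"
  shows "\<exists>p\<in>M. \<forall>m\<in>M. inner (x - p) m = 0"
proof -
  have ne: "M \<noteq> {}" using subspace_0[OF sub] by blast
  define C where "C n = M \<inter> cball x (infdist x M + 1 / real (Suc n))" for n
  have "\<exists>p. \<forall>n. p \<in> C n"
  proof (rule nested_convex_sets)
    fix n
    show "closed (C n)" unfolding C_def using cl by auto
    show "convex (C n)" unfolding C_def using sub by (auto intro: convex_Int subspace_imp_convex)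
    have "infdist x M < infdist x M + 1 / real (Suc n)" by simp
    then obtain m where "m \<in> M" "dist x m < infdist x M + 1 / real (Suc n)"
      using cInf_lessD[of "dist x ` M"] ne infdist_notempty[OF ne, of x] by (metis (no_types, lifting) imageE image_is_empty)
    then show "C n \<noteq> {}" unfolding C_def by force
    have "1 / real (Suc (Suc n)) \<le> 1 / real (Suc n)"
      by (intro divide_left_mono) auto
    then show "C (Suc n) \<subseteq> C n" unfolding C_def
      by (intro Int_mono order_refl subset_cball add_left_mono)
    show "bounded (C 0)" unfolding C_def by (auto intro: bounded_Int)
  qed
  then obtain p where p: "\<And>n. p \<in> C n" by blast
  have pM: "p \<in> M" using p[of 0] by (simp add: C_def)
  have "dist x p \<le> infdist x M + 1 / real (Suc n)" for n using p[of n] by (simp add: C_def)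
  moreover have "(\<lambda>n. infdist x M + 1 / real (Suc n)) \<longlonglongrightarrow> infdist x M + 0"
    by (intro tendsto_intros LIMSEQ_Suc[OF lim_const_over_n])
  ultimately have pmin: "dist x p \<le> infdist x M"
    by (intro LIMSEQ_le_const[of _ "infdist x M" "dist x p"]) auto
  have "inner (x - p) m = 0" if m: "m \<in> M" for m
  proof (rule orthogonal_if_minimal)
    fix t
    have "p + t *\<^sub>R m \<in> M" using sub pM m by (simp add: subspace_add subspace_scale)
    then have "dist x p \<le> dist x (p + t *\<^sub>R m)"
      using pmin infdist_le order_trans by blast
    then show "norm (x - p) \<le> norm (x - p - t *\<^sub>R m)"
      by (simp add: dist_norm algebra_simps)
  qed
  with pM show ?thesis by blast
qed

section \<open>Spectral subspaces of a nonnegative self-adjoint operator\<close>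

text \<open>A maximum above \<open>C\<close> would be attained strictly inside
  \<open>{0..N}\<close>. At the least index where it is attained, log-convexity makes the preceding
  term just as large, a contradiction.\<close>

lemma log_convex_bounded_between:
  fixes a :: "nat \<Rightarrow> real"
  assumes nn: "\<And>i. 0 \<le> a i" and lc: "\<And>i. (a (Suc i))\<^sup>2 \<le> a i * a (Suc (Suc i))"
    and "a 0 \<le> C" "a N \<le> C" "i \<le> N"
  shows "a i \<le> C"
proof (rule ccontr)
  assume "\<not> a i \<le> C"
  have fin: "finite (a ` {..N})" by simp
  define m where "m = Max (a ` {..N})"
  have mge: "a k \<le> m" if "k \<le> N" for k unfolding m_def using that by (intro Max_ge) auto
  have "m \<in> a ` {..N}" unfolding m_def by (intro Max_in) auto
  then have ex: "\<exists>k. k \<le> N \<and> a k = m" by auto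
  define k where "k = (LEAST k. k \<le> N \<and> a k = m)"
  have k: "k \<le> N" "a k = m" using LeastI_ex[OF ex] by (auto simp: k_def)
  have kl: "a l \<noteq> m" if "l < k" for l
    using that k(1) not_less_Least[of l "\<lambda>k. k \<le> N \<and> a k = m"] by (auto simp: k_def)
  have "m > C" using mge[OF assms(5)] \<open>\<not> a i \<le> C\<close> by simp
  then have "k \<noteq> 0" "k \<noteq> N" using k(2) assms(3,4) by (metis leD)+
  then obtain l where l: "k = Suc l" "Suc k \<le> N" using k(1) by (metis Suc_leI le_neq_implies_less not0_implies_Suc)
  have m0: "m > 0" using \<open>m > C\<close> nn[of 0] assms(3) by linarith
  have "m * m \<le> a l * a (Suc k)" using lc[of l] l k by (simp add: power2_eq_square)
  also have "\<dots> \<le> a l * m" using mge[OF l(2)] nn by (intro mult_left_mono) auto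
  finally have "m \<le> a l" using m0 by simp
  moreover have "a l \<le> m" using mge l k by auto
  ultimately show False using kl[of l] l by simp
qed

text \<open>Ratios of successive terms are nondecreasing, so a first ratio \<open>q > r\<close>
  would force growth like \<open>q ^ i\<close>, against the bound. The constant \<open>C\<close>
  thereby disappears from the conclusion.\<close>

lemma log_convex_growth:
  fixes a :: "nat \<Rightarrow> real"
  assumes nn: "\<And>i. 0 \<le> a i" and lc: "\<And>i. (a (Suc i))\<^sup>2 \<le> a i * a (Suc (Suc i))"
    and r: "r > 0" and bd: "\<And>i. a i \<le> C * r ^ i"
  shows "a 1 \<le> r * a 0"
proof (rule ccontr)
  assume n: "\<not> a 1 \<le> r * a 0"
  have a0: "a 0 > 0"
  proof (rule ccontr)
    assume "\<not> a 0 > 0"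
    then have "a 0 = 0" using nn[of 0] by simp
    then have "a 1 = 0" using lc[of 0] by simp
    then show False using n \<open>a 0 = 0\<close> by simp
  qed
  define q where "q = a 1 / a 0"
  have q: "q > r" using n a0 by (simp add: q_def field_simps)
  have step: "a (Suc i) \<ge> q * a i \<and> a i > 0" for i
  proof (induction i)
    case 0 show ?case using a0 by (simp add: q_def)
  next
    case (Suc i)
    have "q * a i > 0" using q r Suc by simp
    then have p: "a (Suc i) > 0" using Suc by linarith
    have "q * a i * a (Suc i) \<le> (a (Suc i))\<^sup>2" using Suc p by (simp add: power2_eq_square)
    also have "\<dots> \<le> a i * a (Suc (Suc i))" by (rule lc)
    finally have "a i * (q * a (Suc i)) \<le> a i * a (Suc (Suc i))" by (simp add: mult_ac)
    then show ?case using Suc p by simp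
  qed
  have "a i \<ge> q ^ i * a 0" for i
  proof (induction i)
    case (Suc i)
    have "q ^ Suc i * a 0 = q * (q ^ i * a 0)" by simp
    also have "\<dots> \<le> q * a i" using Suc q r by (intro mult_left_mono) auto
    finally show ?case using step[of i] by linarith
  qed simp
  then have "q ^ i * a 0 \<le> C * r ^ i" for i using bd order_trans by blast
  then have le: "(q / r) ^ i \<le> C / a 0" for i
    using a0 r by (simp add: power_divide field_simps)
  moreover have "1 < q / r" using q r by simp
  ultimately show False
    using real_arch_pow[of "q / r" "C / a 0"] by (meson not_less)
qed

text \<open>Self-adjointness enters as symmetry together with \<open>A_dom\<close>, which says that
  the domain of the adjoint is no larger than \<open>D\<close>. The complex structure is left out,
  so that the locale can also be instantiated by an auxiliary bounded operator, as in
  \<open>one_plus_Rpow_surj\<close>.\<close>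

locale nonneg_op =
  fixes D :: "'h::{real_inner, complete_space} set" and A :: "'h \<Rightarrow> 'h"
  assumes subD: "subspace D" and denseD: "closure D = UNIV"
    and A_add: "\<And>x y. x \<in> D \<Longrightarrow> y \<in> D \<Longrightarrow> A (x + y) = A x + A y"
    and A_scale: "\<And>x c. x \<in> D \<Longrightarrow> A (c *\<^sub>R x) = c *\<^sub>R A x"
    and A_sym: "\<And>x y. x \<in> D \<Longrightarrow> y \<in> D \<Longrightarrow> inner (A x) y = inner x (A y)"
    and A_dom: "\<And>y z. (\<And>x. x \<in> D \<Longrightarrow> inner (A x) y = inner x z) \<Longrightarrow> y \<in> D"
    and A_nonneg: "\<And>x. x \<in> D \<Longrightarrow> inner (A x) x \<ge> 0"
begin

lemma A_diff: "x \<in> D \<Longrightarrow> y \<in> D \<Longrightarrow> A (x - y) = A x - A y"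
  using A_add[of x "-1 *\<^sub>R y"] A_scale[of y "-1"] subspace_scale[OF subD, of y "-1"] by simp

lemma A_zero [simp]: "A 0 = 0"
  using A_scale[of 0 0] subspace_0[OF subD] by simp

lemma orthogonal_dense_zero:
  assumes "\<And>d. d \<in> D \<Longrightarrow> inner d w = 0"
  shows "w = 0"
proof -
  have "closed {d. inner d w = 0}" by (intro closed_Collect_eq continuous_intros)
  moreover have "D \<subseteq> {d. inner d w = 0}" using assms by auto
  ultimately have "closure D \<subseteq> {d. inner d w = 0}" by (simp add: closure_minimal)
  then have "w \<in> {d. inner d w = 0}" unfolding denseD by blast
  then show ?thesis by simp
qed

text \<open>The relation \<open>inner (A d) (X n) = inner d (A (X n))\<close> survives the limit,
  and \<open>A_dom\<close> turns it into membership in \<open>D\<close>.\<close>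

lemma A_closed:
  assumes X: "\<And>n. X n \<in> D" and x: "X \<longlonglongrightarrow> x" and z: "(\<lambda>n. A (X n)) \<longlonglongrightarrow> z"
  shows "x \<in> D" and "A x = z"
proof -
  have eq: "inner (A d) x = inner d z" if d: "d \<in> D" for d
  proof -
    have "(\<lambda>n. inner (A d) (X n)) \<longlonglongrightarrow> inner (A d) x" by (intro tendsto_intros x)
    moreover have "(\<lambda>n. inner (A d) (X n)) \<longlonglongrightarrow> inner d z"
      unfolding A_sym[OF d X] by (intro tendsto_intros z)
    ultimately show ?thesis by (rule LIMSEQ_unique)
  qed
  then show xD: "x \<in> D" by (rule A_dom)
  have "inner d (A x - z) = 0" if "d \<in> D" for d
    using eq[OF that] A_sym[OF that xD] by (simp add: inner_diff_right)
  then have "A x - z = 0" by (rule orthogonal_dense_zero)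
  then show "A x = z" by simp
qed

section \<open>The resolvent \<open>R\<close> and its powers\<close>

lemma norm_le_shift: "x \<in> D \<Longrightarrow> (norm x)\<^sup>2 + (norm (A x))\<^sup>2 \<le> (norm (A x + x))\<^sup>2"
  using A_nonneg[of x]
  by (simp add: power2_norm_eq_inner inner_add_left inner_add_right inner_commute[of x "A x"])

lemma norm_le_shift1: "x \<in> D \<Longrightarrow> norm x \<le> norm (A x + x)"
  using norm_le_shift[of x] zero_le_power2[of "norm (A x)"]
  by (intro power2_le_imp_le[OF _ norm_ge_zero]) linarith

lemma norm_le_shift2: "x \<in> D \<Longrightarrow> norm (A x) \<le> norm (A x + x)"
  using norm_le_shift[of x] zero_le_power2[of "norm x"]
  by (intro power2_le_imp_le[OF _ norm_ge_zero]) linarith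

text \<open>The range of \<open>A + I\<close> is closed because \<open>A + I\<close> is bounded
  below by 1 and \<open>A\<close> is closed. A vector \<open>w\<close> orthogonal to the range
  satisfies \<open>A w = - w\<close> in the weak sense, hence lies in \<open>D\<close> by
  \<open>A_dom\<close>, and nonnegativity makes it zero.\<close>

lemma shift_surj: "\<exists>g\<in>D. A g + g = f"
proof -
  define W where "W = (\<lambda>g. A g + g) ` D"
  have subW: "subspace W"
    unfolding subspace_def
  proof (intro conjI ballI allI)
    show "0 \<in> W" unfolding W_def using subspace_0[OF subD] by (auto intro!: image_eqI[of _ _ 0])
    fix x y assume "x \<in> W" "y \<in> W"
    then obtain a b where "a \<in> D" "x = A a + a" "b \<in> D" "y = A b + b" by (auto simp: W_def)
    then show "x + y \<in> W" unfolding W_def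
      by (intro image_eqI[of _ _ "a + b"]) (auto simp: A_add subspace_add[OF subD])
  next
    fix c x assume "x \<in> W"
    then obtain a where "a \<in> D" "x = A a + a" by (auto simp: W_def)
    then show "c *\<^sub>R x \<in> W" unfolding W_def
      by (intro image_eqI[of _ _ "c *\<^sub>R a"]) (auto simp: A_scale subspace_scale[OF subD] scaleR_add_right)
  qed
  have clW: "closed W"
    unfolding closed_sequential_limits
  proof (intro allI impI, elim conjE)
    fix X l assume "\<forall>n. X n \<in> W" and l: "X \<longlonglongrightarrow> l"
    then have "\<forall>n. X n \<in> W" by blast
    then have "\<forall>n. \<exists>g. g \<in> D \<and> A g + g = X n" unfolding W_def image_iff by metis
    then obtain g where g: "\<And>n. g n \<in> D" "\<And>n. A (g n) + g n = X n" by metis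
    have "Cauchy X" using l by (rule LIMSEQ_imp_Cauchy)
    have le: "dist (g m) (g n) \<le> dist (X m) (X n)" for m n
    proof -
      have "norm (g m - g n) \<le> norm (A (g m - g n) + (g m - g n))"
        by (rule norm_le_shift1) (use g subspace_diff[OF subD] in auto)
      also have "A (g m - g n) + (g m - g n) = X m - X n"
        by (simp add: A_diff g(1) g(2)[symmetric])
      finally show ?thesis by (simp add: dist_norm)
    qed
    have "Cauchy g"
      using \<open>Cauchy X\<close> le unfolding Cauchy_def by (meson le_less_trans)
    then obtain g0 where g0: "g \<longlonglongrightarrow> g0" using Cauchy_convergent convergent_def by blast
    have "(\<lambda>n. X n - g n) \<longlonglongrightarrow> l - g0" by (intro tendsto_intros l g0)
    then have "(\<lambda>n. A (g n)) \<longlonglongrightarrow> l - g0" by (simp add: g(2)[symmetric])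
    from A_closed[OF g(1) g0 this] show "l \<in> W" unfolding W_def by (intro image_eqI[of _ _ g0]) auto
  qed
  obtain p where p: "p \<in> W" "\<And>m. m \<in> W \<Longrightarrow> inner (f - p) m = 0"
    using closed_subspace_projection[OF clW subW] by blast
  define w where "w = f - p"
  have w: "inner w (A d + d) = 0" if "d \<in> D" for d
    unfolding w_def by (rule p(2)) (use that in \<open>auto simp: W_def\<close>)
  have eq: "inner (A x) w = inner x (- w)" if "x \<in> D" for x
    using w[OF that] by (simp add: inner_add_right inner_commute)
  have wD: "w \<in> D" by (rule A_dom[OF eq])
  have "(norm w)\<^sup>2 \<le> 0"
    using w[OF wD] A_nonneg[OF wD] by (simp add: power2_norm_eq_inner inner_add_right inner_commute)
  then have "f = p" by (simp add: w_def)
  then show ?thesis using p(1) by (auto simp: W_def)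
qed

definition R :: "'h \<Rightarrow> 'h" where "R = resolv D A"

lemma shift_inj: "g \<in> D \<Longrightarrow> h \<in> D \<Longrightarrow> A g + g = A h + h \<Longrightarrow> g = h"
proof -
  assume a: "g \<in> D" "h \<in> D" "A g + g = A h + h"
  have "norm (g - h) \<le> norm (A (g - h) + (g - h))"
    by (rule norm_le_shift1) (use a subspace_diff[OF subD] in auto)
  also have "A (g - h) + (g - h) = 0" using a by (simp add: A_diff algebra_simps)
  finally show "g = h" by simp
qed

lemma R_spec: "R f \<in> D \<and> A (R f) + R f = f"
  unfolding R_def resolv_def
proof (rule theI')
  show "\<exists>!g. g \<in> D \<and> A g + g = f" using shift_surj[of f] shift_inj by metis
qed

lemma R_dom [simp]: "R f \<in> D" and A_R: "A (R f) = f - R f" and shift_R: "A (R f) + R f = f"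
  using R_spec[of f] by (auto simp: algebra_simps)

lemma R_eqI: "g \<in> D \<Longrightarrow> A g + g = f \<Longrightarrow> R f = g"
  using shift_inj[of "R f" g] shift_R by auto

lemma R_shift: "g \<in> D \<Longrightarrow> R (A g + g) = g"
  by (rule R_eqI) auto

lemma R_norm: "norm (R f) \<le> norm f"
  using norm_le_shift1[of "R f"] by (simp add: shift_R)

lemma R_bounded_linear: "bounded_linear R"
proof (rule bounded_linear_intro[where K = 1])
  show "R (x + y) = R x + R y" for x y
    by (rule R_eqI) (auto simp: subspace_add[OF subD] A_add A_R)
  show "R (c *\<^sub>R x) = c *\<^sub>R R x" for c x
    by (rule R_eqI) (auto simp: subspace_scale[OF subD] A_scale A_R algebra_simps)
  show "norm (R x) \<le> norm x * 1" for x using R_norm by simp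
qed

sublocale R: bounded_linear R by (rule R_bounded_linear)

lemma R_inj: "R x = R y \<Longrightarrow> x = y"
  by (metis shift_R)

lemma R_sym: "inner (R x) y = inner x (R y)"
proof -
  have "inner (R x) y = inner (R x) (A (R y) + R y)" by (simp add: shift_R)
  also have "\<dots> = inner (A (R x) + R x) (R y)" by (simp add: inner_add_left inner_add_right A_sym)
  finally show ?thesis by (simp add: shift_R)
qed

lemma Rpow_bounded_linear: "bounded_linear (R ^^ k)"
proof (induction k)
  case 0 show ?case by (simp add: id_def bounded_linear_ident)
next
  case (Suc k) then show ?case
    unfolding funpow.simps o_def by (rule bounded_linear_compose[OF R_bounded_linear])
qed

lemma Rpow_sym: "inner ((R ^^ k) x) y = inner x ((R ^^ k) y)"
  by (induction k arbitrary: x y) (auto simp: R_sym funpow_swap1)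

lemma Rpow_inj: "(R ^^ k) x = (R ^^ k) y \<Longrightarrow> x = y"
  by (induction k) (auto dest: R_inj)

lemma R_log_convex: "(norm (R u))\<^sup>2 \<le> norm u * norm (R (R u))"
proof -
  have "(norm (R u))\<^sup>2 = inner u (R (R u))" by (simp add: power2_norm_eq_inner R_sym)
  also have "\<dots> \<le> norm u * norm (R (R u))" by (rule norm_cauchy_schwarz)
  finally show ?thesis .
qed

text \<open>Images of closed balls under \<open>R ^^ k\<close> are closed. The vectors of the ball
  whose image is within \<open>1 / Suc n\<close> of \<open>v\<close> form nested closed convex sets,
  so \<open>nested_convex_sets\<close> yields an exact preimage.\<close>

lemma closure_ball_image:
  assumes V: "\<And>e. e > 0 \<Longrightarrow> \<exists>u. norm u \<le> C \<and> norm ((R ^^ k) u - v) \<le> e"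
  shows "\<exists>u. norm u \<le> C \<and> (R ^^ k) u = v"
proof -
  interpret Rk: bounded_linear "R ^^ k" by (rule Rpow_bounded_linear)
  define S where "S n = cball 0 C \<inter> (R ^^ k) -` cball v (1 / real (Suc n))" for n
  have "\<exists>u. \<forall>n. u \<in> S n"
  proof (rule nested_convex_sets)
    fix n
    show "closed (S n)" unfolding S_def
      by (intro closed_Int closed_cball closed_vimage Rk.continuous_on continuous_on_id)
    show "convex (S n)" unfolding S_def
      by (intro convex_Int convex_cball convex_linear_vimage Rk.linear_axioms)
    obtain u where "norm u \<le> C" "norm ((R ^^ k) u - v) \<le> 1 / real (Suc n)"
      using V[of "1 / real (Suc n)"] by auto
    then show "S n \<noteq> {}" unfolding S_def by (auto simp: dist_norm norm_minus_commute)
    have "1 / real (Suc (Suc n)) \<le> 1 / real (Suc n)"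
      by (intro divide_left_mono) auto
    then show "S (Suc n) \<subseteq> S n" unfolding S_def
      by (intro Int_mono order_refl vimage_mono subset_cball)
    show "bounded (S 0)" unfolding S_def by (auto intro: bounded_Int)
  qed
  then obtain u where u: "\<And>n. u \<in> S n" by blast
  have "dist v ((R ^^ k) u) \<le> 1 / real (Suc n)" for n using u[of n] by (simp add: S_def)
  moreover have "(\<lambda>n. 1 / real (Suc n)) \<longlonglongrightarrow> 0" by (rule LIMSEQ_Suc[OF lim_const_over_n])
  ultimately have "dist v ((R ^^ k) u) \<le> 0"
    by (intro LIMSEQ_le_const[of _ 0 "dist v ((R ^^ k) u)"]) auto
  then show ?thesis using u[of 0] by (auto simp: S_def)
qed

text \<open>Since \<open>R\<close> is injective, \<open>u\<close> can only be
  \<open>(A + I)\<^sup>k v\<close>; phrasing this through the bounded \<open>R\<close> builds in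
  membership in all domains. For \<open>\<rho> \<ge> 1\<close> this is the spectral subspace of
  \<open>A\<close> for the interval from 0 to \<open>\<rho> - 1\<close>. The free constant
  \<open>C\<close> makes sums unproblematic; \<open>M_bound\<close> shows afterwards that
  \<open>norm v\<close> serves.\<close>

definition M :: "real \<Rightarrow> 'h set" where
  "M \<rho> = {v. \<exists>C. \<forall>k. \<exists>u. (R ^^ k) u = v \<and> norm u \<le> C * \<rho> ^ k}"

lemma M_bound:
  assumes r: "\<rho> > 0" and v: "v \<in> M \<rho>" and u: "(R ^^ k) u = v"
  shows "norm u \<le> \<rho> ^ k * norm v"
proof -
  obtain C where "\<forall>k. \<exists>u. (R ^^ k) u = v \<and> norm u \<le> C * \<rho> ^ k"
    using v unfolding M_def by blast
  then obtain w where w: "\<And>k. (R ^^ k) (w k) = v" "\<And>k. norm (w k) \<le> C * \<rho> ^ k"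
    by metis
  have Rw: "R (w (Suc k)) = w k" for k
    by (rule Rpow_inj[of k]) (use w(1)[of k] w(1)[of "Suc k"] in \<open>simp add: funpow_swap1\<close>)
  have lc: "(norm (w (Suc i)))\<^sup>2 \<le> norm (w i) * norm (w (Suc (Suc i)))" for i
    using R_log_convex[of "w (Suc (Suc i))"] by (simp add: Rw mult.commute)
  have step: "norm (w (Suc k)) \<le> \<rho> * norm (w k)" for k
  proof -
    \<comment> \<open>\<open>log_convex_growth\<close> only controls the first ratio of a sequence,
      so it is applied to the tail starting at \<open>k\<close>.\<close>
    have "norm (w (i + k)) \<le> C * \<rho> ^ k * \<rho> ^ i" for i
      using w(2)[of "i + k"] by (simp add: power_add mult_ac)
    from log_convex_growth[of "\<lambda>i. norm (w (i + k))", OF _ _ r this] lc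
    show ?thesis by simp
  qed
  have "norm (w k) \<le> \<rho> ^ k * norm v" for k
  proof (induction k)
    case 0 show ?case using w(1)[of 0] by simp
  next
    case (Suc k)
    have "norm (w (Suc k)) \<le> \<rho> * (\<rho> ^ k * norm v)"
      using step[of k] Suc r by (meson mult_left_mono order_trans less_imp_le)
    then show ?case by simp
  qed
  moreover have "u = w k" using u w(1) Rpow_inj by metis
  ultimately show ?thesis by simp
qed

lemma M_iff: "\<rho> > 0 \<Longrightarrow> v \<in> M \<rho> \<longleftrightarrow> (\<forall>k. \<exists>u. (R ^^ k) u = v \<and> norm u \<le> norm v * \<rho> ^ k)"
proof
  assume r: "\<rho> > 0" and "v \<in> M \<rho>"
  then have "\<forall>k. \<exists>u. (R ^^ k) u = v" by (auto simp: M_def)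
  then show "\<forall>k. \<exists>u. (R ^^ k) u = v \<and> norm u \<le> norm v * \<rho> ^ k"
    using M_bound[OF r \<open>v \<in> M \<rho>\<close>] by (metis mult.commute)
qed (auto simp: M_def)

lemma M_mono: "0 < \<rho> \<Longrightarrow> \<rho> \<le> \<sigma> \<Longrightarrow> M \<rho> \<subseteq> M \<sigma>"
proof
  fix v assume a: "0 < \<rho>" "\<rho> \<le> \<sigma>" and "v \<in> M \<rho>"
  then have *: "\<forall>k. \<exists>u. (R ^^ k) u = v \<and> norm u \<le> norm v * \<rho> ^ k" by (simp add: M_iff)
  have "norm v * \<rho> ^ k \<le> norm v * \<sigma> ^ k" for k
    using a by (intro mult_left_mono power_mono) auto
  with * have "\<exists>u. (R ^^ k) u = v \<and> norm u \<le> norm v * \<sigma> ^ k" for k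
    by (blast intro: order_trans)
  then show "v \<in> M \<sigma>" unfolding M_def by blast
qed

lemma M_subspace: "subspace (M \<rho>)"
  unfolding subspace_def
proof (intro conjI ballI allI)
  have "(R ^^ k) 0 = 0" for k by (rule linear_simps(3)[OF Rpow_bounded_linear])
  then show "0 \<in> M \<rho>" unfolding M_def by (auto intro!: exI[of _ 0])
  fix x y assume "x \<in> M \<rho>" "y \<in> M \<rho>"
  then obtain C1 C2 where
    C1: "\<And>k. \<exists>u. (R ^^ k) u = x \<and> norm u \<le> C1 * \<rho> ^ k" and
    C2: "\<And>k. \<exists>u. (R ^^ k) u = y \<and> norm u \<le> C2 * \<rho> ^ k" unfolding M_def by auto
  have "\<exists>u. (R ^^ k) u = x + y \<and> norm u \<le> (C1 + C2) * \<rho> ^ k" for k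
  proof -
    obtain u w where "(R ^^ k) u = x" "norm u \<le> C1 * \<rho> ^ k" "(R ^^ k) w = y" "norm w \<le> C2 * \<rho> ^ k"
      using C1 C2 by metis
    then show ?thesis
      by (intro exI[of _ "u + w"])
        (auto simp: linear_simps(1)[OF Rpow_bounded_linear] distrib_right
          intro: order_trans[OF norm_triangle_ineq])
  qed
  then show "x + y \<in> M \<rho>" unfolding M_def by blast
next
  fix c x assume "x \<in> M \<rho>"
  then obtain C where C: "\<And>k. \<exists>u. (R ^^ k) u = x \<and> norm u \<le> C * \<rho> ^ k" unfolding M_def by auto
  have "\<exists>u. (R ^^ k) u = c *\<^sub>R x \<and> norm u \<le> (\<bar>c\<bar> * C) * \<rho> ^ k" for k
  proof -
    obtain u where "(R ^^ k) u = x" "norm u \<le> C * \<rho> ^ k" using C by metis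
    then show ?thesis
      by (intro exI[of _ "c *\<^sub>R u"])
        (auto simp: linear_simps(5)[OF Rpow_bounded_linear] mult.assoc
          intro: mult_left_mono)
  qed
  then show "c *\<^sub>R x \<in> M \<rho>" unfolding M_def by blast
qed

text \<open>By \<open>M_iff\<close> the constant for \<open>X n\<close> can be taken to be
  \<open>norm (X n)\<close>, which is bounded along a convergent sequence. All approximating
  preimages then lie in one ball, as \<open>closure_ball_image\<close> needs.\<close>

lemma M_closed:
  assumes r: "\<rho> > 0" shows "closed (M \<rho>)"
  unfolding closed_sequential_limits
proof (intro allI impI, elim conjE)
  fix X l assume X: "\<forall>n. X n \<in> M \<rho>" and l: "X \<longlonglongrightarrow> l"
  obtain B where B: "\<And>n. norm (X n) \<le> B"
    using convergent_imp_Bseq[of X] l by (metis Bseq_def convergentI)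
  have "\<exists>u. (R ^^ k) u = l \<and> norm u \<le> B * \<rho> ^ k" for k
  proof -
    have "\<exists>u. norm u \<le> B * \<rho> ^ k \<and> (R ^^ k) u = l"
    proof (rule closure_ball_image)
      fix e :: real assume "e > 0"
      then obtain n where n: "norm (X n - l) < e"
        using LIMSEQ_D[OF l] by blast
      obtain u where u: "(R ^^ k) u = X n" "norm u \<le> norm (X n) * \<rho> ^ k"
        using X r M_iff by blast
      have "norm u \<le> B * \<rho> ^ k"
        using u(2) B[of n] r by (meson mult_right_mono order_trans less_imp_le zero_le_power)
      then show "\<exists>u. norm u \<le> B * \<rho> ^ k \<and> norm ((R ^^ k) u - l) \<le> e" using u n by (auto intro!: exI[of _ u])
    qed
    then show ?thesis by blast
  qed
  then show "l \<in> M \<rho>" unfolding M_def by blast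
qed

lemma M_R: "v \<in> M \<rho> \<Longrightarrow> R v \<in> M \<rho>"
proof -
  assume "v \<in> M \<rho>"
  then obtain C where C: "\<And>k. \<exists>u. (R ^^ k) u = v \<and> norm u \<le> C * \<rho> ^ k" unfolding M_def by auto
  have "\<exists>u. (R ^^ k) u = R v \<and> norm u \<le> C * \<rho> ^ k" for k
  proof -
    obtain u where u: "(R ^^ k) u = v" "norm u \<le> C * \<rho> ^ k" using C by metis
    then show ?thesis using R_norm[of u] by (intro exI[of _ "R u"]) (auto simp: funpow_swap1)
  qed
  then show ?thesis unfolding M_def by blast
qed

lemma M_R_preimage: "R u \<in> M \<rho> \<Longrightarrow> u \<in> M \<rho>"
proof -
  assume "R u \<in> M \<rho>"
  then obtain C where C: "\<And>k. \<exists>w. (R ^^ k) w = R u \<and> norm w \<le> C * \<rho> ^ k" unfolding M_def by auto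
  have "\<exists>w. (R ^^ k) w = u \<and> norm w \<le> (C * \<rho>) * \<rho> ^ k" for k
  proof -
    obtain w where w: "(R ^^ Suc k) w = R u" "norm w \<le> C * \<rho> ^ Suc k" using C by metis
    then have "(R ^^ k) w = u" by (auto dest: R_inj)
    then show ?thesis using w by (auto simp: mult_ac)
  qed
  then show ?thesis unfolding M_def by blast
qed

lemma M_dom: "v \<in> M \<rho> \<Longrightarrow> v \<in> D"
proof -
  assume "v \<in> M \<rho>"
  then obtain u where "(R ^^ 1) u = v" unfolding M_def by blast
  then show ?thesis by auto
qed

lemma M_shift: "v \<in> M \<rho> \<Longrightarrow> A v + v \<in> M \<rho>"
  by (rule M_R_preimage) (simp add: R_shift M_dom)

lemma M_A: "v \<in> M \<rho> \<Longrightarrow> A v \<in> M \<rho>"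
  using subspace_diff[OF M_subspace M_shift, of v \<rho> v] by simp

lemma M_shift_norm: "\<rho> > 0 \<Longrightarrow> v \<in> M \<rho> \<Longrightarrow> norm (A v + v) \<le> \<rho> * norm v"
  using M_bound[of \<rho> v 1 "A v + v"] by (simp add: R_shift M_dom)

lemma M_A_norm: "\<rho> > 0 \<Longrightarrow> v \<in> M \<rho> \<Longrightarrow> norm (A v) \<le> \<rho> * norm v"
  using M_shift_norm norm_le_shift2[OF M_dom] order_trans by blast

text \<open>The bounded operator \<open>c *\<^sub>R (R ^^ (n + n)) z\<close> is itself symmetric and
  nonnegative on the whole space, the even exponent giving \<open>norm ((R ^^ n) x)\<^sup>2\<close>.
  Surjectivity of its shift is therefore another instance of \<open>shift_surj\<close>.\<close>

lemma one_plus_Rpow_surj: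
  assumes "c \<ge> 0"
  shows "\<exists>z. z + c *\<^sub>R (R ^^ (n + n)) z = x"
proof -
  interpret S: nonneg_op UNIV "\<lambda>z. c *\<^sub>R (R ^^ (n + n)) z"
  proof
    interpret Rk: bounded_linear "R ^^ (n + n)" by (rule Rpow_bounded_linear)
    show "c *\<^sub>R (R ^^ (n + n)) (x + y) = c *\<^sub>R (R ^^ (n + n)) x + c *\<^sub>R (R ^^ (n + n)) y" for x y
      by (simp add: Rk.add scaleR_add_right)
    show "c *\<^sub>R (R ^^ (n + n)) (a *\<^sub>R x) = a *\<^sub>R (c *\<^sub>R (R ^^ (n + n)) x)" for a x
      by (simp add: Rk.scaleR)
    show "inner (c *\<^sub>R (R ^^ (n + n)) x) y = inner x (c *\<^sub>R (R ^^ (n + n)) y)" for x y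
      by (simp add: Rpow_sym)
    show "0 \<le> inner (c *\<^sub>R (R ^^ (n + n)) x) x" for x
      using assms Rpow_sym[of n "(R ^^ n) x" x] by (simp add: funpow_add)
  qed auto
  show ?thesis using S.shift_surj[of x] by (auto simp: add.commute)
qed

text \<open>With \<open>T = \<rho> R\<close> put \<open>z\<^sub>n = (I + T\<^sup>2\<^sup>n)\<^sup>-\<^sup>1 x\<close> and \<open>y\<^sub>n = x - z\<^sub>n = T\<^sup>2\<^sup>n z\<^sub>n\<close>. A weak limit of the \<open>y\<^sub>n\<close>
  lies in \<open>M \<rho>\<close>, hence is orthogonal to \<open>x\<close>; therefore \<open>inner y\<^sub>n x = norm (T\<^sup>n z\<^sub>n)\<^sup>2 + norm y\<^sub>n\<^sup>2\<close> becomes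
  arbitrarily small. Then \<open>z\<^sub>n\<close> is close to \<open>x\<close> and \<open>norm (T\<^sup>n z\<^sub>n) \<le> norm z\<^sub>n\<close>, so log-convexity gives
  \<open>norm (T z\<^sub>n) \<le> norm z\<^sub>n\<close>.\<close>

lemma norm_R_orthogonal_M:
  assumes r: "\<rho> > 0" and x: "\<And>v. v \<in> M \<rho> \<Longrightarrow> inner x v = 0"
  shows "\<rho> * norm (R x) \<le> norm x"
proof (cases "x = 0")
  case False
  define T where "T k v = \<rho> ^ k *\<^sub>R (R ^^ k) v" for k v
  have T_sym: "inner (T k v) w = inner v (T k w)" for k v w
    by (simp add: T_def Rpow_sym)
  have T_T: "T k (T l v) = T (k + l) v" for k l v
    by (simp add: T_def funpow_add linear_simps(5)[OF Rpow_bounded_linear] power_add mult_ac)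
  have T0: "T 0 v = v" for v by (simp add: T_def)
  have "\<exists>z. z + T (n + n) z = x" for n
    unfolding T_def by (rule one_plus_Rpow_surj) (use r in simp)
  then obtain z where z: "\<And>n. z n + T (n + n) (z n) = x" by metis
  define y where "y n = T (n + n) (z n)" for n
  have zy: "z n = x - y n" for n using z[of n] by (simp add: y_def algebra_simps)
  have T_y: "inner (y n) (z n) = (norm (T n (z n)))\<^sup>2" for n
    unfolding y_def T_T[symmetric] by (simp add: T_sym power2_norm_eq_inner T_T)
  have zx: "inner (z n) x = (norm (z n))\<^sup>2 + (norm (T n (z n)))\<^sup>2" for n
  proof -
    have "inner (z n) x = inner (z n) (z n + y n)" by (simp add: zy)
    then show ?thesis by (simp add: inner_add_right T_y inner_commute[of "z n" "y n"] power2_norm_eq_inner)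
  qed
  have yx: "inner (y n) x = (norm (T n (z n)))\<^sup>2 + (norm (y n))\<^sup>2" for n
  proof -
    have "inner (y n) x = inner (y n) (z n + y n)" by (simp add: zy)
    then show ?thesis by (simp add: inner_add_right T_y power2_norm_eq_inner)
  qed
  have le: "norm w \<le> norm x" if "(norm w)\<^sup>2 \<le> inner w x" for w
  proof (cases "w = 0")
    case False
    have "norm w * norm w \<le> norm w * norm x"
      using that norm_cauchy_schwarz[of w x] by (simp add: power2_eq_square)
    then show ?thesis using False by simp
  qed simp
  have z_le: "norm (z n) \<le> norm x" for n by (rule le) (simp add: zx)
  have y_le: "norm (y n) \<le> norm x" for n by (rule le) (simp add: yx)
  have lc: "(norm (T (Suc i) w))\<^sup>2 \<le> norm (T i w) * norm (T (Suc (Suc i)) w)" for i w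
  proof -
    have e: "T (Suc i) w = T 1 (T i w)" "T (Suc (Suc i)) w = T 1 (T (Suc i) w)"
      by (simp_all add: T_T)
    have "(norm (T (Suc i) w))\<^sup>2 = inner (T 1 (T i w)) (T (Suc i) w)"
      by (simp only: e(1) power2_norm_eq_inner)
    also have "\<dots> = inner (T i w) (T (Suc (Suc i)) w)" by (simp only: T_sym[of 1] e(2))
    also have "\<dots> \<le> norm (T i w) * norm (T (Suc (Suc i)) w)" by (rule norm_cauchy_schwarz)
    finally show ?thesis .
  qed
  \<comment> \<open>The endpoints of the log-convex sequence are \<open>T 0 (z n) = z n\<close> and
    \<open>T (n + n) (z n) = y n\<close>, both already bounded by \<open>norm x\<close>.\<close>
  have Tz_le: "norm (T i (z n)) \<le> norm x" if "i \<le> n + n" for i n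
    by (rule log_convex_bounded_between[of "\<lambda>i. norm (T i (z n))" _ "n + n"])
      (use lc z_le[of n] y_le[of n] that in \<open>auto simp: T0 y_def\<close>)
  \<comment> \<open>Closed convex hulls of tails replace weak limits: a closed halfspace, or the
    closure of a convex image of a ball, that contains a tail of \<open>y\<close> also contains
    \<open>v\<close>.\<close>
  have "\<exists>v. \<forall>n. v \<in> closure (convex hull (y ` {n..}))"
  proof (rule nested_convex_sets)
    fix n
    show "closure (convex hull (y ` {Suc n..})) \<subseteq> closure (convex hull (y ` {n..}))"
      by (intro closure_mono hull_mono image_mono) auto
    have "bounded (y ` {0..})" using y_le by (auto simp: bounded_iff)
    then show "bounded (closure (convex hull (y ` {0..})))"
      by (intro bounded_closure bounded_convex_hull)
  qed (auto intro!: convex_closure convex_convex_hull)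
  then obtain v where v: "\<And>n. v \<in> closure (convex hull (y ` {n..}))" by blast
  have "\<exists>u. (R ^^ k) u = v \<and> norm u \<le> norm x * \<rho> ^ k" for k
  proof -
    define Q where "Q = (\<lambda>u. (R ^^ k) u) ` cball 0 (norm x * \<rho> ^ k)"
    have "convex Q" unfolding Q_def
      by (intro convex_linear_image convex_cball bounded_linear.linear Rpow_bounded_linear)
    moreover have "y ` {k..} \<subseteq> Q"
    proof
      fix w assume "w \<in> y ` {k..}"
      then obtain n where n: "w = y n" "k \<le> n" by auto
      have "w = T k (T (n + n - k) (z n))" using n by (simp add: T_T y_def)
      then have "w = (R ^^ k) (\<rho> ^ k *\<^sub>R T (n + n - k) (z n))"
        by (simp add: T_def[of k] linear_simps(5)[OF Rpow_bounded_linear])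
      moreover have "norm (\<rho> ^ k *\<^sub>R T (n + n - k) (z n)) \<le> norm x * \<rho> ^ k"
        using Tz_le[of "n + n - k" n] r by (simp add: mult.commute)
      ultimately show "w \<in> Q" unfolding Q_def by (intro image_eqI) auto
    qed
    ultimately have "convex hull (y ` {k..}) \<subseteq> Q" by (intro hull_minimal)
    then have vQ: "v \<in> closure Q" using v[of k] closure_mono by blast
    have "\<exists>u. norm u \<le> norm x * \<rho> ^ k \<and> (R ^^ k) u = v"
    proof (rule closure_ball_image)
      fix e :: real assume "e > 0"
      then obtain w where "w \<in> Q" "dist w v < e" using vQ closure_approachable by metis
      then show "\<exists>u. norm u \<le> norm x * \<rho> ^ k \<and> norm ((R ^^ k) u - v) \<le> e"
        unfolding Q_def by (auto simp: dist_norm intro: less_imp_le)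
    qed
    then show ?thesis by blast
  qed
  then have "v \<in> M \<rho>" unfolding M_def by blast
  then have vx: "inner x v = 0" by (rule x)
  have small: "\<exists>n\<ge>1. inner (y n) x < e" if e: "e > 0" for e
  proof (rule ccontr)
    assume *: "\<not> (\<exists>n\<ge>1. inner (y n) x < e)"
    have "y ` {1..} \<subseteq> {w. inner x w \<ge> e}" using * by (auto simp: inner_commute not_less)
    then have "closure (convex hull (y ` {1..})) \<subseteq> {w. inner x w \<ge> e}"
      by (intro closure_minimal hull_minimal convex_halfspace_ge closed_halfspace_ge)
    then have "inner x v \<ge> e" using v[of 1] by auto
    then show False using vx e by simp
  qed
  \<comment> \<open>With \<open>norm (y n) < d \<le> norm x / 2\<close> the vector
    \<open>z n\<close> has norm above \<open>norm x / 2\<close>, hence above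
    \<open>norm (T n (z n))\<close>. The bound at the endpoints \<open>0\<close> and
    \<open>n \<ge> 1\<close> then holds at index 1.\<close>
  have "\<rho> * norm (R x) \<le> norm x + \<rho> * d" if d: "d > 0" "d \<le> norm x / 2" for d
  proof -
    have "d\<^sup>2 > 0" using d by simp
    from small[OF this] obtain n where n: "n \<ge> 1" "inner (y n) x < d\<^sup>2" by auto
    have "(norm (T n (z n)))\<^sup>2 < d\<^sup>2" "(norm (y n))\<^sup>2 < d\<^sup>2"
      using n(2) unfolding yx by (smt (verit) zero_le_power2)+
    then have a: "norm (T n (z n)) < d" "norm (y n) < d"
      using d by (auto intro: power2_less_imp_less)
    have "norm x \<le> norm (z n) + norm (y n)" using zy[of n] norm_triangle_ineq[of "z n" "y n"] by simp
    then have "norm (T n (z n)) \<le> norm (z n)" using a d by linarith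
    then have "norm (T 1 (z n)) \<le> norm (z n)"
      by (intro log_convex_bounded_between[of "\<lambda>i. norm (T i (z n))" _ n 1])
        (use lc n in \<open>auto simp: T0\<close>)
    then have "norm (T 1 (z n)) \<le> norm x" using z_le[of n] by linarith
    then have 1: "\<rho> * norm (R (z n)) \<le> norm x" using r by (simp add: T_def)
    have "R x = R (z n) + R (y n)" by (simp add: zy R.diff)
    then have "norm (R x) \<le> norm (R (z n)) + d"
      using norm_triangle_ineq[of "R (z n)" "R (y n)"] R_norm[of "y n"] a by simp
    then have "\<rho> * norm (R x) \<le> \<rho> * (norm (R (z n)) + d)" using r by (intro mult_left_mono) auto
    then show ?thesis using 1 by (simp add: distrib_left)
  qed
  note key = this
  show ?thesis
  proof (rule field_le_epsilon)
    fix e :: real assume e: "e > 0"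
    define d where "d = min (norm x / 2) (e / \<rho>)"
    have "d > 0" using e r False by (simp add: d_def)
    moreover have "d \<le> norm x / 2" unfolding d_def by (rule min.cobounded1)
    moreover have "\<rho> * d \<le> e" using r by (simp add: d_def min_def field_simps)
    ultimately show "\<rho> * norm (R x) \<le> norm x + e" using key[of d] by linarith
  qed
qed simp

section \<open>Orthogonal projections onto the spectral subspaces\<close>

definition P :: "real \<Rightarrow> 'h \<Rightarrow> 'h" where
  "P \<rho> x = (SOME p. p \<in> M \<rho> \<and> (\<forall>m\<in>M \<rho>. inner (x - p) m = 0))"

lemma P_spec: "\<rho> > 0 \<Longrightarrow> P \<rho> x \<in> M \<rho> \<and> (\<forall>m\<in>M \<rho>. inner (x - P \<rho> x) m = 0)"
  unfolding P_def
proof (rule someI_ex)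
  assume "\<rho> > 0"
  then show "\<exists>p. p \<in> M \<rho> \<and> (\<forall>m\<in>M \<rho>. inner (x - p) m = 0)"
    using closed_subspace_projection[OF M_closed M_subspace, of \<rho> x] by blast
qed

lemma P_M: "\<rho> > 0 \<Longrightarrow> P \<rho> x \<in> M \<rho>"
  and P_orth: "\<rho> > 0 \<Longrightarrow> m \<in> M \<rho> \<Longrightarrow> inner (x - P \<rho> x) m = 0"
  using P_spec by auto

lemma P_eqI:
  assumes r: "\<rho> > 0" and p: "p \<in> M \<rho>" and o: "\<And>m. m \<in> M \<rho> \<Longrightarrow> inner (x - p) m = 0"
  shows "P \<rho> x = p"
proof -
  have d: "P \<rho> x - p \<in> M \<rho>" using P_M[OF r] p by (simp add: subspace_diff[OF M_subspace])
  have "inner (P \<rho> x - p) (P \<rho> x - p) = inner (x - p) (P \<rho> x - p) - inner (x - P \<rho> x) (P \<rho> x - p)"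
    by (simp add: inner_diff_left)
  then show ?thesis using o[OF d] P_orth[OF r d] by simp
qed

lemma P_id: "\<rho> > 0 \<Longrightarrow> v \<in> M \<rho> \<Longrightarrow> P \<rho> v = v"
  by (rule P_eqI) auto

lemma P_pythagoras:
  assumes r: "\<rho> > 0"
  shows "(norm x)\<^sup>2 = (norm (P \<rho> x))\<^sup>2 + (norm (x - P \<rho> x))\<^sup>2"
proof -
  have "inner (x - P \<rho> x) (P \<rho> x) = 0" by (rule P_orth[OF r P_M[OF r]])
  then show ?thesis
    by (simp add: power2_norm_eq_inner inner_diff_left inner_diff_right inner_commute[of x "P \<rho> x"])
qed

lemma P_norm: "\<rho> > 0 \<Longrightarrow> norm (P \<rho> x) \<le> norm x"
  by (rule power2_le_imp_le) (simp_all add: P_pythagoras[of \<rho> x])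

lemma P_compl_norm: "\<rho> > 0 \<Longrightarrow> norm (x - P \<rho> x) \<le> norm x"
  by (rule power2_le_imp_le) (simp_all add: P_pythagoras[of \<rho> x])

lemma P_bounded_linear:
  assumes r: "\<rho> > 0" shows "bounded_linear (P \<rho>)"
proof (rule bounded_linear_intro[where K = 1])
  note [simp] = P_M[OF r] P_orth[OF r]
  show "P \<rho> (x + y) = P \<rho> x + P \<rho> y" for x y
  proof (rule P_eqI[OF r])
    fix m assume "m \<in> M \<rho>"
    moreover have "x + y - (P \<rho> x + P \<rho> y) = (x - P \<rho> x) + (y - P \<rho> y)" by simp
    ultimately show "inner (x + y - (P \<rho> x + P \<rho> y)) m = 0" by (simp only: inner_add_left) simp
  qed (simp add: subspace_add[OF M_subspace])
  show "P \<rho> (c *\<^sub>R x) = c *\<^sub>R P \<rho> x" for c x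
    by (rule P_eqI[OF r])
      (simp_all add: subspace_scale[OF M_subspace] scaleR_diff_right[symmetric])
  show "norm (P \<rho> x) \<le> norm x * 1" for x using P_norm[OF r] by simp
qed

text \<open>\<open>R\<close> is symmetric and maps \<open>M \<rho>\<close> into itself, so it
  preserves the orthogonal complement as well.\<close>

lemma P_R: assumes r: "\<rho> > 0" shows "P \<rho> (R x) = R (P \<rho> x)"
proof (rule P_eqI[OF r])
  show "R (P \<rho> x) \<in> M \<rho>" using P_M[OF r] M_R by blast
  show "inner (R x - R (P \<rho> x)) m = 0" if "m \<in> M \<rho>" for m
    using P_orth[OF r M_R[OF that]] by (simp add: R.diff[symmetric] R_sym)
qed

text \<open>Commutation with the unbounded \<open>A + I\<close> follows from commutation with
  \<open>R\<close> because \<open>R\<close> is injective.\<close>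

lemma P_shift:
  assumes r: "\<rho> > 0" and x: "x \<in> D"
  shows "P \<rho> (A x + x) = A (P \<rho> x) + P \<rho> x"
proof (rule R_inj)
  show "R (P \<rho> (A x + x)) = R (A (P \<rho> x) + P \<rho> x)"
    by (simp add: P_R[OF r, symmetric] R_shift x M_dom[OF P_M[OF r]])
qed

lemma P_A:
  assumes r: "\<rho> > 0" and x: "x \<in> D"
  shows "P \<rho> (A x) = A (P \<rho> x)"
  using P_shift[OF assms] linear_simps(1)[OF P_bounded_linear[OF r]] by simp

lemma norm_R_P_compl: "\<rho> > 0 \<Longrightarrow> \<rho> * norm (R (x - P \<rho> x)) \<le> norm (x - P \<rho> x)"
  by (rule norm_R_orthogonal_M) (auto intro: P_orth)

text \<open>This is \<open>norm_R_P_compl\<close> at \<open>A x + x\<close>: \<open>R\<close>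
  carries the complementary part of \<open>A x + x\<close> to that of \<open>x\<close>.\<close>

lemma norm_shift_P_compl:
  "\<rho> > 0 \<Longrightarrow> x \<in> D \<Longrightarrow> \<rho> * norm (x - P \<rho> x) \<le> norm (A (x - P \<rho> x) + (x - P \<rho> x))"
  using norm_R_P_compl[of \<rho> "A x + x"]
  by (simp add: P_R[symmetric] P_shift R.diff R_shift M_dom[OF P_M] A_diff) (simp add: algebra_simps)

lemma P_mono_compl_norm:
  assumes r: "0 < \<rho>" "\<rho> \<le> \<sigma>"
  shows "norm (x - P \<sigma> x) \<le> norm (x - P \<rho> x)"
proof -
  interpret P: bounded_linear "P \<sigma>" by (rule P_bounded_linear) (use r in simp)
  have "P \<sigma> (P \<rho> x) = P \<rho> x" using r P_M[of \<rho> x] M_mono[OF r] by (intro P_id) auto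
  then have eq: "x - P \<sigma> x = (x - P \<rho> x) - P \<sigma> (x - P \<rho> x)" by (simp add: P.diff)
  have "norm ((x - P \<rho> x) - P \<sigma> (x - P \<rho> x)) \<le> norm (x - P \<rho> x)"
    by (rule P_compl_norm) (use r in simp)
  then show ?thesis by (simp only: eq)
qed

text \<open>On \<open>D\<close> the lower bound \<open>norm_shift_P_compl\<close> gives convergence
  of order \<open>1 / \<rho>\<close>; density of \<open>D\<close> and contractivity of the
  complementary projections do the rest.\<close>

lemma P_tendsto: "(\<lambda>n. P (real (Suc n)) x) \<longlonglongrightarrow> x"
proof (rule LIMSEQ_I)
  fix e :: real assume e: "e > 0"
  have "x \<in> closure D" by (simp add: denseD)
  then obtain d where d: "d \<in> D" "dist d x < e / 2"
    using e half_gt_zero unfolding closure_approachable by blast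
  define w where "w = A d + d"
  obtain N :: nat where N: "norm w < real N * (e / 2)"
    using e reals_Archimedean3[of "e / 2"] by (auto simp: mult.commute)
  have "norm (P (real (Suc n)) x - x) < e" if n: "n \<ge> N" for n
  proof -
    let ?r = "real (Suc n)"
    interpret P: bounded_linear "P ?r" by (rule P_bounded_linear) simp
    have eq: "A (d - P ?r d) + (d - P ?r d) = w - P ?r w"
      by (simp add: w_def P_shift A_diff M_dom[OF P_M] d)
    have "?r * norm (d - P ?r d) \<le> norm (w - P ?r w)"
      using norm_shift_P_compl[of ?r d] d by (simp only: eq)
    also have "\<dots> \<le> norm w" by (rule P_compl_norm) simp
    also have "\<dots> < ?r * (e / 2)"
    proof -
      have "real N * (e / 2) \<le> ?r * (e / 2)" using n e by (intro mult_right_mono) auto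
      then show ?thesis using N by linarith
    qed
    finally have 1: "norm (d - P ?r d) < e / 2" by (simp only: mult_less_cancel_left_pos of_nat_0_less_iff zero_less_Suc)
    have eq2: "x - P ?r x = ((x - d) - P ?r (x - d)) + (d - P ?r d)" by (simp only: P.diff) simp
    have "norm ((x - d) - P ?r (x - d)) \<le> norm (x - d)" by (rule P_compl_norm) simp
    then have "norm (x - P ?r x) \<le> norm (x - d) + norm (d - P ?r d)"
      unfolding eq2 by (intro norm_triangle_le add_right_mono)
    then show ?thesis using 1 d by (simp add: dist_norm norm_minus_commute)
  qed
  then show "\<exists>N. \<forall>n\<ge>N. norm (P (real (Suc n)) x - x) < e" by blast
qed

end

section \<open>Weak solutions\<close>

lemma integral_has_vector_derivative_halfline:
  fixes y :: "real \<Rightarrow> 'a::{real_normed_vector, complete_space}"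
  assumes y: "continuous_on {0..} y" and t: "t \<ge> 0"
  shows "((\<lambda>u. integral {0..u} y) has_vector_derivative y t) (at t within {0..})"
proof -
  have "((\<lambda>u. integral {0..u} y) has_vector_derivative y t) (at t within {0..t+1})"
    by (rule integral_has_vector_derivative_complete)
      (use t in \<open>auto intro: continuous_on_subset[OF y]\<close>)
  moreover have "at t within {0..t+1} = at t within {0..}"
    by (rule at_within_nhd[of _ "{..<t+1}"]) auto
  ultimately show ?thesis by simp
qed

lemma vector_derivative_unique_halfline:
  assumes t: "t \<ge> (0::real)"
    and "(f has_vector_derivative a) (at t within {0..})" "(f has_vector_derivative b) (at t within {0..})"
  shows "a = b"
proof (rule vector_derivative_unique_within_closed_interval[of 0 "t + 1" t])
  show "(f has_vector_derivative a) (at t within cbox 0 (t + 1))"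
       "(f has_vector_derivative b) (at t within cbox 0 (t + 1))"
    using assms(2,3) by (auto intro: has_vector_derivative_within_subset)
qed (use t in auto)

context nonneg_op
begin

text \<open>The derivative of \<open>inner (u s) (u s)\<close> is
  \<open>- 2 * inner (A (u s)) (u s)\<close>, which is nonpositive.\<close>

lemma norm_nonincreasing:
  assumes D: "\<And>t. t \<ge> 0 \<Longrightarrow> u t \<in> D"
    and d: "\<And>t. t \<ge> 0 \<Longrightarrow> (u has_vector_derivative - A (u t)) (at t within {0..})"
    and t: "t \<ge> 0"
  shows "norm (u t) \<le> norm (u 0)"
proof -
  have "inner (u 0) (u 0) \<ge> inner (u t) (u t)"
  proof (rule DERIV_nonpos_imp_decreasing_open[OF t])
    fix x assume x: "0 < x" "x < t"
    then have "at x within {0..} = at x" by (intro at_within_interior) auto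
    then have "(u has_derivative (\<lambda>h. h *\<^sub>R - A (u x))) (at x)"
      using d[of x] x by (simp add: has_vector_derivative_def)
    from has_derivative_inner[OF this this]
    have "((\<lambda>s. inner (u s) (u s)) has_derivative (*) (- 2 * inner (A (u x)) (u x))) (at x)"
      by (rule has_derivative_eq_rhs) (simp add: fun_eq_iff inner_commute[of "u x" "A (u x)"])
    then have "DERIV (\<lambda>s. inner (u s) (u s)) x :> - 2 * inner (A (u x)) (u x)"
      by (simp only: has_field_derivative_def)
    moreover have "- 2 * inner (A (u x)) (u x) \<le> 0" using A_nonneg[OF D[of x]] x by simp
    ultimately show "\<exists>y. DERIV (\<lambda>s. inner (u s) (u s)) x :> y \<and> y \<le> 0" by blast
  next
    have "continuous_on {0..} u"
      using d by (auto simp: continuous_on_eq_continuous_within intro: has_vector_derivative_continuous)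
    then have "continuous_on {0..t} u" by (rule continuous_on_subset) auto
    then show "continuous_on {0..t} (\<lambda>s. inner (u s) (u s))" by (intro continuous_intros)
  qed
  then show ?thesis by (simp add: norm_eq_sqrt_inner)
qed

lemma weak_solD:
  assumes "weak_sol D A y"
  shows "continuous_on {0..} y" and "t \<ge> 0 \<Longrightarrow> integral {0..t} y \<in> D"
    and "t \<ge> 0 \<Longrightarrow> A (integral {0..t} y) = y 0 - y t"
  using assms unfolding weak_sol_def by (auto simp: algebra_simps)

lemma weak_sol_diff:
  assumes y: "weak_sol D A y" and z: "weak_sol D A z"
  shows "weak_sol D A (\<lambda>t. y t - z t)"
  unfolding weak_sol_def
proof (intro conjI allI impI)
  show "continuous_on {0..} (\<lambda>t. y t - z t)"
    using y z by (intro continuous_intros weak_solD)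
  fix t :: real assume t: "t \<ge> 0"
  have "y integrable_on {0..t}" "z integrable_on {0..t}"
    using weak_solD(1)[OF y] weak_solD(1)[OF z]
    by (auto intro!: integrable_continuous_complete intro: continuous_on_subset)
  then have i: "integral {0..t} (\<lambda>t. y t - z t) = integral {0..t} y - integral {0..t} z"
    by (rule Henstock_Kurzweil_Integration.integral_diff)
  show "integral {0..t} (\<lambda>t. y t - z t) \<in> D"
    unfolding i using weak_solD(2)[OF y t] weak_solD(2)[OF z t] by (rule subspace_diff[OF subD])
  show "y t - z t = - A (integral {0..t} (\<lambda>t. y t - z t)) + (y 0 - z 0)"
    unfolding i using weak_solD(2,3)[OF y t] weak_solD(2,3)[OF z t] by (simp add: A_diff)
qed

text \<open>Applying \<open>K\<close> to the integral equation turns \<open>A\<close> into the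
  bounded operator \<open>A K\<close> acting on \<open>integral {0..t} y\<close>, which can be
  differentiated. So \<open>K\<close> applied to a weak solution solves the equation classically and
  is contractive, even where \<open>y t\<close> is not known to lie in \<open>D\<close>.\<close>

lemma smoothed_weak_sol:
  assumes y: "weak_sol D A y" and K: "bounded_linear K" and AK: "bounded_linear (\<lambda>x. A (K x))"
    and KD: "\<And>x. K x \<in> D" and comm: "\<And>x. x \<in> D \<Longrightarrow> K (A x) = A (K x)" and t: "t \<ge> 0"
  shows "((\<lambda>t. K (y t)) has_vector_derivative - A (K (y t))) (at t within {0..})"
    and "norm (K (y t)) \<le> norm (K (y 0))"
proof -
  have d: "((\<lambda>t. K (y t)) has_vector_derivative - A (K (y t))) (at t within {0..})" if t: "t \<ge> 0" for t
  proof (rule has_vector_derivative_transform)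
    show "t \<in> {0..}" using t by simp
    show "K (y s) = K (y 0) - A (K (integral {0..s} y))" if "s \<in> {0..}" for s
    proof -
      have "y s = y 0 - A (integral {0..s} y)" using weak_solD(3)[OF y] that by simp
      then have "K (y s) = K (y 0) - K (A (integral {0..s} y))"
        by (simp only: linear_simps(2)[OF K])
      then show ?thesis using comm weak_solD(2)[OF y] that by simp
    qed
    have "((\<lambda>s. A (K (integral {0..s} y))) has_vector_derivative A (K (y t))) (at t within {0..})"
      by (rule bounded_linear.has_vector_derivative[OF AK
            integral_has_vector_derivative_halfline[OF weak_solD(1)[OF y] t]])
    from has_vector_derivative_diff[OF has_vector_derivative_const this]
    show "((\<lambda>s. K (y 0) - A (K (integral {0..s} y))) has_vector_derivative - A (K (y t))) (at t within {0..})"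
      by simp
  qed
  show "((\<lambda>t. K (y t)) has_vector_derivative - A (K (y t))) (at t within {0..})" by (rule d[OF t])
  show "norm (K (y t)) \<le> norm (K (y 0))"
    by (rule norm_nonincreasing[of "\<lambda>t. K (y t)", OF KD d t])
qed

lemma AP_bounded_linear:
  assumes r: "\<rho> > 0" shows "bounded_linear (\<lambda>x. A (P \<rho> x))"
proof (rule bounded_linear_intro[where K = \<rho>])
  interpret P: bounded_linear "P \<rho>" by (rule P_bounded_linear[OF r])
  note [simp] = M_dom[OF P_M[OF r]]
  show "A (P \<rho> (x + y)) = A (P \<rho> x) + A (P \<rho> y)" for x y by (simp add: P.add A_add)
  show "A (P \<rho> (c *\<^sub>R x)) = c *\<^sub>R A (P \<rho> x)" for c x by (simp add: P.scaleR A_scale)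
  show "norm (A (P \<rho> x)) \<le> norm x * \<rho>" for x
  proof -
    have "norm (A (P \<rho> x)) \<le> \<rho> * norm (P \<rho> x)" by (rule M_A_norm[OF r P_M[OF r]])
    also have "\<dots> \<le> \<rho> * norm x" using P_norm[OF r] r by (intro mult_left_mono) auto
    finally show ?thesis by (simp add: mult.commute)
  qed
qed

text \<open>A frequency cutoff of \<open>A + I\<close>: bounded, commuting with \<open>A\<close> on
  \<open>D\<close>, and undone by \<open>R\<close> up to the projection,
  \<open>R (L \<rho> x) = P \<rho> x\<close>.\<close>

definition L :: "real \<Rightarrow> 'h \<Rightarrow> 'h" where "L \<rho> x = A (P \<rho> x) + P \<rho> x"

lemma L_M: "\<rho> > 0 \<Longrightarrow> L \<rho> x \<in> M \<rho>"
  unfolding L_def by (rule M_shift[OF P_M])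

lemma L_bounded_linear: "\<rho> > 0 \<Longrightarrow> bounded_linear (L \<rho>)"
  unfolding L_def by (intro bounded_linear_add AP_bounded_linear P_bounded_linear)

lemma AL_bounded_linear: "\<rho> > 0 \<Longrightarrow> bounded_linear (\<lambda>x. A (L \<rho> x))"
  using bounded_linear_compose[OF AP_bounded_linear L_bounded_linear, of \<rho> \<rho>]
  by (simp add: P_id L_M)

lemma L_comm: "\<rho> > 0 \<Longrightarrow> x \<in> D \<Longrightarrow> L \<rho> (A x) = A (L \<rho> x)"
  unfolding L_def by (simp add: P_A A_add M_dom[OF P_M] M_dom[OF M_A[OF P_M]])

lemma R_comm: "x \<in> D \<Longrightarrow> R (A x) = A (R x)"
  using R_shift[of x] by (simp add: R.add A_R algebra_simps)

lemma AR_bounded_linear: "bounded_linear (\<lambda>x. A (R x))"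
  unfolding A_R by (intro bounded_linear_sub bounded_linear_ident R_bounded_linear)

text \<open>The smoothed orbits \<open>L n (y t)\<close> converge uniformly in \<open>t\<close>, because by contractivity their
  differences are dominated by those of \<open>P n ((A + I) (y 0))\<close>.\<close>

lemma weak_sol_shift:
  assumes y: "weak_sol D A y" and y0: "y 0 \<in> D"
  shows "t \<ge> 0 \<Longrightarrow> y t \<in> D" and "weak_sol D A (\<lambda>t. A (y t) + y t)"
proof -
  define w where "w = A (y 0) + y 0"
  define f where "f n t = L (real (Suc n)) (y t)" for n t
  have le: "norm (f m t - f n t) \<le> norm (P (real (Suc m)) w - P (real (Suc n)) w)" if t: "t \<ge> 0" for m n t
  proof -
    let ?m = "real (Suc m)" and ?n = "real (Suc n)"
    have mn: "?m > 0" "?n > 0" by simp_all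
    note [simp] = M_dom[OF L_M] L_comm
    have "norm (L ?m (y t) - L ?n (y t)) \<le> norm (L ?m (y 0) - L ?n (y 0))"
    proof (rule smoothed_weak_sol(2)[OF y, of "\<lambda>x. L ?m x - L ?n x"])
      show "bounded_linear (\<lambda>x. L ?m x - L ?n x)"
        using mn by (intro bounded_linear_sub L_bounded_linear)
      have "bounded_linear (\<lambda>x. A (L ?m x) - A (L ?n x))"
        using mn by (intro bounded_linear_sub AL_bounded_linear)
      then show "bounded_linear (\<lambda>x. A (L ?m x - L ?n x))"
        using mn by (simp only: A_diff M_dom[OF L_M])
      show "L ?m x - L ?n x \<in> D" for x
        using mn by (intro subspace_diff[OF subD] M_dom[OF L_M])
      show "L ?m (A x) - L ?n (A x) = A (L ?m x - L ?n x)" if "x \<in> D" for x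
        using mn that by (simp only: A_diff M_dom[OF L_M] L_comm)
      show "t \<ge> 0" by (rule t)
    qed
    moreover have "L k (y 0) = P k w" if "k > 0" for k
      unfolding L_def w_def by (rule P_shift[OF that y0, symmetric])
    ultimately show ?thesis unfolding f_def using mn by simp
  qed
  have "uniformly_Cauchy_on {0..} f"
  proof (rule uniformly_Cauchy_onI)
    fix e :: real assume e: "e > 0"
    have "Cauchy (\<lambda>n. P (real (Suc n)) w)" using P_tendsto by (rule LIMSEQ_imp_Cauchy)
    then obtain N where N: "\<And>m n. m \<ge> N \<Longrightarrow> n \<ge> N \<Longrightarrow> dist (P (real (Suc m)) w) (P (real (Suc n)) w) < e"
      using e unfolding Cauchy_def by blast
    show "\<exists>M. \<forall>t\<in>{0..}. \<forall>m\<ge>M. \<forall>n\<ge>M. dist (f m t) (f n t) < e"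
    proof (intro exI ballI allI impI)
      fix t :: real and m n assume "t \<in> {0..}" "m \<ge> N" "n \<ge> N"
      then show "dist (f m t) (f n t) < e"
        using le[of t m n] N[of m n] unfolding dist_norm by fastforce
    qed
  qed
  then obtain s where s: "uniform_limit {0..} f s sequentially"
    using Cauchy_uniformly_convergent unfolding uniformly_convergent_on_def by blast
  have cs: "continuous_on {0..} s"
  proof (rule uniform_limit_theorem[OF _ s])
    show "\<forall>\<^sub>F n in sequentially. continuous_on {0..} (f n)"
      unfolding f_def
      by (intro always_eventually allI bounded_linear.continuous_on[OF L_bounded_linear] weak_solD(1)[OF y]) simp
  qed simp
  \<comment> \<open>The limit \<open>s\<close> is the candidate for \<open>A (y t) + y t\<close>.
    Recovering \<open>y t\<close> as \<open>R (s t)\<close> proves both this and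
    \<open>y t \<in> D\<close>.\<close>
  have Rs: "R (s t) = y t" if t: "t \<ge> 0" for t
  proof (rule LIMSEQ_unique)
    have "(\<lambda>n. f n t) \<longlonglongrightarrow> s t" using tendsto_uniform_limitI[OF s] t by simp
    then show "(\<lambda>n. R (f n t)) \<longlonglongrightarrow> R (s t)" by (rule R.tendsto)
    have "R (f n t) = P (real (Suc n)) (y t)" for n
      unfolding f_def L_def by (rule R_shift[OF M_dom[OF P_M]]) simp
    then show "(\<lambda>n. R (f n t)) \<longlonglongrightarrow> y t" using P_tendsto by simp
  qed
  show yD: "y t \<in> D" if "t \<ge> 0" for t using R_dom[of "s t"] Rs[OF that] by simp
  have s_eq: "A (y t) + y t = s t" if "t \<ge> 0" for t using shift_R[of "s t"] Rs[OF that] by simp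
  show "weak_sol D A (\<lambda>t. A (y t) + y t)"
    unfolding weak_sol_def
  proof (intro conjI allI impI)
    show "continuous_on {0..} (\<lambda>t. A (y t) + y t)"
      using cs by (rule continuous_on_eq) (simp add: s_eq)
    fix t :: real assume t: "t \<ge> 0"
    define Y where "Y = integral {0..t} y"
    have Y: "Y \<in> D" "A Y = y 0 - y t" unfolding Y_def using weak_solD(2,3)[OF y t] by auto
    have "s integrable_on {0..t}"
      by (rule integrable_continuous_complete) (auto intro: continuous_on_subset[OF cs])
    \<comment> \<open>The integral of \<open>s\<close> is computed by taking the bounded
      \<open>R\<close>, rather than the unbounded \<open>A\<close>, through the integral
      sign.\<close>
    then have "((R \<circ> s) has_integral R (integral {0..t} s)) {0..t}"
      by (intro has_integral_linear integrable_integral R_bounded_linear)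
    then have "R (integral {0..t} s) = integral {0..t} (R \<circ> s)" by (simp add: integral_unique)
    also have "\<dots> = Y" unfolding Y_def by (rule integral_cong) (simp add: Rs)
    finally have "integral {0..t} s = A Y + Y" using shift_R[of "integral {0..t} s"] by simp
    moreover have "integral {0..t} (\<lambda>t. A (y t) + y t) = integral {0..t} s"
      by (rule integral_cong) (simp add: s_eq)
    ultimately have i: "integral {0..t} (\<lambda>t. A (y t) + y t) = y 0 - y t + Y" using Y by simp
    show "integral {0..t} (\<lambda>t. A (y t) + y t) \<in> D"
      unfolding i using yD[OF t] y0 Y by (intro subspace_add[OF subD] subspace_diff[OF subD])
    show "A (y t) + y t = - A (integral {0..t} (\<lambda>t. A (y t) + y t)) + (A (y 0) + y 0)"
      unfolding i using yD[OF t] y0 Y by (simp add: A_add A_diff subspace_diff[OF subD])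
  qed
qed

lemma weak_sol_A:
  assumes y: "weak_sol D A y" and y0: "y 0 \<in> D"
  shows "weak_sol D A (\<lambda>t. A (y t))"
  using weak_sol_diff[OF weak_sol_shift(2)[OF y y0] y] by simp

lemma weak_sol_classical:
  assumes y: "weak_sol D A y" and y0: "y 0 \<in> D" and t: "t \<ge> 0"
  shows "(y has_vector_derivative - A (y t)) (at t within {0..})"
proof (rule has_vector_derivative_transform)
  note D = weak_sol_shift(1)[OF y y0]
  show "t \<in> {0..}" using t by simp
  show "y s = R (A (y s) + y s)" if "s \<in> {0..}" for s using D[of s] that by (simp add: R_shift)
  have "((\<lambda>t. R (A (y t) + y t)) has_vector_derivative - A (R (A (y t) + y t))) (at t within {0..})"
    by (rule smoothed_weak_sol(1)[OF weak_sol_shift(2)[OF y y0] R_bounded_linear AR_bounded_linear R_dom R_comm t])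
  then show "((\<lambda>t. R (A (y t) + y t)) has_vector_derivative - A (y t)) (at t within {0..})"
    using R_shift[OF D[OF t]] by simp
qed

lemma weak_sol_norm:
  assumes "weak_sol D A y" and "y 0 \<in> D" and "t \<ge> 0"
  shows "norm (y t) \<le> norm (y 0)"
  by (rule norm_nonincreasing) (use assms weak_sol_shift(1) weak_sol_classical in auto)

lemma weak_sol_power:
  assumes "weak_sol D A y" and "y 0 \<in> dom_pow D A n"
  shows "(\<forall>t\<ge>0. y t \<in> dom_pow D A n) \<and> weak_sol D A (\<lambda>t. (A ^^ n) (y t))"
  using assms
proof (induction n arbitrary: y)
  case (Suc n)
  then have y0: "y 0 \<in> D" and "A (y 0) \<in> dom_pow D A n" by auto
  from Suc.IH[OF weak_sol_A[OF Suc.prems(1) y0] this(2)] weak_sol_shift(1)[OF Suc.prems(1) y0]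
  show ?case by (simp add: funpow_swap1)
qed simp

lemma dom_pow_add: "x \<in> dom_pow D A (n + k) \<longleftrightarrow> x \<in> dom_pow D A n \<and> (A ^^ n) x \<in> dom_pow D A k"
  by (induction n arbitrary: x) (auto simp: funpow_swap1)

lemma weak_sol_power_norm:
  assumes y: "weak_sol D A y" and y0: "\<And>n. y 0 \<in> dom_pow D A n" and t: "t \<ge> 0"
  shows "norm ((A ^^ n) (y t)) \<le> norm ((A ^^ n) (y 0))"
proof (rule weak_sol_norm[of "\<lambda>t. (A ^^ n) (y t)", OF _ _ t])
  show "weak_sol D A (\<lambda>t. (A ^^ n) (y t))" using weak_sol_power[OF y y0] by blast
  show "(A ^^ n) (y 0) \<in> D" using y0[of "n + 1"] unfolding dom_pow_add by simp
qed

lemma weak_sol_derivs_on: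
  assumes y: "weak_sol D A y" and y0: "\<And>n. y 0 \<in> dom_pow D A n"
  shows "derivs_on y (\<lambda>n t. (- 1) ^ n *\<^sub>R (A ^^ n) (y t))"
  unfolding derivs_on_def
proof (intro conjI allI impI)
  fix n and t :: real assume t: "t \<ge> 0"
  have "((\<lambda>t. (A ^^ n) (y t)) has_vector_derivative - A ((A ^^ n) (y t))) (at t within {0..})"
  proof (rule weak_sol_classical[OF _ _ t])
    show "weak_sol D A (\<lambda>t. (A ^^ n) (y t))" using weak_sol_power[OF y y0] by blast
    show "(A ^^ n) (y 0) \<in> D" using y0[of "n + 1"] unfolding dom_pow_add by simp
  qed
  from has_vector_derivative_scaleR[OF DERIV_const[of "(- 1) ^ n"] this]
  show "((\<lambda>t. (- 1) ^ n *\<^sub>R (A ^^ n) (y t)) has_vector_derivative (- 1) ^ Suc n *\<^sub>R (A ^^ Suc n) (y t))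
      (at t within {0..})" by simp
qed simp

text \<open>Tested against \<open>x \<in> D\<close>, the operator moves to \<open>x\<close>:
  \<open>inner x (y 0 - y s) = inner (A x) (integral {0..s} y)\<close>. Comparing the derivatives of
  the two sides at \<open>t\<close> gives exactly the hypothesis of \<open>A_dom\<close> for
  \<open>y t\<close>.\<close>

lemma differentiable_weak_sol:
  assumes y: "weak_sol D A y" and t: "t \<ge> 0"
    and d: "(y has_vector_derivative v) (at t within {0..})"
  shows "y t \<in> D" and "A (y t) = - v"
proof -
  have eq: "inner (A x) (y t) = inner x (- v)" if x: "x \<in> D" for x
  proof (rule vector_derivative_unique_halfline[OF t])
    have "((\<lambda>s. inner (A x) (integral {0..s} y)) has_vector_derivative inner (A x) (y t)) (at t within {0..})"
      by (rule bounded_linear.has_vector_derivative[OF bounded_linear_inner_right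
            integral_has_vector_derivative_halfline[OF weak_solD(1)[OF y] t]])
    then show "((\<lambda>s. inner x (y 0 - y s)) has_vector_derivative inner (A x) (y t)) (at t within {0..})"
    proof (rule has_vector_derivative_transform[rotated 2])
      show "inner x (y 0 - y s) = inner (A x) (integral {0..s} y)" if "s \<in> {0..}" for s
        using that weak_solD(2,3)[OF y, of s] A_sym[OF x] by simp
    qed (use t in simp)
    have "((\<lambda>s. y 0 - y s) has_vector_derivative 0 - v) (at t within {0..})"
      by (intro has_vector_derivative_diff has_vector_derivative_const d)
    then have "((\<lambda>s. y 0 - y s) has_vector_derivative - v) (at t within {0..})" by simp
    then show "((\<lambda>s. inner x (y 0 - y s)) has_vector_derivative inner x (- v)) (at t within {0..})"
      by (rule bounded_linear.has_vector_derivative[OF bounded_linear_inner_right])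
  qed
  then show D: "y t \<in> D" by (rule A_dom)
  have "inner x (A (y t) - (- v)) = 0" if "x \<in> D" for x
    using eq[OF that] A_sym[OF that D] by (simp only: inner_diff_right)
  then have "A (y t) - (- v) = 0" by (rule orthogonal_dense_zero)
  then show "A (y t) = - v" by (simp only: right_minus_eq)
qed

lemma derivs_on_weak_sol:
  assumes "weak_sol D A y" and "derivs_on y Dy" and "t \<ge> 0"
  shows "y t \<in> dom_pow D A n \<and> (A ^^ n) (y t) = (- 1) ^ n *\<^sub>R Dy n t"
  using assms
proof (induction n arbitrary: y Dy t)
  case 0 then show ?case by (simp add: derivs_on_def)
next
  case (Suc n)
  note y = Suc.prems(1) and Dy = Suc.prems(2)
  have d: "y s \<in> D \<and> A (y s) = - Dy 1 s" if s: "s \<ge> 0" for s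
  proof -
    have "(Dy 0 has_vector_derivative Dy 1 s) (at s within {0..})"
      using Dy s unfolding derivs_on_def by (metis One_nat_def)
    then have "(y has_vector_derivative Dy 1 s) (at s within {0..})"
      by (rule has_vector_derivative_transform[rotated 2]) (use Dy s in \<open>auto simp: derivs_on_def\<close>)
    then show ?thesis using differentiable_weak_sol[OF y s] by blast
  qed
  have "weak_sol D A (\<lambda>t. A (y t))" using weak_sol_A[OF y] d by simp
  moreover have "derivs_on (\<lambda>t. A (y t)) (\<lambda>n t. - Dy (Suc n) t)"
    using Dy d unfolding derivs_on_def by (auto intro!: has_vector_derivative_minus)
  ultimately have "A (y t) \<in> dom_pow D A n \<and> (A ^^ n) (A (y t)) = (- 1) ^ n *\<^sub>R - Dy (Suc n) t"
    using Suc.IH[of "\<lambda>t. A (y t)" "\<lambda>n t. - Dy (Suc n) t" t] Suc.prems(3) by blast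
  then show ?case using d[OF Suc.prems(3)] by (simp add: funpow_swap1)
qed

end

section \<open>Entire solutions of exponential type\<close>

lemma norm_le_sums:
  fixes f :: "nat \<Rightarrow> 'a::real_normed_vector"
  assumes f: "f sums s" and g: "g sums c" and le: "\<And>n. norm (f n) \<le> g n"
  shows "norm s \<le> c"
proof (rule LIMSEQ_le)
  show "(\<lambda>n. norm (\<Sum>i<n. f i)) \<longlonglongrightarrow> norm s" using f unfolding sums_def by (rule tendsto_norm)
  show "(\<lambda>n. \<Sum>i<n. g i) \<longlonglongrightarrow> c" using g unfolding sums_def .
  show "\<exists>N. \<forall>n\<ge>N. norm (\<Sum>i<n. f i) \<le> (\<Sum>i<n. g i)"
    using le by (auto intro!: sum_norm_le)
qed

locale complex_hilbert =
  fixes J :: "'h::{real_inner, complete_space} \<Rightarrow> 'h"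
  assumes cplx: "cplx_structure J"
begin

lemma J_linear: "linear J" and J_J [simp]: "J (J x) = - x" and J_inner: "inner (J x) (J y) = inner x y"
  using cplx unfolding cplx_structure_def by auto

lemma J_norm [simp]: "norm (J x) = norm x"
  by (simp add: norm_eq_sqrt_inner J_inner)

lemma J_skew: "inner (J x) y = - inner x (J y)"
  using J_inner[of "J x" y] by simp

lemma J_orthogonal: "inner x (J x) = 0"
  using J_skew[of x x] by (simp add: inner_commute)

lemma cscale_norm: "norm (cscale J z x) = cmod z * norm x"
proof -
  have "(norm (cscale J z x))\<^sup>2 = ((Re z)\<^sup>2 + (Im z)\<^sup>2) * (norm x)\<^sup>2"
    unfolding cscale_def power2_norm_eq_inner inner_add_left inner_add_right inner_scaleR_left
      inner_scaleR_right J_inner inner_commute[of "J x" x] J_orthogonal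
    by (simp add: power2_eq_square algebra_simps)
  then have "(norm (cscale J z x))\<^sup>2 = (cmod z * norm x)\<^sup>2" by (simp add: cmod_def power_mult_distrib)
  then show ?thesis by (simp add: power2_eq_iff_nonneg)
qed

lemma cscale_bounded_linear: "bounded_linear (cscale J z)"
  by (rule bounded_linear_intro[where K = "cmod z"])
    (simp_all add: cscale_norm, simp_all add: cscale_def linear_add[OF J_linear] linear_scale[OF J_linear] algebra_simps)

lemma cscale_bounded_linear_left: "bounded_linear (\<lambda>z. cscale J z x)"
  by (rule bounded_linear_intro[where K = "norm x"])
    (simp_all add: cscale_norm, simp_all add: cscale_def algebra_simps)

lemma cscale_mult: "cscale J (z * w) x = cscale J z (cscale J w x)"
  by (simp add: cscale_def linear_add[OF J_linear] linear_scale[OF J_linear] algebra_simps)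

lemma cscale_of_real [simp]: "cscale J (complex_of_real t) x = t *\<^sub>R x"
  by (simp add: cscale_def)

text \<open>The exponential series with the vectors \<open>a n\<close> in place of operator powers;
  it is used with \<open>a n\<close> equal to \<open>(- A)\<^sup>n g\<close>.\<close>

definition E :: "(nat \<Rightarrow> 'h) \<Rightarrow> complex \<Rightarrow> 'h" where
  "E a z = (\<Sum>n. cscale J (z ^ n / fact n) (a n))"

lemma exp_series_sums: "(\<lambda>n. x ^ n / fact n) sums exp (x::real)"
  using exp_converges[of x] by (simp add: divide_inverse mult.commute)

lemma E_sums:
  assumes a: "\<And>n. norm (a n) \<le> C * \<rho> ^ n"
  shows "(\<lambda>n. cscale J (z ^ n / fact n) (a n)) sums E a z"
    and "norm (E a z) \<le> C * exp (\<rho> * cmod z)"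
proof -
  have le: "norm (cscale J (z ^ n / fact n) (a n)) \<le> C * ((\<rho> * cmod z) ^ n / fact n)" for n
  proof -
    have "norm (cscale J (z ^ n / fact n) (a n)) = cmod z ^ n / fact n * norm (a n)"
      by (simp add: cscale_norm norm_divide norm_power)
    also have "\<dots> \<le> cmod z ^ n / fact n * (C * \<rho> ^ n)" by (intro mult_left_mono a) simp
    finally show ?thesis by (simp add: power_mult_distrib mult_ac)
  qed
  have g: "(\<lambda>n. C * ((\<rho> * cmod z) ^ n / fact n)) sums (C * exp (\<rho> * cmod z))"
    by (intro sums_mult exp_series_sums)
  have "summable (\<lambda>n. norm (cscale J (z ^ n / fact n) (a n)))"
    by (rule summable_comparison_test'[OF sums_summable[OF g]]) (use le in simp)
  then show s: "(\<lambda>n. cscale J (z ^ n / fact n) (a n)) sums E a z"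
    unfolding E_def by (rule summable_sums[OF summable_norm_complete])
  show "norm (E a z) \<le> C * exp (\<rho> * cmod z)" by (rule norm_le_sums[OF s g le])
qed

text \<open>Termwise differentiation shifts the coefficient sequence. The remainder after the linear
  term is dominated by \<open>b n * (cmod w)\<^sup>2\<close>, where \<open>b\<close> is the majorant
  of the series differentiated twice.\<close>

lemma E_has_derivative:
  assumes a: "\<And>n. norm (a n) \<le> C * \<rho> ^ n" and r: "\<rho> \<ge> 0"
  shows "(E a has_derivative (\<lambda>w. cscale J w (E (\<lambda>n. a (Suc n)) z))) (at z)"
proof -
  \<comment> \<open>Bounds both \<open>cmod z\<close> and \<open>cmod (z + w)\<close> for increments
    with \<open>cmod w < 1\<close>, as the second-order estimate requires.\<close>
  define K where "K = cmod z + 1"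
  have "norm (a 0) \<le> C" using a[of 0] by simp
  then have C: "C \<ge> 0" using norm_ge_zero order_trans by blast
  have aS: "norm (a (Suc n)) \<le> (C * \<rho>) * \<rho> ^ n" for n using a[of "Suc n"] by (simp add: mult_ac)
  note sE = E_sums(1)[OF a]
  have sE': "(\<lambda>n. cscale J (of_nat n * z ^ (n - Suc 0) / fact n) (a n)) sums E (\<lambda>n. a (Suc n)) z"
  proof -
    have "of_nat (Suc n) * z ^ n / fact (Suc n) = z ^ n / fact n" for n
      by (simp add: field_simps del: of_nat_Suc)
    then have "(\<lambda>n. cscale J (of_nat (Suc n) * z ^ (Suc n - Suc 0) / fact (Suc n)) (a (Suc n))) sums E (\<lambda>n. a (Suc n)) z"
      using E_sums(1)[of "\<lambda>n. a (Suc n)", OF aS, of z] by (simp del: of_nat_Suc fact_Suc)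
    from sums_Suc[OF this] show ?thesis by (simp add: cscale_def)
  qed
  define b where "b n = real n * real (n - Suc 0) * K ^ (n - 2) / fact n * (C * \<rho> ^ n)" for n
  have "summable b"
  proof -
    have "b (Suc (Suc n)) = (C * \<rho>\<^sup>2) * ((K * \<rho>) ^ n / fact n)" for n
      by (simp add: b_def field_simps power2_eq_square power_mult_distrib del: of_nat_Suc)
    then have "summable (\<lambda>n. b (Suc (Suc n)))"
      using summable_mult[OF sums_summable[OF exp_series_sums[of "K * \<rho>"]]] by simp
    then show ?thesis
      using summable_Suc_iff[of b] summable_Suc_iff[of "\<lambda>n. b (Suc n)"] by blast
  qed
  then obtain S where S: "b sums S" by (auto simp: summable_def)
  have bound: "norm (E a (z + w) - E a z - cscale J w (E (\<lambda>n. a (Suc n)) z)) \<le> S * (cmod w)\<^sup>2"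
    if w: "w \<noteq> 0" "cmod w < 1" for w
  proof (rule norm_le_sums)
    let ?c = "\<lambda>n. (z + w) ^ n / fact n - z ^ n / fact n - w * (of_nat n * z ^ (n - Suc 0) / fact n)"
    have "(\<lambda>n. cscale J ((z + w) ^ n / fact n) (a n) - cscale J (z ^ n / fact n) (a n)
         - cscale J w (cscale J (of_nat n * z ^ (n - Suc 0) / fact n) (a n)))
        sums (E a (z + w) - E a z - cscale J w (E (\<lambda>n. a (Suc n)) z))"
      by (intro sums_diff sE bounded_linear.sums[OF cscale_bounded_linear sE'])
    then show "(\<lambda>n. cscale J (?c n) (a n)) sums (E a (z + w) - E a z - cscale J w (E (\<lambda>n. a (Suc n)) z))"
      by (simp only: cscale_mult linear_simps(2)[OF cscale_bounded_linear_left])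
    show "(\<lambda>n. b n * (cmod w)\<^sup>2) sums (S * (cmod w)\<^sup>2)" by (intro sums_mult2 S)
    fix n
    have "cmod (z + w) \<le> K" using norm_triangle_ineq[of z w] w by (simp add: K_def)
    then have "cmod (((z + w) ^ n - z ^ n) / w - of_nat n * z ^ (n - Suc 0))
        \<le> of_nat n * of_nat (n - Suc 0) * K ^ (n - 2) * cmod w"
      using w by (intro lemma_termdiff3) (auto simp: K_def)
    then have "cmod w / fact n * cmod (((z + w) ^ n - z ^ n) / w - of_nat n * z ^ (n - Suc 0))
        \<le> cmod w / fact n * (of_nat n * of_nat (n - Suc 0) * K ^ (n - 2) * cmod w)"
      by (intro mult_left_mono) auto
    moreover have "?c n = w / fact n * (((z + w) ^ n - z ^ n) / w - of_nat n * z ^ (n - Suc 0))"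
      using w by (simp add: field_simps)
    then have "cmod (?c n) = cmod w / fact n * cmod (((z + w) ^ n - z ^ n) / w - of_nat n * z ^ (n - Suc 0))"
      by (simp only: norm_mult norm_divide norm_fact)
    ultimately have "cmod (?c n) \<le> real n * real (n - Suc 0) * K ^ (n - 2) / fact n * (cmod w)\<^sup>2"
      by (simp add: power2_eq_square mult_ac)
    then have "cmod (?c n) * norm (a n)
        \<le> (real n * real (n - Suc 0) * K ^ (n - 2) / fact n * (cmod w)\<^sup>2) * (C * \<rho> ^ n)"
      by (intro mult_mono a) (auto simp: K_def)
    then show "norm (cscale J (?c n) (a n)) \<le> b n * (cmod w)\<^sup>2"
      by (simp only: cscale_norm b_def mult_ac)
  qed
  show ?thesis
  proof (rule has_derivativeI_sandwich[of 1])
    show "bounded_linear (\<lambda>w. cscale J w (E (\<lambda>n. a (Suc n)) z))" by (rule cscale_bounded_linear_left)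
    show "norm (E a y - E a z - cscale J (y - z) (E (\<lambda>n. a (Suc n)) z)) / norm (y - z) \<le> S * cmod (y - z)"
      if "y \<noteq> z" "dist y z < 1" for y
    proof -
      have "norm (E a y - E a z - cscale J (y - z) (E (\<lambda>n. a (Suc n)) z)) \<le> S * (cmod (y - z))\<^sup>2"
        using bound[of "y - z"] that by (simp add: dist_norm)
      then show ?thesis using that by (simp add: divide_le_eq power2_eq_square mult.assoc)
    qed
    have "((\<lambda>y. S * cmod (y - z)) \<longlongrightarrow> S * cmod (z - z)) (at z)" by (intro tendsto_intros)
    then show "((\<lambda>y. S * cmod (y - z)) \<longlongrightarrow> 0) (at z)" by simp
  qed simp
qed

end

locale complex_nonneg_op = nonneg_op D A + complex_hilbert J
  for J :: "'h::{real_inner, complete_space} \<Rightarrow> 'h" and D :: "'h set" and A :: "'h \<Rightarrow> 'h" +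
  assumes J_D: "x \<in> D \<Longrightarrow> J x \<in> D" and A_J: "x \<in> D \<Longrightarrow> A (J x) = J (A x)"

lemma complex_nonneg_opI:
  fixes J :: "'h::{real_inner, complete_space} \<Rightarrow> 'h"
  assumes "cplx_structure J" "nonneg_selfadjoint J D A"
  shows "complex_nonneg_op J D A"
proof
  note A = assms(2)[unfolded nonneg_selfadjoint_def]
  show "subspace D" "closure D = UNIV" using A by blast+
  show "A (x + y) = A x + A y" if "x \<in> D" "y \<in> D" for x y using A that by blast
  show "A (c *\<^sub>R x) = c *\<^sub>R A x" if "x \<in> D" for x c using A that by blast
  show "inner (A x) y = inner x (A y)" if "x \<in> D" "y \<in> D" for x y using A that by blast
  show "y \<in> D" if "\<And>x. x \<in> D \<Longrightarrow> inner (A x) y = inner x z" for y z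
  proof -
    have "(\<forall>x\<in>D. inner (A x) y = inner x z) \<longrightarrow> y \<in> D" using A by blast
    then show ?thesis using that by blast
  qed
  show "inner (A x) x \<ge> 0" if "x \<in> D" for x using A that by blast
  show "J x \<in> D" "A (J x) = J (A x)" if "x \<in> D" for x using A that by blast+
qed (rule assms(1))

context nonneg_op
begin

text \<open>That the integral of \<open>y\<close> lies in \<open>D\<close> is obtained by
  integrating \<open>y s = R (A (y s) + y s)\<close>: the bounded \<open>R\<close> comes out of the
  integral and its values lie in \<open>D\<close>.\<close>

lemma classical_weak_sol:
  assumes D: "\<And>t. t \<ge> 0 \<Longrightarrow> y t \<in> D"
    and d: "\<And>t. t \<ge> 0 \<Longrightarrow> (y has_vector_derivative - A (y t)) (at t within {0..})"
    and c: "continuous_on {0..} (\<lambda>t. A (y t))"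
  shows "weak_sol D A y"
  unfolding weak_sol_def
proof (intro conjI allI impI)
  show cy: "continuous_on {0..} y"
    using d by (auto simp: continuous_on_eq_continuous_within intro: has_vector_derivative_continuous)
  fix t :: real assume t: "t \<ge> 0"
  have iy: "(y has_integral integral {0..t} y) {0..t}"
    by (intro integrable_integral integrable_continuous_complete continuous_on_subset[OF cy]) auto
  have "((\<lambda>s. - A (y s)) has_integral (y t - y 0)) {0..t}"
    by (rule fundamental_theorem_of_calculus_complete[OF t])
      (auto intro: has_vector_derivative_within_subset[OF d])
  from has_integral_neg[OF this] have iA: "((\<lambda>s. A (y s)) has_integral (y 0 - y t)) {0..t}" by simp
  have "((R \<circ> (\<lambda>s. A (y s) + y s)) has_integral R (y 0 - y t + integral {0..t} y)) {0..t}"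
    by (intro has_integral_linear has_integral_add iA iy R_bounded_linear)
  then have "(y has_integral R (y 0 - y t + integral {0..t} y)) {0..t}"
    by (rule has_integral_eq[rotated]) (simp add: R_shift D)
  with iy have eq: "integral {0..t} y = R (y 0 - y t + integral {0..t} y)"
    by (rule has_integral_unique)
  then show "integral {0..t} y \<in> D" by (rule ssubst) (rule R_dom)
  have "A (integral {0..t} y) + integral {0..t} y = y 0 - y t + integral {0..t} y"
    using shift_R[of "y 0 - y t + integral {0..t} y"] unfolding eq[symmetric] .
  then show "y t = - A (integral {0..t} y) + y 0" by (simp add: algebra_simps)
qed

lemma M_A_power: "v \<in> M \<rho> \<Longrightarrow> (A ^^ n) v \<in> M \<rho>"
  by (induction n) (auto intro: M_A)

lemma M_A_power_norm:
  assumes r: "\<rho> > 0" and v: "v \<in> M \<rho>" shows "norm ((A ^^ n) v) \<le> norm v * \<rho> ^ n"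
proof (induction n)
  case (Suc n)
  have "norm ((A ^^ Suc n) v) \<le> \<rho> * norm ((A ^^ n) v)"
    using M_A_norm[OF r M_A_power[OF v]] by simp
  also have "\<dots> \<le> \<rho> * (norm v * \<rho> ^ n)" using Suc r by (intro mult_left_mono) auto
  finally show ?case by (simp add: mult_ac)
qed simp

end

context complex_nonneg_op
begin

lemma entire_solution:
  assumes r: "\<rho> > 0" and g: "g \<in> M \<rho>"
  shows "\<exists>y0 \<in> S0_le J D A \<rho>. y0 0 = g"
proof -
  define a where "a n = (- 1) ^ n *\<^sub>R (A ^^ n) g" for n
  have aM: "a n \<in> M \<rho>" for n
    unfolding a_def by (intro subspace_scale[OF M_subspace] M_A_power g)
  have a_norm: "norm (a n) \<le> norm g * \<rho> ^ n" for n
    using M_A_power_norm[OF r g, of n] by (simp add: a_def)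
  have Aa: "A (a n) = - a (Suc n)" for n
    using M_dom[OF M_A_power[OF g]] by (simp add: a_def A_scale)
  have aS: "norm (a (Suc n)) \<le> (norm g * \<rho>) * \<rho> ^ n" for n
    using a_norm[of "Suc n"] by (simp add: mult_ac)
  define y0 where "y0 t = E a (complex_of_real t)" for t
  have y0_sums: "(\<lambda>n. (t ^ n / fact n) *\<^sub>R a n) sums y0 t" for t
  proof -
    have eq: "complex_of_real t ^ n / fact n = complex_of_real (t ^ n / fact n)" for n by simp
    show ?thesis using E_sums(1)[OF a_norm, of "complex_of_real t"]
      unfolding eq cscale_of_real y0_def .
  qed
  have y1_sums: "(\<lambda>n. (t ^ n / fact n) *\<^sub>R a (Suc n)) sums E (\<lambda>n. a (Suc n)) (complex_of_real t)" for t
  proof -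
    have eq: "complex_of_real t ^ n / fact n = complex_of_real (t ^ n / fact n)" for n by simp
    show ?thesis using E_sums(1)[of "\<lambda>n. a (Suc n)", OF aS, of "complex_of_real t"]
      unfolding eq cscale_of_real .
  qed
  have y0M: "y0 t \<in> M \<rho>" for t
  proof (rule closed_sequentially[OF M_closed[OF r]])
    show "(\<lambda>n. \<Sum>i<n. (t ^ i / fact i) *\<^sub>R a i) \<longlonglongrightarrow> y0 t" using y0_sums unfolding sums_def .
    show "(\<Sum>i<n. (t ^ i / fact i) *\<^sub>R a i) \<in> M \<rho>" for n
      by (intro subspace_sum[OF M_subspace] subspace_scale[OF M_subspace] aM)
  qed
  have Ay0: "E (\<lambda>n. a (Suc n)) (complex_of_real t) = - A (y0 t)" for t
  proof (rule sums_unique2[OF y1_sums])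
    \<comment> \<open>\<open>P \<rho>\<close> is inserted, at no cost on \<open>M \<rho>\<close>,
      because the composite with \<open>A\<close> is bounded and may be applied termwise.\<close>
    have "(\<lambda>n. A (P \<rho> ((t ^ n / fact n) *\<^sub>R a n))) sums A (P \<rho> (y0 t))"
      by (rule bounded_linear.sums[OF AP_bounded_linear[OF r] y0_sums])
    then have "(\<lambda>n. A ((t ^ n / fact n) *\<^sub>R a n)) sums A (y0 t)"
      by (simp add: P_id[OF r] y0M aM subspace_scale[OF M_subspace])
    then have "(\<lambda>n. - ((t ^ n / fact n) *\<^sub>R a (Suc n))) sums A (y0 t)"
      by (simp add: A_scale M_dom[OF aM] Aa)
    from sums_minus[OF this] show "(\<lambda>n. (t ^ n / fact n) *\<^sub>R a (Suc n)) sums - A (y0 t)" by simp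
  qed
  have d: "(y0 has_vector_derivative - A (y0 t)) (at t within S)" for t S
  proof -
    have "((\<lambda>t. complex_of_real t) has_derivative complex_of_real) (at t within S)"
      by (intro derivative_intros)
    from has_derivative_compose[OF this E_has_derivative[OF a_norm, of "complex_of_real t"]] r
    show ?thesis unfolding has_vector_derivative_def y0_def[abs_def, symmetric]
      by (simp add: Ay0[unfolded y0_def] y0_def)
  qed
  have cy: "continuous_on {0..} y0"
    using d by (auto simp: continuous_on_eq_continuous_within intro: has_vector_derivative_continuous)
  have ws: "weak_sol D A y0"
  proof (rule classical_weak_sol)
    have "continuous_on {0..} (\<lambda>t. A (P \<rho> (y0 t)))"
      by (rule bounded_linear.continuous_on[OF AP_bounded_linear[OF r] cy])
    then show "continuous_on {0..} (\<lambda>t. A (y0 t))" by (simp add: P_id[OF r] y0M)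
  qed (use d M_dom[OF y0M] in auto)
  have ex: "\<rho> \<in> exp_type_set (E a)"
    unfolding exp_type_set_def using r E_sums(2)[OF a_norm] by blast
  have "exp_type (E a) \<le> \<rho>"
    unfolding exp_type_def by (rule cInf_lower[OF ex]) (auto simp: exp_type_set_def bdd_below_def intro!: exI[of _ 0])
  moreover have "entire_J J (E a)"
    unfolding entire_J_def using E_has_derivative[OF a_norm] r by (meson less_imp_le)
  ultimately have "y0 \<in> S0_le J D A \<rho>"
    unfolding S0_le_def using ws ex by (auto simp: y0_def intro!: exI[of _ "E a"])
  moreover have "y0 0 = g"
  proof -
    have "(\<lambda>n. (0 ^ n / fact n) *\<^sub>R a n) sums a 0"
      using sums_single[of 0 a] by (rule sums_cong[THEN iffD1, rotated]) auto
    from sums_unique2[OF this y0_sums[of 0]] show ?thesis by (simp add: a_def)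
  qed
  ultimately show ?thesis by blast
qed

end

section \<open>Initial values of entire solutions of exponential type\<close>

context complex_nonneg_op
begin

text \<open>The complex inner product of \<open>F z\<close> with \<open>h\<close>, linear in
  \<open>F z\<close>, recovered from its real part by \<open>J_skew\<close>. It reduces the
  vector-valued \<open>F\<close> to scalar entire functions.\<close>

definition pairing :: "(complex \<Rightarrow> 'h) \<Rightarrow> 'h \<Rightarrow> complex \<Rightarrow> complex" where
  "pairing F h z = Complex (inner (F z) h) (inner (F z) (J h))"

lemma pairing_has_field_derivative:
  assumes "(F has_derivative (\<lambda>w. cscale J w v)) (at z)"
  shows "(pairing F h has_field_derivative Complex (inner v h) (inner v (J h))) (at z)"
proof -
  have 1: "((\<lambda>z. inner (F z) h) has_derivative (\<lambda>w. inner (cscale J w v) h)) (at z)" for h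
    by (rule has_derivative_inner_left[OF assms])
  have "((\<lambda>z. inner (F z) h *\<^sub>R 1 + inner (F z) (J h) *\<^sub>R \<i>) has_derivative
      (\<lambda>w. inner (cscale J w v) h *\<^sub>R 1 + inner (cscale J w v) (J h) *\<^sub>R \<i>)) (at z)"
    by (intro has_derivative_add has_derivative_scaleR_left 1)
  then have "(pairing F h has_derivative
      (\<lambda>w. inner (cscale J w v) h *\<^sub>R 1 + inner (cscale J w v) (J h) *\<^sub>R \<i>)) (at z)"
    by (rule has_derivative_transform[rotated 2]) (auto simp: pairing_def complex_eq_iff)
  moreover have "(\<lambda>w. inner (cscale J w v) h *\<^sub>R 1 + inner (cscale J w v) (J h) *\<^sub>R \<i>) =
      (*) (Complex (inner v h) (inner v (J h)))"
    by (auto simp: fun_eq_iff complex_eq_iff cscale_def inner_add_left J_skew[of v] algebra_simps)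
  ultimately show ?thesis unfolding has_field_derivative_def by simp
qed

lemma pairing_bound: "cmod (pairing F h z) \<le> 2 * norm (F z) * norm h"
proof -
  have "cmod (pairing F h z) \<le> \<bar>inner (F z) h\<bar> + \<bar>inner (F z) (J h)\<bar>"
    using cmod_le[of "pairing F h z"] by (simp add: pairing_def)
  then show ?thesis
    using Cauchy_Schwarz_ineq2[of "F z" h] Cauchy_Schwarz_ineq2[of "F z" "J h"] by simp
qed

lemma pairing_uminus: "pairing F (- h) z = - pairing F h z"
  by (simp add: pairing_def complex_eq_iff linear_neg[OF J_linear])

text \<open>Off the half-line \<open>F z\<close> is not known to lie in \<open>D\<close>, so
  \<open>A\<close> acts on the test vector. On the half-line the identity is the weak equation
  tested against \<open>h\<close> and \<open>J h\<close>; both sides are entire, and the half-line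
  accumulates at \<open>0\<close>.\<close>

lemma deriv_pairing:
  assumes F: "entire_J J F" and y0: "weak_sol D A y0" and ext: "\<And>t. t \<ge> 0 \<Longrightarrow> F (complex_of_real t) = y0 t"
    and h: "h \<in> D"
  shows "deriv (pairing F h) z = pairing F (- A h) z"
proof -
  have d: "(pairing F h has_field_derivative deriv (pairing F h) z) (at z)" for z h
    using F pairing_has_field_derivative unfolding entire_J_def
    by (metis DERIV_imp_deriv)
  have hol: "pairing F h holomorphic_on UNIV" for h
    using d by (auto simp: holomorphic_on_open)
  have real: "deriv (pairing F h) (complex_of_real t) = - pairing F (A h) (complex_of_real t)" if t: "t \<ge> 0" for t
  proof (rule vector_derivative_unique_halfline[OF t])
    show "((\<lambda>t. pairing F h (complex_of_real t)) has_vector_derivative deriv (pairing F h) (complex_of_real t)) (at t within {0..})"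
      by (rule has_vector_derivative_real_field[OF d])
    have i: "((\<lambda>s. inner (y0 s) k) has_vector_derivative - inner (y0 t) (A k)) (at t within {0..})" if k: "k \<in> D" for k
    proof (rule has_vector_derivative_transform)
      show "t \<in> {0..}" using t by simp
      show "inner (y0 s) k = inner (y0 0) k - inner (integral {0..s} y0) (A k)" if "s \<in> {0..}" for s
        using weak_solD(2,3)[OF y0, of s] that A_sym[OF _ k, of "integral {0..s} y0"] by (simp add: inner_diff_left)
      have "((\<lambda>s. inner (integral {0..s} y0) (A k)) has_vector_derivative inner (y0 t) (A k)) (at t within {0..})"
        by (rule bounded_linear.has_vector_derivative[OF bounded_linear_inner_left
              integral_has_vector_derivative_halfline[OF weak_solD(1)[OF y0] t]])
      from has_vector_derivative_diff[OF has_vector_derivative_const this]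
      show "((\<lambda>s. inner (y0 0) k - inner (integral {0..s} y0) (A k)) has_vector_derivative - inner (y0 t) (A k)) (at t within {0..})"
        by simp
    qed
    have "((\<lambda>s. of_real (inner (y0 s) h) + \<i> * of_real (inner (y0 s) (J h))) has_vector_derivative
        of_real (- inner (y0 t) (A h)) + \<i> * of_real (- inner (y0 t) (A (J h)))) (at t within {0..})"
      by (intro has_vector_derivative_add has_vector_derivative_mult_right has_vector_derivative_of_real
           i[OF h, unfolded has_real_derivative_iff_has_vector_derivative[symmetric]]
           i[OF J_D[OF h], unfolded has_real_derivative_iff_has_vector_derivative[symmetric]])
    then have "((\<lambda>t. pairing F h (complex_of_real t)) has_vector_derivative
        of_real (- inner (y0 t) (A h)) + \<i> * of_real (- inner (y0 t) (A (J h)))) (at t within {0..})"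
      by (rule has_vector_derivative_transform[rotated 2]) (use t in \<open>auto simp: pairing_def ext complex_eq_iff\<close>)
    moreover have "of_real (- inner (y0 t) (A h)) + \<i> * of_real (- inner (y0 t) (A (J h))) = - pairing F (A h) (complex_of_real t)"
      using t by (simp add: pairing_def ext complex_eq_iff A_J h)
    ultimately show "((\<lambda>t. pairing F h (complex_of_real t)) has_vector_derivative - pairing F (A h) (complex_of_real t)) (at t within {0..})"
      by simp
  qed
  have "deriv (pairing F h) z + pairing F (A h) z = 0"
  proof (rule analytic_continuation[of "\<lambda>z. deriv (pairing F h) z + pairing F (A h) z" UNIV "complex_of_real ` {0..}" 0])
    show "(\<lambda>z. deriv (pairing F h) z + pairing F (A h) z) holomorphic_on UNIV"
      by (intro holomorphic_on_add holomorphic_deriv hol) auto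
    show "0 islimpt complex_of_real ` {0..}"
      unfolding islimpt_approachable
    proof (intro allI impI)
      fix e :: real assume "e > 0"
      then show "\<exists>x'\<in>complex_of_real ` {0..}. x' \<noteq> 0 \<and> dist x' 0 < e"
        by (intro bexI[OF _ imageI[of "e / 2"]]) auto
    qed
    show "deriv (pairing F h) w + pairing F (A h) w = 0" if "w \<in> complex_of_real ` {0..}" for w
      using that real by auto
  qed auto
  then show ?thesis by (simp add: pairing_uminus add_eq_0_iff2)
qed

lemma shift_lower_bound:
  assumes r: "\<rho> > 1" and v: "v \<in> D" and P: "P \<rho> v = 0"
  shows "(\<rho> - 1) * norm v \<le> norm (A v)"
proof -
  have "\<rho> * norm v \<le> norm (A v + v)" using norm_shift_P_compl[of \<rho> v] r v P by simp
  also have "\<dots> \<le> norm (A v) + norm v" by (rule norm_triangle_ineq)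
  finally show ?thesis by (simp add: algebra_simps)
qed

text \<open>For \<open>x = P s g - P \<rho> g\<close> with \<open>g = y0 0\<close>, the derivative of order \<open>2 m\<close> of \<open>pairing F x\<close> at \<open>0\<close> has
  real part \<open>norm (A\<^sup>m x)\<^sup>2\<close>, which grows at least like \<open>(7 q)\<^sup>2\<^sup>m\<close> unless \<open>x = 0\<close>, whereas Cauchy's
  inequality on a circle of radius \<open>2 m / q\<close> allows only \<open>(3 q)\<^sup>2\<^sup>m\<close>.\<close>

lemma S0_le_M:
  assumes y0: "y0 \<in> S0_le J D A r" and r: "r \<ge> 0"
  shows "y0 0 \<in> M (8 * (r + 1))"
proof -
  define q where "q = r + 1"
  \<comment> \<open>The factor 8 yields \<open>\<rho> - 1 \<ge> 7 * q\<close>, comfortably above the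
    rate \<open>3 * q\<close> that Cauchy's inequality allows through \<open>exp 1 \<le> 3\<close>.
    Taking \<open>q = r + 1\<close> leaves room above the infimum defining the type and ensures
    \<open>q \<ge> 1\<close>.\<close>
  define \<rho> where "\<rho> = 8 * q"
  have q: "q \<ge> 1" using r by (simp add: q_def)
  have \<rho>: "\<rho> > 1" "\<rho> > 0" "\<rho> - 1 \<ge> 7 * q" using q by (auto simp: \<rho>_def)
  obtain F where ws: "weak_sol D A y0" and F: "entire_J J F"
    and ext: "\<And>t. t \<ge> 0 \<Longrightarrow> F (complex_of_real t) = y0 t"
    and ne: "exp_type_set F \<noteq> {}" and ty: "exp_type F \<le> r"
    using y0 unfolding S0_le_def by blast
  have "Inf (exp_type_set F) < q" using ty by (simp add: exp_type_def q_def)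
  then obtain \<alpha> where "\<alpha> \<in> exp_type_set F" "\<alpha> < q" using cInf_lessD[OF ne] by blast
  then obtain c where c: "\<And>z. norm (F z) \<le> c * exp (\<alpha> * cmod z)" and "\<alpha> > 0"
    unfolding exp_type_set_def by blast
  have "norm (F 0) \<le> c" using c[of 0] by simp
  then have c0: "c \<ge> 0" using norm_ge_zero order_trans by blast
  have Fq: "norm (F z) \<le> c * exp (q * cmod z)" for z
  proof -
    have "\<alpha> * cmod z \<le> q * cmod z" using \<open>\<alpha> < q\<close> by (intro mult_right_mono) auto
    then have "c * exp (\<alpha> * cmod z) \<le> c * exp (q * cmod z)" using c0 by (intro mult_left_mono) auto
    then show ?thesis using c[of z] by linarith
  qed
  define g where "g = y0 0"
  have F0: "F 0 = g" using ext[of 0] by (simp add: g_def)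
  \<comment> \<open>So \<open>g\<close> has no part between \<open>\<rho>\<close> and any larger
    \<open>s\<close>; with \<open>P_tendsto\<close> this gives
    \<open>g = P \<rho> g\<close>.\<close>
  have eq: "P s g = P \<rho> g" if s: "s \<ge> \<rho>" for s
  proof -
    have s0: "s > 0" using s \<rho> by simp
    define x where "x = P s g - P \<rho> g"
    define N where "N = {v \<in> M s. P \<rho> v = 0}"
    interpret PP: bounded_linear "P \<rho>" by (rule P_bounded_linear[OF \<rho>(2)])
    have sub: "M \<rho> \<subseteq> M s" by (rule M_mono[OF \<rho>(2) s])
    have "P \<rho> (P s g) = P \<rho> g"
    proof (rule P_eqI[OF \<rho>(2) P_M[OF \<rho>(2)]])
      fix m assume m: "m \<in> M \<rho>"
      have "inner (P s g - P \<rho> g) m = inner (g - P \<rho> g) m - inner (g - P s g) m"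
        by (simp add: inner_diff_left)
      then show "inner (P s g - P \<rho> g) m = 0"
        using P_orth[OF \<rho>(2) m, of g] P_orth[OF s0, of m g] m sub by auto
    qed
    then have xN: "x \<in> N"
      using P_M[OF s0, of g] P_M[OF \<rho>(2), of g] sub
      by (auto simp: N_def x_def PP.diff P_id[OF \<rho>(2)] intro!: subspace_diff[OF M_subspace])
    have ND: "v \<in> D" if "v \<in> N" for v using that M_dom by (auto simp: N_def)
    have NA: "- A v \<in> N" if "v \<in> N" for v
    proof -
      have "P \<rho> (A v) = 0" using P_A[OF \<rho>(2) ND[OF that]] that by (simp add: N_def)
      then show ?thesis using that by (auto simp: N_def PP.neg intro!: subspace_neg[OF M_subspace] M_A)
    qed
    define B where "B v = - A v" for v
    have NB: "(B ^^ n) x \<in> N" for n by (induction n) (auto simp: B_def xN NA)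
    have B_norm: "(7 * q) ^ n * norm x \<le> norm ((B ^^ n) x)" for n
    proof (induction n)
      case (Suc n)
      have v: "(B ^^ n) x \<in> D" "P \<rho> ((B ^^ n) x) = 0" using NB[of n] ND by (auto simp: N_def)
      have "(7 * q) ^ Suc n * norm x = 7 * q * ((7 * q) ^ n * norm x)" by simp
      also have "\<dots> \<le> (\<rho> - 1) * norm ((B ^^ n) x)" using Suc \<rho> q by (intro mult_mono) auto
      also have "\<dots> \<le> norm (A ((B ^^ n) x))" by (rule shift_lower_bound[OF \<rho>(1) v])
      finally show ?case by (simp add: B_def[of "(B ^^ n) x"])
    qed simp
    \<comment> \<open>Symmetry rewrites \<open>norm ((B ^^ m) x)\<^sup>2\<close> as a single inner
      product with \<open>(B ^^ (2 * m)) x\<close>, that is, as a derivative of even order.\<close>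
    have B_sym: "inner ((B ^^ n) x) ((B ^^ k) x) = inner x ((B ^^ (n + k)) x)" for n k
    proof (induction n arbitrary: k)
      case (Suc n)
      have "inner ((B ^^ Suc n) x) ((B ^^ k) x) = inner ((B ^^ n) x) ((B ^^ Suc k) x)"
        using A_sym[OF ND[OF NB] ND[OF NB], of n k] by (simp add: B_def)
      also have "\<dots> = inner x ((B ^^ (n + Suc k)) x)" by (rule Suc.IH)
      finally show ?case by simp
    qed simp
    \<comment> \<open>Against vectors of \<open>N\<close> the initial value \<open>g\<close> acts
      only through its part \<open>x\<close>, so derivatives of the pairing at \<open>0\<close> see
      \<open>x\<close> alone.\<close>
    have gx: "inner g v = inner x v" if "v \<in> N" for v
    proof -
      have "inner (g - P s g) v = 0" using that by (intro P_orth[OF s0]) (auto simp: N_def)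
      moreover have "inner (v - P \<rho> v) (P \<rho> g) = 0" by (rule P_orth[OF \<rho>(2) P_M[OF \<rho>(2)]])
      ultimately show ?thesis using that by (simp add: x_def N_def inner_diff_left inner_commute[of v])
    qed
    have der: "(deriv ^^ n) (pairing F x) = pairing F ((B ^^ n) x)" for n
    proof (induction n)
      case (Suc n)
      show ?case
        using deriv_pairing[OF F ws ext ND[OF NB[of n]]] by (simp add: Suc B_def[of "(B ^^ n) x"] fun_eq_iff)
    qed simp
    have main: "(7 * q) ^ (2 * m) * (norm x)\<^sup>2 \<le> (3 * q) ^ (2 * m) * (2 * c * norm x)" if m: "m > 0" for m
    proof -
      let ?n = "2 * m"
      \<comment> \<open>This radius minimises \<open>exp (q * T) / T ^ (2 * m)\<close>.\<close>
      define T where "T = real ?n / q"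
      have T: "T > 0" using m q by (simp add: T_def)
      have hol: "pairing F x holomorphic_on UNIV"
        using F pairing_has_field_derivative unfolding entire_J_def
        by (auto simp: holomorphic_on_open) metis
      have ca: "cmod ((deriv ^^ ?n) (pairing F x) 0) \<le> fact ?n * (2 * c * norm x * exp (real ?n)) / T ^ ?n"
      proof (rule Cauchy_inequality[OF _ _ T])
        show "pairing F x holomorphic_on ball 0 T" using hol by (rule holomorphic_on_subset) auto
        show "continuous_on (cball 0 T) (pairing F x)"
          using holomorphic_on_imp_continuous_on[OF hol] by (rule continuous_on_subset) auto
        fix z :: complex assume z: "cmod (0 - z) = T"
        have "2 * norm (F z) * norm x \<le> 2 * (c * exp (q * cmod z)) * norm x"
          using Fq[of z] by (intro mult_right_mono mult_left_mono) auto
        moreover have "q * cmod z = real ?n" using z q by (simp add: T_def)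
        ultimately show "cmod (pairing F x z) \<le> 2 * c * norm x * exp (real ?n)"
          using pairing_bound[of F x z] by (simp add: mult_ac)
      qed
      have "fact ?n \<le> real ?n ^ ?n" using fact_le_power[of ?n, where 'a = real] by simp
      then have "fact ?n * (2 * c * norm x * exp (real ?n)) / T ^ ?n \<le>
          real ?n ^ ?n * (2 * c * norm x * exp (real ?n)) / T ^ ?n"
        using c0 T by (intro divide_right_mono mult_right_mono) auto
      also have "\<dots> = q ^ ?n * (2 * c * norm x * exp (real ?n))"
        using m q by (simp add: T_def power_divide)
      also have "\<dots> \<le> q ^ ?n * (2 * c * norm x * 3 ^ ?n)"
      proof -
        have "exp (real ?n) = exp 1 ^ ?n" using exp_of_nat_mult[of ?n "1::real"] by simp
        also have "\<dots> \<le> 3 ^ ?n" using exp_le by (intro power_mono) auto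
        finally show ?thesis using c0 q by (intro mult_left_mono) auto
      qed
      also have "\<dots> = (3 * q) ^ ?n * (2 * c * norm x)" by (simp add: power_mult_distrib)
      finally have up: "cmod ((deriv ^^ ?n) (pairing F x) 0) \<le> (3 * q) ^ ?n * (2 * c * norm x)"
        using ca by linarith
      have "(7 * q) ^ ?n * (norm x)\<^sup>2 = ((7 * q) ^ m * norm x)\<^sup>2"
        by (simp add: power_mult_distrib power_mult[symmetric] mult.commute)
      also have "\<dots> \<le> (norm ((B ^^ m) x))\<^sup>2" using B_norm q by (intro power_mono) auto
      also have "\<dots> = inner x ((B ^^ ?n) x)" unfolding power2_norm_eq_inner B_sym by (simp add: mult_2)
      also have "\<dots> = Re (pairing F ((B ^^ ?n) x) 0)" by (simp add: pairing_def F0 gx[OF NB])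
      also have "\<dots> \<le> cmod ((deriv ^^ ?n) (pairing F x) 0)" unfolding der by (rule complex_Re_le_cmod)
      finally show ?thesis using up by linarith
    qed
    have "x = 0"
    proof (rule ccontr)
      assume "x \<noteq> 0"
      then have nx: "norm x > 0" by simp
      have "(7/3) ^ k * norm x \<le> 2 * c" for k
      proof -
        have "(3 * q) ^ (2 * Suc k) * ((7/3) ^ (2 * Suc k) * norm x) * norm x = (7 * q) ^ (2 * Suc k) * (norm x)\<^sup>2"
          by (simp only: power2_eq_square mult.assoc[symmetric] power_mult_distrib[symmetric]) (simp add: field_simps)
        also have "\<dots> \<le> (3 * q) ^ (2 * Suc k) * (2 * c * norm x)" by (rule main) simp
        finally have "(3 * q) ^ (2 * Suc k) * ((7/3) ^ (2 * Suc k) * norm x) * norm x \<le> (3 * q) ^ (2 * Suc k) * (2 * c) * norm x"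
          by (simp only: mult.assoc)
        then have "(3 * q) ^ (2 * Suc k) * ((7/3) ^ (2 * Suc k) * norm x) \<le> (3 * q) ^ (2 * Suc k) * (2 * c)"
          by (rule mult_right_le_imp_le[OF _ nx])
        then have 1: "(7/3) ^ (2 * Suc k) * norm x \<le> 2 * c"
          by (rule mult_left_le_imp_le) (use q in simp)
        have "(7/3::real) ^ k * norm x \<le> (7/3) ^ (2 * Suc k) * norm x"
          by (intro mult_right_mono power_increasing) auto
        then show ?thesis using 1 by linarith
      qed
      then have le: "(7/3) ^ k \<le> 2 * c / norm x" for k using nx by (simp only: pos_le_divide_eq)
      obtain k where "2 * c / norm x < (7/3) ^ k" using real_arch_pow[of "7/3"] by auto
      then show False using le[of k] by linarith
    qed
    then show ?thesis by (simp add: x_def)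
  qed
  have "(\<lambda>n. P (real (Suc n)) g) \<longlonglongrightarrow> P \<rho> g"
  proof (rule tendsto_eventually, rule eventually_mono)
    show "\<forall>\<^sub>F n in sequentially. n \<ge> nat \<lceil>\<rho>\<rceil>" by (rule eventually_ge_at_top)
    show "P (real (Suc n)) g = P \<rho> g" if "n \<ge> nat \<lceil>\<rho>\<rceil>" for n
      by (rule eq) (use that in linarith)
  qed
  then have "g = P \<rho> g" using P_tendsto LIMSEQ_unique by blast
  then show ?thesis using P_M[OF \<rho>(2), of g] by (simp add: g_def \<rho>_def q_def)
qed

end

section \<open>Direct and inverse estimates for best approximation\<close>

context nonneg_op
begin

lemma P_compl_power:
  assumes r: "\<rho> > 0" and f: "f \<in> dom_pow D A n"
  shows "f - P \<rho> f \<in> dom_pow D A n" and "(A ^^ n) (f - P \<rho> f) = (A ^^ n) f - P \<rho> ((A ^^ n) f)"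
proof -
  have "f - P \<rho> f \<in> dom_pow D A n \<and> (A ^^ n) (f - P \<rho> f) = (A ^^ n) f - P \<rho> ((A ^^ n) f)"
    using f
  proof (induction n arbitrary: f)
    case (Suc n)
    then have fD: "f \<in> D" and Af: "A f \<in> dom_pow D A n" by auto
    have "A (f - P \<rho> f) = A f - P \<rho> (A f)"
      using fD by (simp add: A_diff P_A[OF r] M_dom[OF P_M[OF r]])
    moreover have "f - P \<rho> f \<in> D" by (intro subspace_diff[OF subD] fD M_dom[OF P_M[OF r]])
    ultimately show ?case using Suc.IH[OF Af] by (simp add: funpow_swap1)
  qed simp
  then show "f - P \<rho> f \<in> dom_pow D A n" "(A ^^ n) (f - P \<rho> f) = (A ^^ n) f - P \<rho> ((A ^^ n) f)"
    by auto
qed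

end

context complex_nonneg_op
begin

text \<open>Off \<open>M \<rho>\<close> each power of \<open>A\<close> gains at least
  \<open>\<rho> - 1\<close>, and \<open>\<rho> - 1 \<ge> \<rho> / 2\<close> for
  \<open>\<rho> \<ge> 2\<close>.\<close>

lemma P_compl_decay:
  assumes r: "\<rho> \<ge> 2" and f: "f \<in> dom_pow D A n"
  shows "norm (f - P \<rho> f) \<le> (2 / \<rho>) ^ n * norm ((A ^^ n) f)"
  using f
proof (induction n arbitrary: f)
  case 0
  show ?case using P_compl_norm[of \<rho> f] r by simp
next
  case (Suc n)
  have r0: "\<rho> > 0" using r by simp
  interpret P: bounded_linear "P \<rho>" by (rule P_bounded_linear[OF r0])
  from Suc.prems have fD: "f \<in> D" and Af: "A f \<in> dom_pow D A n" by auto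
  have "P \<rho> (f - P \<rho> f) = 0" by (simp add: P.diff P_id[OF r0 P_M[OF r0]])
  moreover have "f - P \<rho> f \<in> D" by (intro subspace_diff[OF subD] fD M_dom[OF P_M[OF r0]])
  ultimately have "(\<rho> - 1) * norm (f - P \<rho> f) \<le> norm (A (f - P \<rho> f))"
    using r by (intro shift_lower_bound) auto
  moreover have "(\<rho> / 2) * norm (f - P \<rho> f) \<le> (\<rho> - 1) * norm (f - P \<rho> f)"
    using r by (intro mult_right_mono) auto
  moreover have "norm (A (f - P \<rho> f)) \<le> (2 / \<rho>) ^ n * norm ((A ^^ n) (A f))"
    using fD Suc.IH[OF Af] by (simp add: A_diff P_A[OF r0] M_dom[OF P_M[OF r0]])
  ultimately have "(\<rho> / 2) * norm (f - P \<rho> f) \<le> (2 / \<rho>) ^ n * norm ((A ^^ n) (A f))" by linarith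
  then have "(2 / \<rho>) * ((\<rho> / 2) * norm (f - P \<rho> f)) \<le> (2 / \<rho>) * ((2 / \<rho>) ^ n * norm ((A ^^ n) (A f)))"
    using r by (intro mult_left_mono) auto
  then show ?case using r by (simp add: funpow_swap1 mult.assoc)
qed

text \<open>The competitor is the entire solution starting at \<open>P \<rho> (y 0)\<close>;
  contractivity, for the difference and for its image under \<open>A ^^ k1\<close>, reduces all
  times to time \<open>0\<close>. \<open>K\<close> depends on neither \<open>\<rho>\<close> nor
  \<open>n\<close>, so \<open>n\<close> may later be chosen for each \<open>\<rho>\<close>.\<close>

lemma best_approx_upper:
  assumes B: "B_between D A k1 e j" and y: "weak_sol D A y" and f: "\<And>n. y 0 \<in> dom_pow D A n"
  obtains K where "K \<ge> 0" and "\<And>\<rho> n. \<rho> \<ge> 2 \<Longrightarrow> best_approx J D A e j y \<rho> \<le>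
    ereal (K * ((2 / \<rho>) ^ n * (norm ((A ^^ n) (y 0)) + norm ((A ^^ (n + k1)) (y 0)))))"
proof -
  obtain C where C: "\<And>g. g \<in> dom_pow D A k1 \<Longrightarrow> norm (THE b. j b = e g) \<le> C * Hpos_norm A k1 g"
    and ran: "\<And>g. g \<in> dom_pow D A k1 \<Longrightarrow> e g \<in> range j"
    using B unfolding B_between_def by blast
  define K where "K = max C 0"
  have bound: "best_approx J D A e j y \<rho> \<le>
    ereal (K * ((2 / \<rho>) ^ n * (norm ((A ^^ n) (y 0)) + norm ((A ^^ (n + k1)) (y 0)))))" if r: "\<rho> \<ge> 2" for \<rho> n
  proof -
    have r0: "\<rho> > 0" using r by simp
    obtain y0 where y0: "y0 \<in> S0_le J D A \<rho>" "y0 0 = P \<rho> (y 0)"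
      using entire_solution[OF r0 P_M[OF r0]] by blast
    then have "weak_sol D A y0" by (simp add: S0_le_def)
    then have d: "weak_sol D A (\<lambda>s. y s - y0 s)" by (rule weak_sol_diff[OF y])
    have d0: "y 0 - y0 0 \<in> dom_pow D A n" for n unfolding y0(2) by (rule P_compl_power(1)[OF r0 f])
    have "Bnorm e j (y s - y0 s) \<le>
      ereal (K * ((2 / \<rho>) ^ n * (norm ((A ^^ n) (y 0)) + norm ((A ^^ (n + k1)) (y 0)))))" if s: "s \<ge> 0" for s
    proof -
      let ?d = "y s - y0 s"
      have dk: "?d \<in> dom_pow D A k1" using weak_sol_power[OF d d0] s by blast
      have "Hpos_norm A k1 ?d \<le> norm ?d + norm ((A ^^ k1) ?d)"
        unfolding Hpos_norm_def by (rule sqrt_sum_squares_le_sum) auto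
      also have "\<dots> \<le> norm (y 0 - y0 0) + norm ((A ^^ k1) (y 0 - y0 0))"
        using weak_sol_power_norm[OF d d0 s, of 0] weak_sol_power_norm[OF d d0 s, of k1] by simp
      also have "norm (y 0 - y0 0) \<le> (2 / \<rho>) ^ n * norm ((A ^^ n) (y 0))"
        unfolding y0(2) by (rule P_compl_decay[OF r f])
      also have "norm ((A ^^ k1) (y 0 - y0 0)) \<le> (2 / \<rho>) ^ n * norm ((A ^^ (n + k1)) (y 0))"
      proof -
        have "(A ^^ k1) (y 0) \<in> dom_pow D A n" using f[of "k1 + n"] unfolding dom_pow_add by simp
        from P_compl_decay[OF r this] show ?thesis
          unfolding y0(2) P_compl_power(2)[OF r0 f] funpow_add o_def .
      qed
      finally have H: "Hpos_norm A k1 ?d \<le> (2 / \<rho>) ^ n * (norm ((A ^^ n) (y 0)) + norm ((A ^^ (n + k1)) (y 0)))"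
        by (simp add: distrib_left)
      have "norm (THE b. j b = e ?d) \<le> K * Hpos_norm A k1 ?d"
      proof -
        have "C * Hpos_norm A k1 ?d \<le> K * Hpos_norm A k1 ?d"
          unfolding K_def by (intro mult_right_mono) (auto simp: Hpos_norm_def)
        then show ?thesis using C[OF dk] by linarith
      qed
      also have "\<dots> \<le> K * ((2 / \<rho>) ^ n * (norm ((A ^^ n) (y 0)) + norm ((A ^^ (n + k1)) (y 0))))"
        by (intro mult_left_mono H) (simp add: K_def)
      finally have "norm (THE b. j b = e ?d) \<le> K * ((2 / \<rho>) ^ n * (norm ((A ^^ n) (y 0)) + norm ((A ^^ (n + k1)) (y 0))))" .
      moreover have "\<exists>b. j b = e ?d" using ran[OF dk] by (metis imageE)
      ultimately show ?thesis by (simp only: Bnorm_def if_True ereal_less_eq)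
    qed
    then have "(SUP s\<in>{0..}. Bnorm e j (y s - y0 s)) \<le>
      ereal (K * ((2 / \<rho>) ^ n * (norm ((A ^^ n) (y 0)) + norm ((A ^^ (n + k1)) (y 0)))))"
      by (intro SUP_least) simp
    then show ?thesis unfolding best_approx_def by (rule INF_lower2[OF y0(1)])
  qed
  show ?thesis by (rule that[OF _ bound]) (simp add: K_def)
qed

lemma P_Rpow: "\<rho> > 0 \<Longrightarrow> P \<rho> ((R ^^ k) x) = (R ^^ k) (P \<rho> x)"
  by (induction k) (simp_all add: P_R)

text \<open>A near-optimal competitor starts in \<open>M (8 * (r + 1))\<close>, hence in
  \<open>M (16 * r)\<close>, and is annihilated by the complementary projection. Only the error at
  time \<open>0\<close> remains, measured in the norm of \<open>R ^^ k2\<close> that the embedding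
  into the completion controls.\<close>

lemma best_approx_lower:
  assumes B: "B_between D A k1 e j" and H: "is_Hneg_completion D A k2 e"
  obtains K where "K \<ge> 0" and "\<And>r c. r \<ge> 1 \<Longrightarrow> c > 0 \<Longrightarrow> best_approx J D A e j y r \<le> ereal c \<Longrightarrow>
    norm ((R ^^ k2) (y 0 - P (16 * r) (y 0))) \<le> K * c"
proof -
  obtain C where C: "\<And>b. norm (j b) \<le> C * norm b" and inj: "inj j"
    using B unfolding B_between_def by blast
  have e: "norm (e f) = norm ((R ^^ k2) f)" for f
    using H unfolding is_Hneg_completion_def R_def by blast
  define K where "K = 2 * max C 0"
  have "norm ((R ^^ k2) (y 0 - P (16 * r) (y 0))) \<le> K * c"
    if r: "r \<ge> 1" and c: "c > 0" and le: "best_approx J D A e j y r \<le> ereal c" for r c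
  proof -
    have r0: "16 * r > 0" using r by simp
    interpret P: bounded_linear "P (16 * r)" by (rule P_bounded_linear[OF r0])
    \<comment> \<open>The infimum need not be attained; doubling the positive \<open>c\<close> makes
      room for a competitor.\<close>
    have "best_approx J D A e j y r < ereal (2 * c)"
      using le c by (simp add: le_less_trans)
    then obtain y0 where y0: "y0 \<in> S0_le J D A r" "(SUP s\<in>{0..}. Bnorm e j (y s - y0 s)) < ereal (2 * c)"
      unfolding best_approx_def INF_less_iff by blast
    have "Bnorm e j (y 0 - y0 0) \<le> (SUP s\<in>{0..}. Bnorm e j (y s - y0 s))"
      by (rule SUP_upper) simp
    then have lt: "Bnorm e j (y 0 - y0 0) < ereal (2 * c)" using y0(2) by (rule le_less_trans)
    then have "\<exists>b. j b = e (y 0 - y0 0)" unfolding Bnorm_def by (cases "\<exists>b. j b = e (y 0 - y0 0)") auto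
    then obtain b where b: "j b = e (y 0 - y0 0)" by blast
    have the: "(THE b. j b = e (y 0 - y0 0)) = b"
    proof (rule the_equality[of "\<lambda>b. j b = e (y 0 - y0 0)", OF b])
      fix b' assume "j b' = e (y 0 - y0 0)"
      then show "b' = b" using b injD[OF inj, of b' b] by simp
    qed
    have "Bnorm e j (y 0 - y0 0) = ereal (norm b)"
      unfolding Bnorm_def the using b by (simp only: if_P exI[of _ b])
    then have nb: "norm b < 2 * c" using lt by simp
    define u where "u = (R ^^ k2) (y 0 - y0 0)"
    have "norm u = norm (j b)" by (simp add: u_def e b)
    also have "\<dots> \<le> max C 0 * norm b"
      using C[of b] mult_right_mono[of C "max C 0" "norm b"] by simp
    also have "\<dots> \<le> max C 0 * (2 * c)" using nb by (intro mult_left_mono) auto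
    finally have nu: "norm u \<le> K * c" by (simp add: K_def mult_ac)
    have "y0 0 \<in> M (8 * (r + 1))" by (rule S0_le_M[OF y0(1)]) (use r in simp)
    moreover have "M (8 * (r + 1)) \<subseteq> M (16 * r)" using r by (intro M_mono) auto
    ultimately have "P (16 * r) (y0 0) = y0 0" by (intro P_id[OF r0]) auto
    then have "y 0 - P (16 * r) (y 0) = (y 0 - y0 0) - P (16 * r) (y 0 - y0 0)" by (simp add: P.diff)
    then have "(R ^^ k2) (y 0 - P (16 * r) (y 0)) = u - P (16 * r) u"
      by (simp only: u_def linear_simps(2)[OF Rpow_bounded_linear, of k2 "y 0 - y0 0" "P (16 * r) (y 0 - y0 0)"]
          P_Rpow[OF r0])
    then show ?thesis using P_compl_norm[OF r0, of u] nu by simp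
  qed
  then show ?thesis by (intro that[of K]) (auto simp: K_def)
qed

text \<open>\<open>f\<close> is the limit of \<open>P (16 * 2 ^ i) f\<close>, hence a low-frequency
  part plus dyadic blocks. On each block \<open>A\<close> and the inverse of \<open>R\<close> are
  bounded by the block's upper frequency, so negative-norm decay turns into norm bounds for powers
  of \<open>A\<close>.\<close>

lemma dyadic_bound:
  assumes dec: "\<And>i. i \<ge> i0 \<Longrightarrow> norm ((R ^^ k) (f - P (16 * 2 ^ i) f)) \<le> c / (2 ^ i) ^ (n + k + 1)"
  shows "f \<in> dom_pow D A n" and "norm ((A ^^ n) f) \<le> (16 * 2 ^ i0) ^ n * norm f + 2 * 32 ^ (n + k) * c"
proof -
  define \<sigma> where "\<sigma> i = 16 * (2::real) ^ i" for i :: nat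
  have \<sigma>: "\<sigma> i > 0" "\<sigma> i \<ge> 1" "\<sigma> i \<le> \<sigma> (Suc i)" "\<sigma> (Suc i) = 32 * 2 ^ i" for i
  proof -
    have "(1::real) \<le> 2 ^ i" by (rule one_le_power) simp
    then show "\<sigma> i \<ge> 1" unfolding \<sigma>_def by linarith
  qed (simp_all add: \<sigma>_def)
  define x where "x i = P (\<sigma> i) f" for i
  define d where "d i = x (Suc i) - x i" for i
  have xM: "x i \<in> M (\<sigma> i)" for i unfolding x_def by (rule P_M[OF \<sigma>(1)])
  have xM': "x i \<in> M (\<sigma> (Suc i))" for i using xM M_mono[OF \<sigma>(1) \<sigma>(3)] by blast
  have dM: "d i \<in> M (\<sigma> (Suc i))" for i unfolding d_def by (intro subspace_diff[OF M_subspace] xM xM')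
  have c0: "c \<ge> 0"
  proof -
    have "0 \<le> c / (2 ^ i0) ^ (n + k + 1)" using dec[of i0] norm_ge_zero order_trans by blast
    then show ?thesis by (rule contrapos_pp) (simp add: not_le divide_neg_pos)
  qed
  have d_norm: "norm (d i) \<le> \<sigma> (Suc i) ^ k * (c / (2 ^ i) ^ (n + k + 1))" if i: "i \<ge> i0" for i
  proof -
    interpret P: bounded_linear "P (\<sigma> (Suc i))" by (rule P_bounded_linear[OF \<sigma>(1)])
    \<comment> \<open>As a projection of the remainder \<open>f - x i\<close>, the block inherits
      the assumed decay after \<open>R ^^ k\<close>; \<open>M_bound\<close> then removes
      \<open>R ^^ k\<close> at the price \<open>\<sigma> (Suc i) ^ k\<close>.\<close>
    have "d i = P (\<sigma> (Suc i)) (f - x i)"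
      using P_id[OF \<sigma>(1) xM'] by (simp add: d_def P.diff) (simp add: x_def)
    then have Rd: "(R ^^ k) (d i) = P (\<sigma> (Suc i)) ((R ^^ k) (f - x i))" by (simp add: P_Rpow[OF \<sigma>(1)])
    then have "norm ((R ^^ k) (d i)) \<le> norm ((R ^^ k) (f - x i))" by (simp add: P_norm[OF \<sigma>(1)])
    also have "\<dots> \<le> c / (2 ^ i) ^ (n + k + 1)" using dec[OF i] by (simp only: x_def \<sigma>_def)
    finally have le: "norm ((R ^^ k) (d i)) \<le> c / (2 ^ i) ^ (n + k + 1)" .
    have "norm (d i) \<le> \<sigma> (Suc i) ^ k * norm ((R ^^ k) (d i))"
      by (rule M_bound[OF \<sigma>(1) _ refl]) (use P_M[OF \<sigma>(1)] Rd in simp)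
    also have "\<dots> \<le> \<sigma> (Suc i) ^ k * (c / (2 ^ i) ^ (n + k + 1))"
      using \<sigma>(1)[of "Suc i"] by (intro mult_left_mono le) simp
    finally show ?thesis .
  qed
  define b where "b = 32 ^ (n + k) * c"
  \<comment> \<open>At most \<open>n\<close> factors \<open>\<sigma> (Suc i) = 32 * 2 ^ i\<close>
    come from \<open>A\<close> and \<open>k\<close> from removing \<open>R ^^ k\<close>. Against the
    exponent \<open>n + k + 1\<close> one factor \<open>(1/2) ^ i\<close> survives.\<close>
  have Ad_norm: "norm ((A ^^ l) (d i)) \<le> b * (1/2) ^ i" if i: "i \<ge> i0" and l: "l \<le> n" for i l
  proof -
    have "norm ((A ^^ l) (d i)) \<le> norm (d i) * \<sigma> (Suc i) ^ l" by (rule M_A_power_norm[OF \<sigma>(1) dM])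
    also have "\<dots> \<le> (\<sigma> (Suc i) ^ k * (c / (2 ^ i) ^ (n + k + 1))) * \<sigma> (Suc i) ^ n"
      using l c0 \<sigma>(1)[of "Suc i"] by (intro mult_mono d_norm[OF i] power_increasing \<sigma>(2)) auto
    also have "\<dots> = \<sigma> (Suc i) ^ (n + k) * (c / (2 ^ i) ^ (n + k + 1))" by (simp add: power_add)
    also have "\<dots> = b * (1/2) ^ i"
      unfolding \<sigma>(4) b_def power_mult_distrib power_add power_one_right by (simp add: field_simps)
    finally show ?thesis .
  qed
  have hs: "(\<lambda>i. b * (1/2) ^ (i0 + i)) sums (b * ((1/2) ^ i0 * 2))"
  proof -
    have "(\<lambda>i. b * ((1/2) ^ i0 * (1/2) ^ i)) sums (b * ((1/2) ^ i0 * (1 / (1 - 1/2))))"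
      by (intro sums_mult geometric_sums) simp
    then show ?thesis by (simp add: power_add)
  qed
  define s where "s l = (\<Sum>i. (A ^^ l) (d (i0 + i)))" for l
  have ssums: "(\<lambda>i. (A ^^ l) (d (i0 + i))) sums s l" if l: "l \<le> n" for l
  proof -
    have "summable (\<lambda>i. norm ((A ^^ l) (d (i0 + i))))"
      by (rule summable_comparison_test'[OF sums_summable[OF hs]]) (use Ad_norm[OF _ l] in simp)
    then show ?thesis unfolding s_def by (rule summable_sums[OF summable_norm_complete])
  qed
  have A_diff_pow: "(A ^^ l) (u - v) = (A ^^ l) u - (A ^^ l) v" if "u \<in> M \<rho>" "v \<in> M \<rho>" for l u v \<rho>
    by (induction l) (use that in \<open>auto simp: A_diff M_dom[OF M_A_power]\<close>)
  have x_sum: "(A ^^ l) (x (i0 + N)) = (A ^^ l) (x i0) + (\<Sum>i<N. (A ^^ l) (d (i0 + i)))" for l N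
  proof (induction N)
    case (Suc N)
    have "(A ^^ l) (d (i0 + N)) = (A ^^ l) (x (Suc (i0 + N))) - (A ^^ l) (x (i0 + N))"
      unfolding d_def by (rule A_diff_pow[OF xM xM'])
    then show ?case using Suc by simp
  qed simp
  define v where "v l = (A ^^ l) (x i0) + s l" for l
  have lim: "(\<lambda>N. (A ^^ l) (x (i0 + N))) \<longlonglongrightarrow> v l" if "l \<le> n" for l
    unfolding x_sum v_def using ssums[OF that] unfolding sums_def by (intro tendsto_intros)
  \<comment> \<open>Closedness of \<open>A\<close> is used one power at a time; therefore all orders
    \<open>l \<le> n\<close>, not just \<open>n\<close>, had to be summed.\<close>
  have Av: "v l \<in> D \<and> A (v l) = v (Suc l)" if l: "Suc l \<le> n" for l
  proof -
    have D: "(A ^^ l) (x (i0 + N)) \<in> D" for N by (rule M_dom[OF M_A_power[OF xM]])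
    have "(\<lambda>N. A ((A ^^ l) (x (i0 + N)))) \<longlonglongrightarrow> v (Suc l)" using lim[OF l] by simp
    from A_closed[OF D lim this] l show ?thesis by simp
  qed
  have v0: "v 0 = f"
  proof (rule LIMSEQ_unique)
    show "(\<lambda>N. x (i0 + N)) \<longlonglongrightarrow> v 0" using lim[of 0] by simp
    have "x \<longlonglongrightarrow> f"
    proof (rule Lim_null_comparison[THEN LIM_zero_cancel])
      have "norm (x i - f) \<le> norm (P (real (Suc i)) f - f)" for i
      proof -
        have "real (Suc i) \<le> \<sigma> i"
          using of_nat_less_two_power[of i, where 'a = real] one_le_power[of "2::real" i]
          unfolding \<sigma>_def by linarith
        then show ?thesis
          using P_mono_compl_norm[of "real (Suc i)" "\<sigma> i" f] by (simp add: x_def norm_minus_commute)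
      qed
      then show "\<forall>\<^sub>F i in sequentially. norm (x i - f) \<le> norm (P (real (Suc i)) f - f)" by simp
      show "(\<lambda>i. norm (P (real (Suc i)) f - f)) \<longlonglongrightarrow> 0"
        using P_tendsto[of f] by (simp only: tendsto_norm_zero_iff LIM_zero_iff)
    qed
    then show "(\<lambda>N. x (i0 + N)) \<longlonglongrightarrow> f"
      using LIMSEQ_ignore_initial_segment[of x f i0] by (simp add: add.commute)
  qed
  have "f \<in> dom_pow D A l \<and> (A ^^ l) f = v l" if "l \<le> n" for l
    using that
  proof (induction l)
    case (Suc l)
    then show ?case using dom_pow_add[of f l 1] Av[of l] by simp
  qed (simp add: v0)
  then have fn: "f \<in> dom_pow D A n" "(A ^^ n) f = v n" by auto
  show "f \<in> dom_pow D A n" by (rule fn)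
  have "norm (s n) \<le> b * ((1/2) ^ i0 * 2)"
    by (rule norm_le_sums[OF ssums[OF order_refl] hs]) (use Ad_norm in simp)
  also have "\<dots> \<le> b * (1 * 2)"
    using c0 by (intro mult_left_mono mult_right_mono power_le_one) (auto simp: b_def)
  finally have "norm (s n) \<le> 2 * b" by simp
  moreover have "norm ((A ^^ n) (x i0)) \<le> \<sigma> i0 ^ n * norm f"
  proof -
    have "norm ((A ^^ n) (x i0)) \<le> norm (x i0) * \<sigma> i0 ^ n" by (rule M_A_power_norm[OF \<sigma>(1) xM])
    also have "\<dots> \<le> norm f * \<sigma> i0 ^ n"
      using P_norm[OF \<sigma>(1), of i0 f] \<sigma>(1)[of i0] unfolding x_def by (intro mult_right_mono) auto
    finally show ?thesis by (simp add: mult.commute)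
  qed
  ultimately show "norm ((A ^^ n) f) \<le> (16 * 2 ^ i0) ^ n * norm f + 2 * 32 ^ (n + k) * c"
    unfolding fn(2) v_def b_def \<sigma>_def using norm_triangle_ineq[of "(A ^^ n) (x i0)" "s n"]
    by (simp add: b_def \<sigma>_def)
qed

end

section \<open>Weight sequences: shifting the index and comparison with \<open>tau\<close>\<close>

lemma shift_weights:
  fixes m :: "nat \<Rightarrow> real"
  assumes pos: "\<forall>n. m n > 0" and ii: "\<exists>c>0. \<exists>h>1. \<forall>n. m (Suc n) \<le> c * h ^ n * m n"
  shows "\<exists>C>0. \<exists>H\<ge>1. \<forall>n. m (n + p) \<le> C * H ^ n * m n"
proof (induction p)
  case 0 show ?case by (intro exI[of _ 1]) auto
next
  case (Suc p)
  then obtain C H where C: "C > 0" "H \<ge> 1" "\<And>n. m (n + p) \<le> C * H ^ n * m n" by blast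
  obtain c h where c: "c > 0" "h > 1" "\<And>n. m (Suc n) \<le> c * h ^ n * m n" using ii by blast
  have "m (n + Suc p) \<le> (c * h ^ p * C) * (h * H) ^ n * m n" for n
  proof -
    have "m (n + Suc p) \<le> c * h ^ (n + p) * m (n + p)" using c(3)[of "n + p"] by simp
    also have "\<dots> \<le> c * h ^ (n + p) * (C * H ^ n * m n)" using c by (intro mult_left_mono C) auto
    finally show ?thesis by (simp add: power_add power_mult_distrib mult_ac)
  qed
  moreover have "h * H \<ge> 1" using c(2) C(2) mult_mono[of 1 h 1 H] by simp
  moreover have "c * h ^ p * C > 0" using c C by simp
  ultimately show ?case by blast
qed

locale weights =
  fixes m :: "nat \<Rightarrow> real"
  assumes m_pos: "\<And>n. m n > 0" and m_i: "\<And>\<alpha>. \<alpha> > 0 \<Longrightarrow> \<exists>c>0. \<forall>n. m n \<ge> c * \<alpha> ^ n"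
begin

lemma tau_summable:
  assumes x: "x \<ge> 0" shows "summable (\<lambda>n. x ^ n / m n)"
proof -
  define a where "a = 2 * x + 1"
  have a: "a > 0" "x / a \<le> 1/2" using x by (auto simp: a_def field_simps)
  obtain c where c: "c > 0" "\<And>n. m n \<ge> c * a ^ n" using m_i[OF a(1)] by blast
  have "norm (x ^ n / m n) \<le> (1 / c) * (1/2) ^ n" for n
  proof -
    have "x ^ n / m n \<le> x ^ n / (c * a ^ n)"
      using c a m_pos x by (intro divide_left_mono) auto
    also have "\<dots> = (1 / c) * (x / a) ^ n" by (simp add: power_divide)
    also have "\<dots> \<le> (1 / c) * (1/2) ^ n" using a x c by (intro mult_left_mono power_mono) auto
    finally show ?thesis using x m_pos[of n] by (simp add: less_imp_le)
  qed
  note le = this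
  have "summable (\<lambda>n. (1 / c) * (1/2) ^ n)"
    by (intro summable_mult summable_geometric) simp
  then show ?thesis by (rule summable_comparison_test') (rule le)
qed

lemma tau_ge: "x \<ge> 0 \<Longrightarrow> x ^ n / m n \<le> tau m x"
  unfolding tau_def using sum_le_suminf[OF tau_summable, of x "{n}"] m_pos
  by (simp add: less_imp_le)

lemma tau_pos: "x \<ge> 0 \<Longrightarrow> tau m x > 0"
  by (rule less_le_trans[of 0 "1 / m 0"]) (use tau_ge[of x 0] m_pos[of 0] in simp_all)

lemma inverse_tau_le: "x > 0 \<Longrightarrow> 1 / tau m x \<le> m n / x ^ n"
  using tau_ge[of x n] m_pos[of n] tau_pos[of x] by (simp add: field_simps)

text \<open>Together with \<open>inverse_tau_le\<close> this shows that \<open>1 / tau\<close> and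
  the infimum of \<open>m n / x ^ n\<close> agree up to constants and halving of the argument. If
  every \<open>x ^ n / m n\<close> were below a third of \<open>tau m (x / 2)\<close>, the factors
  \<open>(1/2) ^ n\<close> would sum the series to at most two thirds of itself.\<close>

lemma tau_half_attained:
  assumes x: "x > 0" shows "\<exists>n. m n / x ^ n \<le> 3 / tau m (x / 2)"
proof (rule ccontr)
  let ?t = "tau m (x / 2)"
  assume "\<not> ?thesis"
  then have lt: "3 / ?t < m n / x ^ n" for n by (simp add: not_le)
  have t: "?t > 0" using tau_pos[of "x / 2"] x by simp
  have le: "(x / 2) ^ n / m n \<le> ?t / 3 * (1/2) ^ n" for n
  proof -
    have "x ^ n / m n \<le> ?t / 3" using lt[of n] t x m_pos[of n] by (simp add: field_simps)
    then have "x ^ n / m n * (1/2) ^ n \<le> ?t / 3 * (1/2) ^ n" by (intro mult_right_mono) auto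
    then show ?thesis by (simp add: power_divide mult.commute)
  qed
  have gs: "(\<lambda>n. ?t / 3 * (1/2) ^ n) sums (?t / 3 * (1 / (1 - 1/2)))"
    by (intro sums_mult geometric_sums) simp
  have "?t \<le> (\<Sum>n. ?t / 3 * (1/2) ^ n)"
    unfolding tau_def[of m "x / 2"]
    by (rule suminf_le[OF le[unfolded tau_def] tau_summable]) (use x gs[unfolded tau_def] in \<open>auto simp: sums_iff\<close>)
  also have "\<dots> = ?t / 3 * 2" using sums_unique[OF gs] by simp
  finally show False using t by simp
qed

end

section \<open>The three smoothness classes and their approximation rates\<close>

context complex_nonneg_op
begin

lemma C_infty_dom_pow:
  assumes y: "weak_sol D A y"
  shows "C_infty y \<longleftrightarrow> (\<forall>n. y 0 \<in> dom_pow D A n)"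
  unfolding C_infty_def using derivs_on_weak_sol[OF y, of _ 0] weak_sol_derivs_on[OF y] by auto

text \<open>Derivatives of \<open>y\<close> are, up to sign, the functions
  \<open>(A ^^ k) (y t)\<close>, whose norms are largest at time \<open>0\<close>.\<close>

lemma C_alpha_iff:
  assumes y: "weak_sol D A y"
  shows "C_alpha m \<alpha> y \<longleftrightarrow>
    (\<forall>n. y 0 \<in> dom_pow D A n) \<and> (\<exists>c>0. \<forall>k. norm ((A ^^ k) (y 0)) \<le> c * m k * \<alpha> ^ k)"
proof
  assume "C_alpha m \<alpha> y"
  then obtain Dy c where Dy: "derivs_on y Dy" and c: "c > 0" "\<And>k t. t \<ge> 0 \<Longrightarrow> norm (Dy k t) \<le> c * m k * \<alpha> ^ k"
    unfolding C_alpha_def by blast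
  from derivs_on_weak_sol[OF y Dy, of 0]
  have *: "y 0 \<in> dom_pow D A n" "(A ^^ n) (y 0) = (- 1) ^ n *\<^sub>R Dy n 0" for n by auto
  then have "norm ((A ^^ k) (y 0)) \<le> c * m k * \<alpha> ^ k" for k
    using c(2)[of 0 k] by simp
  then show "(\<forall>n. y 0 \<in> dom_pow D A n) \<and> (\<exists>c>0. \<forall>k. norm ((A ^^ k) (y 0)) \<le> c * m k * \<alpha> ^ k)"
    using * c(1) by blast
next
  assume r: "(\<forall>n. y 0 \<in> dom_pow D A n) \<and> (\<exists>c>0. \<forall>k. norm ((A ^^ k) (y 0)) \<le> c * m k * \<alpha> ^ k)"
  then obtain c where y0: "\<And>n. y 0 \<in> dom_pow D A n" and c: "c > 0" "\<And>k. norm ((A ^^ k) (y 0)) \<le> c * m k * \<alpha> ^ k"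
    by blast
  have "norm ((- 1) ^ k *\<^sub>R (A ^^ k) (y t)) \<le> c * m k * \<alpha> ^ k" if "t \<ge> 0" for k t
    using weak_sol_power_norm[OF y y0 that, of k] c(2)[of k] by simp
  then show "C_alpha m \<alpha> y"
    unfolding C_alpha_def using weak_sol_derivs_on[OF y y0] c(1)
    by (intro exI[of _ "\<lambda>n t. (- 1) ^ n *\<^sub>R (A ^^ n) (y t)"]) blast
qed

end

text \<open>The threshold is a power of two to match the dyadic blocks, and the constant is made
  positive because \<open>best_approx_lower\<close> asks for \<open>c > 0\<close>.\<close>

lemma bigO_topE:
  assumes "bigO_top E g" and "\<And>r. r \<ge> 1 \<Longrightarrow> g r \<ge> 0"
  obtains C i0 where "C > 0" and "\<And>r. r \<ge> 2 ^ i0 \<Longrightarrow> E r \<le> ereal (C * g r)"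
proof -
  obtain C where "eventually (\<lambda>r. E r \<le> ereal (C * g r)) at_top"
    using assms(1) unfolding bigO_top_def by blast
  then obtain r0 where r0: "\<And>r. r \<ge> r0 \<Longrightarrow> E r \<le> ereal (C * g r)" by (auto simp: eventually_at_top_linorder)
  obtain i0 where i0: "r0 < 2 ^ i0" using real_arch_pow[of 2 r0] by auto
  show ?thesis
  proof (rule that[of "max C 1" i0])
    fix r :: real assume r: "r \<ge> 2 ^ i0"
    have "(1::real) \<le> 2 ^ i0" by (rule one_le_power) simp
    then have "g r \<ge> 0" using r by (intro assms(2)) linarith
    then have "C * g r \<le> max C 1 * g r" by (intro mult_right_mono) auto
    then have "ereal (C * g r) \<le> ereal (max C 1 * g r)" by simp
    then show "E r \<le> ereal (max C 1 * g r)" using r0[of r] r i0 by (meson order_trans less_imp_le)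
  qed simp
qed

locale approximation_setup = complex_nonneg_op J D A
  for J :: "'h::{real_inner, complete_space} \<Rightarrow> 'h" and D A +
  fixes k1 k2 :: nat and e :: "'h \<Rightarrow> 'c::banach" and j :: "'b::banach \<Rightarrow> 'c" and y :: "real \<Rightarrow> 'h"
  assumes Hneg: "is_Hneg_completion D A k2 e" and B: "B_between D A k1 e j"
    and y: "weak_sol D A y"
begin

abbreviation best :: "real \<Rightarrow> ereal" where "best \<equiv> best_approx J D A e j y"

lemma smooth_if_decay:
  assumes C: "C > 0" and dec: "\<And>r. r \<ge> 2 ^ i0 \<Longrightarrow> best r \<le> ereal (C / r ^ (n + k2 + 1))"
  shows "y 0 \<in> dom_pow D A n"
proof -
  obtain K where K: "K \<ge> 0" "\<And>r c. r \<ge> 1 \<Longrightarrow> c > 0 \<Longrightarrow> best r \<le> ereal c \<Longrightarrow>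
      norm ((R ^^ k2) (y 0 - P (16 * r) (y 0))) \<le> K * c"
    using best_approx_lower[OF B Hneg] by blast
  show ?thesis
  proof (rule dyadic_bound(1)[where ?i0.0 = i0 and k = k2 and c = "K * C"])
    fix i assume "i \<ge> i0"
    then have i: "(2::real) ^ i0 \<le> 2 ^ i" by (intro power_increasing) auto
    have "norm ((R ^^ k2) (y 0 - P (16 * 2 ^ i) (y 0))) \<le> K * (C / (2 ^ i) ^ (n + k2 + 1))"
      using dec[OF i] C by (intro K(2)) auto
    then show "norm ((R ^^ k2) (y 0 - P (16 * 2 ^ i) (y 0))) \<le> K * C / (2 ^ i) ^ (n + k2 + 1)" by simp
  qed
qed

theorem C_infty_iff:
  "C_infty y \<longleftrightarrow> (\<forall>\<alpha>>0. bigO_top best (\<lambda>r. r powr (- \<alpha>)))"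
proof
  assume "C_infty y"
  then have f: "y 0 \<in> dom_pow D A n" for n using C_infty_dom_pow[OF y] by blast
  obtain K where K: "K \<ge> 0" "\<And>\<rho> n. \<rho> \<ge> 2 \<Longrightarrow> best \<rho> \<le>
      ereal (K * ((2 / \<rho>) ^ n * (norm ((A ^^ n) (y 0)) + norm ((A ^^ (n + k1)) (y 0)))))"
    using best_approx_upper[OF B y f] by blast
  show "\<forall>\<alpha>>0. bigO_top best (\<lambda>r. r powr (- \<alpha>))"
  proof (intro allI impI)
    fix \<alpha> :: real assume "\<alpha> > 0"
    obtain n :: nat where n: "\<alpha> \<le> real n" using real_arch_simple by blast
    define S where "S = norm ((A ^^ n) (y 0)) + norm ((A ^^ (n + k1)) (y 0))"
    have "best r \<le> ereal ((K * 2 ^ n * S) * r powr (- \<alpha>))" if r: "r \<ge> 2" for r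
    proof -
      have "1 / r ^ n = r powr (- real n)" using r by (simp add: powr_minus powr_realpow divide_inverse)
      also have "\<dots> \<le> r powr (- \<alpha>)" using n r by (intro powr_mono) auto
      finally have "(K * 2 ^ n * S) * (1 / r ^ n) \<le> (K * 2 ^ n * S) * r powr (- \<alpha>)"
        using K(1) by (intro mult_left_mono) (auto simp: S_def)
      moreover have "K * ((2 / r) ^ n * S) = (K * 2 ^ n * S) * (1 / r ^ n)" by (simp add: power_divide)
      ultimately have "ereal (K * ((2 / r) ^ n * S)) \<le> ereal ((K * 2 ^ n * S) * r powr (- \<alpha>))" by simp
      then show ?thesis using K(2)[OF r, of n] unfolding S_def by (meson order_trans)
    qed
    then show "bigO_top best (\<lambda>r. r powr (- \<alpha>))"
      unfolding bigO_top_def eventually_at_top_linorder by blast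
  qed
next
  assume O: "\<forall>\<alpha>>0. bigO_top best (\<lambda>r. r powr (- \<alpha>))"
  have "y 0 \<in> dom_pow D A n" for n
  proof -
    let ?N = "n + k2 + 1"
    have "bigO_top best (\<lambda>r. r powr (- real ?N))" by (rule O[rule_format]) simp
    then obtain C i0 where C: "C > 0" "\<And>r. r \<ge> 2 ^ i0 \<Longrightarrow> best r \<le> ereal (C * r powr (- real ?N))"
      by (rule bigO_topE) auto
    show ?thesis
    proof (rule smooth_if_decay[OF C(1)])
      fix r :: real assume r: "r \<ge> 2 ^ i0"
      have "(0::real) < 2 ^ i0" by simp
      then have "r > 0" using r by linarith
      then have "r powr (- real ?N) = 1 / r ^ ?N" by (simp only: powr_minus powr_realpow divide_inverse mult_1_left)
      then show "best r \<le> ereal (C / r ^ ?N)" using C(2)[OF r] by simp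
    qed
  qed
  then show "C_infty y" using C_infty_dom_pow[OF y] by blast
qed

end

locale weighted_approximation_setup = approximation_setup J D A k1 k2 e j y + weights m
  for J :: "'h::{real_inner, complete_space} \<Rightarrow> 'h" and D A k1 k2
    and e :: "'h \<Rightarrow> 'c::banach" and j :: "'b::banach \<Rightarrow> 'c" and y m +
  assumes m_ii: "\<exists>c>0. \<exists>h>1. \<forall>n. m (Suc n) \<le> c * h ^ n * m n"
begin

text \<open>\<open>H\<close> is independent of \<open>\<alpha>\<close>, which is what lets one
  estimate serve both the union and the intersection over \<open>\<alpha>\<close>.\<close>

lemma best_approx_if_C_alpha:
  shows "\<exists>H>0. \<forall>\<alpha>>0. C_alpha m \<alpha> y \<longrightarrow> bigO_top best (\<lambda>r. 1 / tau m (r / (H * \<alpha>)))"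
proof -
  obtain Cp H where Cp: "Cp > 0" "H \<ge> 1" "\<And>n. m (n + k1) \<le> Cp * H ^ n * m n"
    using shift_weights[of m k1] m_pos m_ii by blast
  have "bigO_top best (\<lambda>r. 1 / tau m (r / (4 * H * \<alpha>)))" if a: "\<alpha> > 0" and Ca: "C_alpha m \<alpha> y" for \<alpha>
  proof -
    obtain c where f: "\<And>n. y 0 \<in> dom_pow D A n" and c: "c > 0" "\<And>k. norm ((A ^^ k) (y 0)) \<le> c * m k * \<alpha> ^ k"
      using Ca unfolding C_alpha_iff[OF y] by blast
    obtain K where K: "K \<ge> 0" "\<And>\<rho> n. \<rho> \<ge> 2 \<Longrightarrow> best \<rho> \<le>
        ereal (K * ((2 / \<rho>) ^ n * (norm ((A ^^ n) (y 0)) + norm ((A ^^ (n + k1)) (y 0)))))"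
      using best_approx_upper[OF B y f] by blast
    define K' where "K' = K * (c * (1 + Cp * \<alpha> ^ k1))"
    have K': "K' \<ge> 0" using K(1) c(1) Cp(1) a by (simp add: K'_def)
    have "best r \<le> ereal (3 * K' * (1 / tau m (r / (4 * H * \<alpha>))))" if r: "r \<ge> 2" for r
    proof -
      \<comment> \<open>The 2 comes from \<open>P_compl_decay\<close> and \<open>H\<close> from
        shifting the index by \<open>k1\<close>; passing to \<open>x / 2\<close> in
        \<open>tau_half_attained\<close> produces the final \<open>4 * H\<close>.\<close>
      define x where "x = r / (2 * H * \<alpha>)"
      have x: "x > 0" using r Cp a by (simp add: x_def)
      obtain n where n: "m n / x ^ n \<le> 3 / tau m (x / 2)" using tau_half_attained[OF x] by blast
      have "norm ((A ^^ n) (y 0)) + norm ((A ^^ (n + k1)) (y 0)) \<le> c * (1 + Cp * \<alpha> ^ k1) * (m n * (H * \<alpha>) ^ n)"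
      proof -
        have "norm ((A ^^ n) (y 0)) \<le> c * m n * \<alpha> ^ n" by (rule c(2))
        also have "\<dots> = c * m n * \<alpha> ^ n * 1" by simp
        also have "\<dots> \<le> c * m n * \<alpha> ^ n * H ^ n"
          using c(1) m_pos[of n] a Cp(2) by (intro mult_left_mono one_le_power) (auto simp: less_imp_le)
        finally have 1: "norm ((A ^^ n) (y 0)) \<le> c * (m n * (H * \<alpha>) ^ n)" by (simp add: power_mult_distrib mult_ac)
        have "norm ((A ^^ (n + k1)) (y 0)) \<le> c * m (n + k1) * \<alpha> ^ (n + k1)" by (rule c(2))
        also have "\<dots> \<le> c * (Cp * H ^ n * m n) * \<alpha> ^ (n + k1)"
          using c(1) a by (intro mult_right_mono mult_left_mono Cp(3)) auto
        finally have 2: "norm ((A ^^ (n + k1)) (y 0)) \<le> c * (Cp * \<alpha> ^ k1) * (m n * (H * \<alpha>) ^ n)"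
          by (simp add: power_mult_distrib power_add mult_ac)
        show ?thesis using 1 2 by (simp add: algebra_simps)
      qed
      then have "K * ((2 / r) ^ n * (norm ((A ^^ n) (y 0)) + norm ((A ^^ (n + k1)) (y 0))))
          \<le> K * ((2 / r) ^ n * (c * (1 + Cp * \<alpha> ^ k1) * (m n * (H * \<alpha>) ^ n)))"
        using K(1) r by (intro mult_left_mono) auto
      also have "\<dots> = K' * (m n * ((2 / r) ^ n * (H * \<alpha>) ^ n))" by (simp add: K'_def mult_ac)
      also have "(2 / r) ^ n * (H * \<alpha>) ^ n = 1 / x ^ n"
        by (simp add: x_def power_mult_distrib[symmetric] power_divide[symmetric] mult_ac flip: power_one_over)
      also have "K' * (m n * (1 / x ^ n)) \<le> K' * (3 / tau m (x / 2))"
        using n K' by (intro mult_left_mono) auto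
      also have "x / 2 = r / (4 * H * \<alpha>)" by (simp add: x_def)
      finally have "K * ((2 / r) ^ n * (norm ((A ^^ n) (y 0)) + norm ((A ^^ (n + k1)) (y 0))))
          \<le> 3 * K' * (1 / tau m (r / (4 * H * \<alpha>)))" by (simp add: mult.commute)
      then have "ereal (K * ((2 / r) ^ n * (norm ((A ^^ n) (y 0)) + norm ((A ^^ (n + k1)) (y 0)))))
          \<le> ereal (3 * K' * (1 / tau m (r / (4 * H * \<alpha>))))" by (simp only: ereal_less_eq)
      then show ?thesis by (rule order_trans[OF K(2)[OF r]])
    qed
    then show ?thesis unfolding bigO_top_def eventually_at_top_linorder by blast
  qed
  then show ?thesis using Cp(2) by (intro exI[of _ "4 * H"]) auto
qed

text \<open>Again \<open>H\<close> is uniform. The intersection case uses the hypothesis at scale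
  \<open>H / \<beta>\<close> for a prescribed \<open>\<beta>\<close>, the union case takes
  \<open>\<beta> = H / \<alpha>\<close>.\<close>

lemma C_alpha_if_best_approx:
  shows "\<exists>H>0. \<forall>\<alpha>>0. \<forall>\<beta>. bigO_top best (\<lambda>r. 1 / tau m (\<alpha> * r)) \<longrightarrow> H / \<alpha> \<le> \<beta> \<longrightarrow> C_alpha m \<beta> y"
proof -
  obtain Cp H where Cp: "Cp > 0" "H \<ge> 1" "\<And>n. m (n + (k2 + 1)) \<le> Cp * H ^ n * m n"
    using shift_weights[of m "k2 + 1"] m_pos m_ii by blast
  obtain K where K: "K \<ge> 0" "\<And>r c. r \<ge> 1 \<Longrightarrow> c > 0 \<Longrightarrow> best r \<le> ereal c \<Longrightarrow>
      norm ((R ^^ k2) (y 0 - P (16 * r) (y 0))) \<le> K * c"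
    using best_approx_lower[OF B Hneg] by blast
  have "C_alpha m \<beta> y" if a: "\<alpha> > 0" and O: "bigO_top best (\<lambda>r. 1 / tau m (\<alpha> * r))" and b: "32 * H / \<alpha> \<le> \<beta>" for \<alpha> \<beta>
  proof -
    have b0: "\<beta> > 0"
    proof -
      have "32 * H / \<alpha> > 0" using a Cp(2) by simp
      then show ?thesis using b by linarith
    qed
    obtain C i0 where C: "C > 0" "\<And>r. r \<ge> 2 ^ i0 \<Longrightarrow> best r \<le> ereal (C * (1 / tau m (\<alpha> * r)))"
      by (rule bigO_topE[OF O]) (use a tau_pos in \<open>auto simp: less_imp_le\<close>)
    \<comment> \<open>Bounding \<open>1 / tau\<close> by its term of index \<open>n + k2 + 1\<close>
      produces exactly the decay that \<open>dyadic_bound\<close> expects. The constant depends on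
      \<open>n\<close>, but the threshold \<open>i0\<close> does not.\<close>
    define c where "c n = K * C * m (n + k2 + 1) / \<alpha> ^ (n + k2 + 1)" for n
    have dec: "norm ((R ^^ k2) (y 0 - P (16 * 2 ^ i) (y 0))) \<le> c n / (2 ^ i) ^ (n + k2 + 1)" if "i \<ge> i0" for i n
    proof -
      have i: "(2::real) ^ i0 \<le> 2 ^ i" using that by (intro power_increasing) auto
      have t: "\<alpha> * 2 ^ i > 0" using a by simp
      have "norm ((R ^^ k2) (y 0 - P (16 * 2 ^ i) (y 0))) \<le> K * (C * (1 / tau m (\<alpha> * 2 ^ i)))"
        using C(2)[OF i] C(1) tau_pos[of "\<alpha> * 2 ^ i"] t by (intro K(2)) auto
      also have "\<dots> \<le> K * (C * (m (n + k2 + 1) / (\<alpha> * 2 ^ i) ^ (n + k2 + 1)))"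
        using K(1) C(1) by (intro mult_left_mono inverse_tau_le t) auto
      also have "\<dots> = c n / (2 ^ i) ^ (n + k2 + 1)" by (simp only: c_def power_mult_distrib) simp
      finally show ?thesis .
    qed
    define s where "s = 16 * (2::real) ^ i0"
    have f: "y 0 \<in> dom_pow D A n" and bd: "norm ((A ^^ n) (y 0)) \<le> s ^ n * norm (y 0) + 2 * 32 ^ (n + k2) * c n" for n
      using dyadic_bound[where ?i0.0 = i0 and k = k2 and f = "y 0" and n = n and c = "c n", OF dec] by (auto simp: s_def)
    \<comment> \<open>The low-frequency part grows only geometrically, like \<open>s ^ n\<close>;
      condition (i) at the rate \<open>s / \<beta>\<close> absorbs it into
      \<open>m n * \<beta> ^ n\<close>, however small \<open>\<beta>\<close> is.\<close>
    obtain c0 where c0: "c0 > 0" "\<And>n. m n \<ge> c0 * (s / \<beta>) ^ n"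
      using m_i[of "s / \<beta>"] b0 by (auto simp: s_def)
    define G where "G = norm (y 0) / c0 + 2 * 32 ^ k2 * K * C * Cp / \<alpha> ^ (k2 + 1) + 1"
    have G: "G > 0" unfolding G_def using c0 K(1) C(1) Cp(1) a by (intro add_nonneg_pos add_nonneg_nonneg) auto
    have "norm ((A ^^ n) (y 0)) \<le> G * m n * \<beta> ^ n" for n
    proof -
      have "s ^ n = (s / \<beta>) ^ n * \<beta> ^ n" using b0 by (simp add: power_divide)
      also have "(s / \<beta>) ^ n \<le> m n / c0" using c0(2)[of n] c0(1) by (simp add: field_simps)
      finally have "s ^ n \<le> m n / c0 * \<beta> ^ n" using b0 by (simp add: mult_right_mono)
      then have "s ^ n * norm (y 0) \<le> m n / c0 * \<beta> ^ n * norm (y 0)" by (intro mult_right_mono) auto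
      then have 1: "s ^ n * norm (y 0) \<le> norm (y 0) / c0 * (m n * \<beta> ^ n)" by (simp add: mult_ac)
      have "2 * 32 ^ (n + k2) * c n \<le> 2 * 32 ^ (n + k2) * (K * C * (Cp * H ^ n * m n) / \<alpha> ^ (n + k2 + 1))"
        unfolding c_def using K(1) C(1) a Cp(3)[of n]
        by (intro mult_left_mono divide_right_mono) (auto simp: add.assoc)
      also have "\<dots> = (2 * 32 ^ k2 * K * C * Cp / \<alpha> ^ (k2 + 1)) * (m n * (32 * H / \<alpha>) ^ n)"
        by (simp add: power_add power_mult_distrib power_divide mult_ac)
      also have "\<dots> \<le> (2 * 32 ^ k2 * K * C * Cp / \<alpha> ^ (k2 + 1)) * (m n * \<beta> ^ n)"
        using K(1) C(1) Cp a m_pos[of n] b by (intro mult_left_mono power_mono) (auto simp: less_imp_le)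
      finally have 2: "2 * 32 ^ (n + k2) * c n \<le> (2 * 32 ^ k2 * K * C * Cp / \<alpha> ^ (k2 + 1)) * (m n * \<beta> ^ n)" .
      have "norm ((A ^^ n) (y 0)) \<le> norm (y 0) / c0 * (m n * \<beta> ^ n)
          + (2 * 32 ^ k2 * K * C * Cp / \<alpha> ^ (k2 + 1)) * (m n * \<beta> ^ n) + 1 * (m n * \<beta> ^ n)"
        using bd[of n] 1 2 m_pos[of n] b0 by (simp add: add_increasing2)
      also have "\<dots> = G * m n * \<beta> ^ n" unfolding G_def distrib_right by simp
      finally show ?thesis .
    qed
    then show ?thesis unfolding C_alpha_iff[OF y] using f G by blast
  qed
  then show ?thesis using Cp(2) by (intro exI[of _ "32 * H"]) auto
qed

theorem C_roumieu_iff: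
  "C_roumieu m y \<longleftrightarrow> (\<exists>\<alpha>>0. bigO_top best (\<lambda>r. 1 / tau m (\<alpha> * r)))"
proof
  assume "C_roumieu m y"
  then obtain \<alpha> where a: "\<alpha> > 0" "C_alpha m \<alpha> y" unfolding C_roumieu_def by blast
  obtain H where H: "H > 0" "\<And>\<alpha>. \<alpha> > 0 \<Longrightarrow> C_alpha m \<alpha> y \<Longrightarrow> bigO_top best (\<lambda>r. 1 / tau m (r / (H * \<alpha>)))"
    using best_approx_if_C_alpha by blast
  from H(2)[OF a] show "\<exists>\<alpha>>0. bigO_top best (\<lambda>r. 1 / tau m (\<alpha> * r))"
    using H(1) a(1) by (intro exI[of _ "1 / (H * \<alpha>)"]) simp
next
  assume "\<exists>\<alpha>>0. bigO_top best (\<lambda>r. 1 / tau m (\<alpha> * r))"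
  then obtain \<alpha> where a: "\<alpha> > 0" "bigO_top best (\<lambda>r. 1 / tau m (\<alpha> * r))" by blast
  obtain H where H: "H > 0" "\<And>\<alpha> \<beta>. \<alpha> > 0 \<Longrightarrow> bigO_top best (\<lambda>r. 1 / tau m (\<alpha> * r)) \<Longrightarrow> H / \<alpha> \<le> \<beta> \<Longrightarrow> C_alpha m \<beta> y"
    using C_alpha_if_best_approx by blast
  from H(2)[OF a order_refl] show "C_roumieu m y"
    unfolding C_roumieu_def using H(1) a(1) by (intro exI[of _ "H / \<alpha>"]) simp
qed

theorem C_beurling_iff:
  "C_beurling m y \<longleftrightarrow> (\<forall>\<alpha>>0. bigO_top best (\<lambda>r. 1 / tau m (\<alpha> * r)))"
proof
  assume b: "C_beurling m y"
  obtain H where H: "H > 0" "\<And>\<alpha>. \<alpha> > 0 \<Longrightarrow> C_alpha m \<alpha> y \<Longrightarrow> bigO_top best (\<lambda>r. 1 / tau m (r / (H * \<alpha>)))"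
    using best_approx_if_C_alpha by blast
  show "\<forall>\<alpha>>0. bigO_top best (\<lambda>r. 1 / tau m (\<alpha> * r))"
  proof (intro allI impI)
    fix \<alpha> :: real assume a: "\<alpha> > 0"
    have "bigO_top best (\<lambda>r. 1 / tau m (r / (H * (1 / (H * \<alpha>)))))"
      using b a H(1) unfolding C_beurling_def by (intro H(2)) auto
    then show "bigO_top best (\<lambda>r. 1 / tau m (\<alpha> * r))" using H(1) a by (simp add: mult.commute)
  qed
next
  assume O: "\<forall>\<alpha>>0. bigO_top best (\<lambda>r. 1 / tau m (\<alpha> * r))"
  obtain H where H: "H > 0" "\<And>\<alpha> \<beta>. \<alpha> > 0 \<Longrightarrow> bigO_top best (\<lambda>r. 1 / tau m (\<alpha> * r)) \<Longrightarrow> H / \<alpha> \<le> \<beta> \<Longrightarrow> C_alpha m \<beta> y"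
    using C_alpha_if_best_approx by blast
  show "C_beurling m y"
    unfolding C_beurling_def
  proof (intro allI impI)
    fix \<beta> :: real assume b: "\<beta> > 0"
    have p: "H / \<beta> > 0" using H(1) b by simp
    show "C_alpha m \<beta> y" by (rule H(2)[OF p O[rule_format, OF p]]) (use H(1) b in simp)
  qed
qed

end

theorem theorem7:
  fixes J :: "'h::{real_inner, complete_space} \<Rightarrow> 'h"
    and D :: "'h set" and A :: "'h \<Rightarrow> 'h"
    and k1 k2 :: nat
    and e :: "'h \<Rightarrow> 'c::banach" and j :: "'b::banach \<Rightarrow> 'c"
    and m :: "nat \<Rightarrow> real"
    and y :: "real \<Rightarrow> 'h"
  assumes J: "cplx_structure J"
    and A: "nonneg_selfadjoint J D A"
    and k: "k1 \<ge> 1" "k2 \<ge> 1"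
    and Hneg: "is_Hneg_completion D A k2 e"
    and B: "B_between D A k1 e j"
    and m_pos: "\<forall>n. m n > 0" and m_mono: "mono m"
    and m_i: "\<forall>\<alpha>>0. \<exists>c>0. \<forall>n. m n \<ge> c * \<alpha> ^ n"
    and m_ii: "\<exists>c>0. \<exists>h>1. \<forall>n. m (Suc n) \<le> c * h ^ n * m n"
    and y: "weak_sol D A y"
  shows "(C_infty y \<longleftrightarrow> (\<forall>\<alpha>>0. bigO_top (best_approx J D A e j y) (\<lambda>r. r powr (- \<alpha>))))
       \<and> (C_roumieu m y \<longleftrightarrow> (\<exists>\<alpha>>0. bigO_top (best_approx J D A e j y) (\<lambda>r. 1 / tau m (\<alpha> * r))))
       \<and> (C_beurling m y \<longleftrightarrow> (\<forall>\<alpha>>0. bigO_top (best_approx J D A e j y) (\<lambda>r. 1 / tau m (\<alpha> * r))))"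
proof -
  interpret complex_nonneg_op J D A by (rule complex_nonneg_opI[OF J A])
  interpret weighted_approximation_setup J D A k1 k2 e j y m
    by unfold_locales (use Hneg B y m_pos m_i m_ii in auto)
  show ?thesis using C_infty_iff C_roumieu_iff C_beurling_iff by blast
qed

end
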